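(* Let $\beta=1$ and $p=p(N)\in(0,1]$. (1) Assume that $p^4N^3\to\infty$ as $N\to\infty$. Then $L_N^1$, considered as a random element of $\mathcal M(\mathbb R)$, converges in probability to $\mathfrak M$, where $\mathfrak M\in\mathcal M(\mathbb R)$ is the probability measure with Lebesgue density $$\psi(x)=\frac{e^{-\frac1{12}x^4}}{\int_{\mathbb R}e^{-\frac1{12}y^4}\,dy}.$$ That is, for every $\varepsilon>0$, $\lim_{N\to\infty}\mathbb P[d_L(L_N^1,\mathfrak M)>\varepsilon]=0$. (2) Assume that $Np\to\infty$ and $p^4N^3\to\frac1{c^2}\in(0,\infty)$ as $N\to\infty$, where $c>0$. Then $L_N^1$, considered as a random element of $\mathcal M(\mathbb R)$, converges in probability to $\mathfrak L_c$, where $\mathfrak L_c\in\mathcal M(\mathbb R)$ is the probability measure with Lebesgue density $$\psi_c(x)=\frac{e^{-c\frac{x^2}{24}-\frac{x^4}{12}}}{\int_{\mathbb R}e^{-c\frac{y^2}{24}-\frac{y^4}{12}}\,dy}.$$ That is, for every $\varepsilon>0$, $\lim_{N\to\infty}\mathbb P[d_L(L_N^1,\mathfrak L_c)>\varepsilon]=0$. (3) Assume that $Np\to\infty$ and $p^4N^3\to0$ as $N\to\infty$. Then $L_N^3$, considered as a random element of $\mathcal M(\mathbb R)$, converges in probability to $\mathfrak N_{0,12}$, the centered normal distribution with variance $12$. That is, for every $\varepsilon>0$, $\lim_{N\to\infty}\mathbb P[d_L(L_N^3,\mathfrak N_{0,12})>\varepsilon]=0$.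
   Context: For each $N$ and $p=p(N)\in(0,1]$, let $(\varepsilon_{i,j})_{i,j=1}^N$ be independent random variables with $\mathbb P[\varepsilon_{i,j}=1]=p$ and $\mathbb P[\varepsilon_{i,j}=0]=1-p$ (indicators of the edges of a directed Erdős–Rényi graph; $i=j$ is allowed). For $\sigma\in\{-1,+1\}^N$ put $$H(\sigma)=-\frac1{2Np}\sum_{i,j=1}^N\varepsilon_{i,j}\sigma_i\sigma_j,\qquad Z_N(\beta)=\sum_{\sigma\in\{-1,+1\}^N}e^{-\beta H(\sigma)}.$$ $\mathcal M(\mathbb R)$ is the space of probability measures on $\mathbb R$ with the weak topology, metrized by the Lévy metric $$d_L(\mu_1,\mu_2)=\inf\{\varepsilon>0:\ \mu_1(-\infty,t-\varepsilon]-\varepsilon\le\mu_2(-\infty,t]\le\mu_1(-\infty,t+\varepsilon]+\varepsilon\ \text{ for all } t\in\mathbb R\}.$$ $L_N^1$ and $L_N^3$ are the random probability measures (functions of the $\varepsilon_{i,j}$) $$L_N^1=\frac1{Z_N(\beta)}\sum_{\sigma\in\{-1,+1\}^N}e^{-\beta H(\sigma)}\,\delta_{\frac1{N^{3/4}}\sum_{i=1}^N\sigma_i},\qquad L_N^3=\frac1{Z_N(\beta)}\sum_{\sigma\in\{-1,+1\}^N}e^{-\beta H(\sigma)}\,\delta_{\frac1{\sqrt{N^3p^2}}\sum_{i=1}^N\sigma_i},$$ taken at $\beta=1$, where $\delta_x$ is the Dirac measure at $x$. *)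

theory Defs
  imports "HOL-Probability.Probability"
begin

definition levy_dist :: "real measure \<Rightarrow> real measure \<Rightarrow> real" where
  "levy_dist \<mu>1 \<mu>2 = Inf {\<epsilon>. \<epsilon> > 0 \<and>
     (\<forall>t. measure \<mu>1 {..t - \<epsilon>} - \<epsilon> \<le> measure \<mu>2 {..t} \<and>
          measure \<mu>2 {..t} \<le> measure \<mu>1 {..t + \<epsilon>} + \<epsilon>)}"

text \<open>The random measures \<open>X N\<close> may live on a different probability space \<open>M N\<close> for each \<open>N\<close>;
  this is meaningful because the limit \<open>\<mu>\<close> is deterministic.\<close>

definition levy_tendsto_in_prob ::
  "(nat \<Rightarrow> 'a measure) \<Rightarrow> (nat \<Rightarrow> 'a \<Rightarrow> real measure) \<Rightarrow> real measure \<Rightarrow> bool" where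
  "levy_tendsto_in_prob M X \<mu> \<longleftrightarrow>
     (\<forall>\<epsilon>>0. (\<lambda>N. measure (M N) {\<omega> \<in> space (M N). levy_dist (X N \<omega>) \<mu> > \<epsilon>})
        \<longlonglongrightarrow> 0)"

text \<open>Spin configurations on the vertices \<open>1, \<dots>, N\<close>, extended by \<open>undefined\<close> outside; the
  argument \<open>e i j\<close> below is the (real-valued) indicator of the edge from \<open>i\<close> to \<open>j\<close>.\<close>

definition spins :: "nat \<Rightarrow> (nat \<Rightarrow> real) set" where
  "spins N = {1..N} \<rightarrow>\<^sub>E {-1, 1}"

definition hamiltonian :: "nat \<Rightarrow> real \<Rightarrow> (nat \<Rightarrow> nat \<Rightarrow> real) \<Rightarrow> (nat \<Rightarrow> real) \<Rightarrow> real" where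
  "hamiltonian N p e \<sigma> =
     - (1 / (2 * real N * p)) * (\<Sum>i=1..N. \<Sum>j=1..N. e i j * \<sigma> i * \<sigma> j)"

definition partition_fun :: "real \<Rightarrow> nat \<Rightarrow> real \<Rightarrow> (nat \<Rightarrow> nat \<Rightarrow> real) \<Rightarrow> real" where
  "partition_fun \<beta> N p e = (\<Sum>\<sigma>\<in>spins N. exp (- \<beta> * hamiltonian N p e \<sigma>))"

text \<open>The measure \<open>(1 / Z) \<Sum>\<^sub>\<sigma> exp (- \<beta> H(\<sigma>)) \<delta>\<^bsub>s \<Sum>\<^sub>i \<sigma>\<^sub>i\<^esub>\<close> with a general scaling factor \<open>s\<close>.\<close>

definition magnetization_law ::
  "real \<Rightarrow> real \<Rightarrow> nat \<Rightarrow> real \<Rightarrow> (nat \<Rightarrow> nat \<Rightarrow> real) \<Rightarrow> real measure" where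
  "magnetization_law s \<beta> N p e = measure_of UNIV (sets borel)
     (\<lambda>A. \<Sum>\<sigma>\<in>spins N. ennreal (exp (- \<beta> * hamiltonian N p e \<sigma>) / partition_fun \<beta> N p e) *
            emeasure (return borel (s * (\<Sum>i=1..N. \<sigma> i))) A)"

definition L1 :: "real \<Rightarrow> nat \<Rightarrow> real \<Rightarrow> (nat \<Rightarrow> nat \<Rightarrow> real) \<Rightarrow> real measure" where
  "L1 \<beta> N p e = magnetization_law (1 / real N powr (3/4)) \<beta> N p e"

definition L3 :: "real \<Rightarrow> nat \<Rightarrow> real \<Rightarrow> (nat \<Rightarrow> nat \<Rightarrow> real) \<Rightarrow> real measure" where
  "L3 \<beta> N p e = magnetization_law (1 / sqrt (real N ^ 3 * p\<^sup>2)) \<beta> N p e"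

lemma finite_spins: "finite (spins N)"
  unfolding spins_def by (intro finite_PiE) auto

lemma spins_nonempty: "spins N \<noteq> {}"
  unfolding spins_def by (simp add: PiE_eq_empty_iff)

lemma partition_fun_pos: "partition_fun \<beta> N p e > 0"
  unfolding partition_fun_def by (intro sum_pos finite_spins spins_nonempty) auto

lemma sets_magnetization_law [simp, measurable_cong]:
  "sets (magnetization_law s \<beta> N p e) = sets borel"
  unfolding magnetization_law_def
  using sets.sigma_sets_eq[of "borel :: real measure"] by simp

lemma space_magnetization_law [simp]: "space (magnetization_law s \<beta> N p e) = UNIV"
  using sets_eq_imp_space_eq[OF sets_magnetization_law] by simp

lemma emeasure_magnetization_law:
  assumes "A \<in> sets borel"
  shows "emeasure (magnetization_law s \<beta> N p e) A =
    (\<Sum>\<sigma>\<in>spins N. ennreal (exp (- \<beta> * hamiltonian N p e \<sigma>) / partition_fun \<beta> N p e) *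
       emeasure (return borel (s * (\<Sum>i=1..N. \<sigma> i))) A)"
proof (rule emeasure_measure_of[OF magnetization_law_def])
  let ?m = "\<lambda>A. \<Sum>\<sigma>\<in>spins N.
    ennreal (exp (- \<beta> * hamiltonian N p e \<sigma>) / partition_fun \<beta> N p e) *
       emeasure (return borel (s * (\<Sum>i=1..N. \<sigma> i))) A"
  show "positive (sets (magnetization_law s \<beta> N p e)) ?m"
    by (simp add: positive_def)
  show "countably_additive (sets (magnetization_law s \<beta> N p e)) ?m"
    unfolding sets_magnetization_law
  proof (rule countably_additiveI)
    fix F :: "nat \<Rightarrow> real set"
    assume F: "range F \<subseteq> sets borel" "disjoint_family F" "\<Union> (range F) \<in> sets borel"
    have "(\<Sum>n. ?m (F n)) = (\<Sum>\<sigma>\<in>spins N. \<Sum>n.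
        ennreal (exp (- \<beta> * hamiltonian N p e \<sigma>) / partition_fun \<beta> N p e) *
       emeasure (return borel (s * (\<Sum>i=1..N. \<sigma> i))) (F n))"
      by (rule suminf_sum) simp
    also have "\<dots> = ?m (\<Union> (range F))"
    proof (rule sum.cong[OF refl])
      fix \<sigma>
      have "(\<Sum>n. emeasure (return borel (s * (\<Sum>i=1..N. \<sigma> i))) (F n)) =
          emeasure (return borel (s * (\<Sum>i=1..N. \<sigma> i))) (\<Union> (range F))"
        using F by (intro suminf_emeasure) auto
      then show "(\<Sum>n. ennreal (exp (- \<beta> * hamiltonian N p e \<sigma>) / partition_fun \<beta> N p e) *
           emeasure (return borel (s * (\<Sum>i=1..N. \<sigma> i))) (F n)) =
         ennreal (exp (- \<beta> * hamiltonian N p e \<sigma>) / partition_fun \<beta> N p e) *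
           emeasure (return borel (s * (\<Sum>i=1..N. \<sigma> i))) (\<Union> (range F))"
        by (simp add: ennreal_suminf_cmult)
    qed
    finally show "(\<Sum>n. ?m (F n)) = ?m (\<Union> (range F))" .
  qed
qed (use assms in auto)

lemma prob_space_magnetization_law: "prob_space (magnetization_law s \<beta> N p e)"
proof
  have "emeasure (magnetization_law s \<beta> N p e) UNIV =
    (\<Sum>\<sigma>\<in>spins N. ennreal (exp (- \<beta> * hamiltonian N p e \<sigma>) / partition_fun \<beta> N p e))"
    by (simp add: emeasure_magnetization_law)
  also have "\<dots> = ennreal (\<Sum>\<sigma>\<in>spins N.
      exp (- \<beta> * hamiltonian N p e \<sigma>) / partition_fun \<beta> N p e)"
    using partition_fun_pos[of \<beta> N p e] by (intro sum_ennreal) simp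
  also have "(\<Sum>\<sigma>\<in>spins N. exp (- \<beta> * hamiltonian N p e \<sigma>) / partition_fun \<beta> N p e) = 1"
    using partition_fun_pos[of \<beta> N p e]
    by (simp add: sum_divide_distrib[symmetric] partition_fun_def)
  finally show "emeasure (magnetization_law s \<beta> N p e) (space (magnetization_law s \<beta> N p e)) = 1"
    by simp
qed

definition quartic_law :: "real measure" where
  "quartic_law = density lborel
     (\<lambda>x. ennreal (exp (- (1/12) * x ^ 4) / (LINT y|lborel. exp (- (1/12) * y ^ 4))))"

definition quartic_law_tilted :: "real \<Rightarrow> real measure" where
  "quartic_law_tilted c = density lborel
     (\<lambda>x. ennreal (exp (- c * (x\<^sup>2 / 24) - x ^ 4 / 12) /
                   (LINT y|lborel. exp (- c * (y\<^sup>2 / 24) - y ^ 4 / 12))))"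

definition centered_normal :: "real \<Rightarrow> real measure" where
  "centered_normal v = density lborel (\<lambda>x. ennreal (normal_density 0 (sqrt v) x))"

lemma prob_space_normalized_density:
  fixes g :: "real \<Rightarrow> real"
  assumes g: "integrable lborel g" and pos: "\<And>x. g x > 0"
  shows "prob_space (density lborel (\<lambda>x. ennreal (g x / (LINT y|lborel. g y))))"
proof
  let ?I = "LINT y|lborel. g y"
  have [measurable]: "g \<in> borel_measurable lborel" using g by auto
  have ne: "?I \<noteq> 0"
  proof
    assume "?I = 0"
    then have "AE x in lborel. g x = 0"
      using integral_nonneg_eq_0_iff_AE[OF g] pos by (simp add: less_imp_le)
    then have "AE x in (lborel :: real measure). False"
      by eventually_elim (use pos in \<open>metis less_irrefl\<close>)
    then show False
      by (simp add: AE_iff_measurable[OF _ refl] emeasure_lborel_UNIV)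
  qed
  moreover have "?I \<ge> 0" using pos by (intro integral_nonneg_AE) (auto intro: less_imp_le)
  ultimately have I: "?I > 0" by simp
  have "(\<integral>\<^sup>+x. ennreal (g x / ?I) \<partial>lborel) = ennreal (LINT x|lborel. g x / ?I)"
    using g I pos by (intro nn_integral_eq_integral) (auto intro!: less_imp_le)
  also have "(LINT x|lborel. g x / ?I) = 1" using ne by simp
  finally show "emeasure (density lborel (\<lambda>x. ennreal (g x / ?I)))
      (space (density lborel (\<lambda>x. ennreal (g x / ?I)))) = 1"
    by (simp add: emeasure_density)
qed

lemma integrable_tilted:
  assumes "c \<ge> 0"
  shows "integrable lborel (\<lambda>x::real. exp (- c * (x\<^sup>2 / 24) - x ^ 4 / 12))"
proof (rule Bochner_Integration.integrable_bound)
  show "integrable lborel (\<lambda>x::real. exp (3/4) * sqrt (2 * pi) * normal_density 0 1 x)"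
    by (intro integrable_mult_right integrable_normal_density) auto
  show "AE x in lborel. norm (exp (- c * (x\<^sup>2 / 24) - x ^ 4 / 12)) \<le>
      norm (exp (3/4) * sqrt (2 * pi) * normal_density 0 1 (x::real))"
  proof (intro AE_I2)
    fix x :: real
    have "0 \<le> (x\<^sup>2 - 3)\<^sup>2" by simp
    then have "- c * (x\<^sup>2 / 24) - x ^ 4 / 12 \<le> 3/4 - x\<^sup>2 / 2"
      using mult_nonneg_nonneg[OF assms zero_le_power2[of x]]
      by (simp add: power2_diff field_simps)
    then have "exp (- c * (x\<^sup>2 / 24) - x ^ 4 / 12) \<le> exp (3/4) * exp (- x\<^sup>2 / 2)"
      by (simp add: exp_add[symmetric])
    then show "norm (exp (- c * (x\<^sup>2 / 24) - x ^ 4 / 12)) \<le>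
      norm (exp (3/4) * sqrt (2 * pi) * normal_density 0 1 x)"
      by (simp add: normal_density_def abs_mult)
  qed
qed simp

lemma prob_space_quartic_law_tilted: "c \<ge> 0 \<Longrightarrow> prob_space (quartic_law_tilted c)"
  unfolding quartic_law_tilted_def
  by (intro prob_space_normalized_density integrable_tilted) auto

lemma prob_space_quartic_law: "prob_space quartic_law"
  using prob_space_quartic_law_tilted[of 0]
  by (simp add: quartic_law_def quartic_law_tilted_def)

lemma prob_space_centered_normal: "v > 0 \<Longrightarrow> prob_space (centered_normal v)"
  unfolding centered_normal_def by (intro prob_space_normal_density) simp

end

theory Submission
  imports Defs "HOL-Real_Asymp.Real_Asymp"
begin

text \<open>The Gibbs measure is compared with an averaged model by a second moment argument, after a reduction
that makes the second moment small.

\<^bold>\<open>Reduction.\<close> With \<open>\<gamma> = 1 / (2 N p)\<close> and \<open>\<epsilon> \<in> {0, 1}\<close>, every edge contributes to \<open>exp (- H)\<close> the factor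
\<open>cosh (\<gamma> \<epsilon>) * (1 + \<epsilon> u tanh \<gamma>)\<close>, where \<open>u = \<sigma>\<^sub>i \<sigma>\<^sub>j\<close>. The hyperbolic cosines do not depend on the
configuration and cancel in the Gibbs measure (\<open>gibbs_weight_factorization\<close>). They carry the fluctuations
of the number of edges, which would spoil a second moment argument for \<open>exp (- H)\<close> itself when \<open>p\<close> is small.

\<^bold>\<open>Averaging.\<close> The remaining weight \<open>W(\<sigma>)\<close> has mean proportional to \<open>exp (b m\<^sup>2)\<close>, where \<open>m\<close> is the sum of
the spins and \<open>b = artanh (p tanh \<gamma>)\<close>. The averaged model is thus a Curie--Weiss model, critical for \<open>p = 1\<close>
and slightly subcritical for \<open>p < 1\<close>: the deficit \<open>1 - 2 N b\<close> is about \<open>\<gamma>\<^sup>2 / 3 = 1 / (12 N\<^sup>2 p\<^sup>2)\<close> for small \<open>p\<close>. Convolving the law of \<open>m\<close> with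
a Gaussian of variance \<open>1 / (2 b)\<close> gives the explicit density \<open>exp (- b y\<^sup>2) (cosh (2 b y))\<^sup>N\<close>, whose exponent is
approximately \<open>- y\<^sup>2 / (24 N\<^sup>3 p\<^sup>2) - y\<^sup>4 / (12 N\<^sup>3)\<close>. At scale \<open>N\<^bsup>3/4\<^esup>\<close> the quartic term survives, together
with the quadratic one exactly when \<open>p\<^sup>4 N\<^sup>3\<close> stays bounded; at scale \<open>N\<^bsup>3/2\<^esup> p\<close> and for \<open>p\<^sup>4 N\<^sup>3 \<rightarrow> 0\<close> only the
quadratic term is left, which is the density of a normal law with variance 12. The noise has standard deviation of
order \<open>sqrt N\<close> and is negligible at both scales because \<open>N p \<rightarrow> \<infinity>\<close>. The inequality
\<open>cosh_le_exp_quartic\<close> provides the integrable majorant (\<open>density_dominated\<close>, \<open>annealed_limit\<close>).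

\<^bold>\<open>Concentration.\<close> The ratio \<open>E[W(\<sigma>) W(\<tau>)] / (E[W(\<sigma>)] E[W(\<tau>)])\<close> is at least \<open>1 - 2 / (N p)\<close> and at most
about \<open>exp (R\<^sup>2 / (2 N\<^sup>2 p))\<close>, where \<open>R\<close> is the overlap of \<open>\<sigma>\<close> and \<open>\<tau>\<close> (\<open>pair_ratio_bounds\<close>). So it has to be
shown that the mean of \<open>exp (R\<^sup>2 / (2 N\<^sup>2 p))\<close> under two independent copies of the averaged model tends to one.
Linearizing \<open>R\<^sup>2\<close> and both \<open>m\<^sup>2\<close> by Gaussian fields makes all sites independent, and an application of
Hoeffding's lemma at each site leaves a one-dimensional integral with the additional weight
\<open>exp (tanh\<^sup>4 h / (2 p))\<close>, which tends to one (\<open>two_replica_partition_le\<close>, \<open>tilted_ratio_limit\<close>). Chebyshev's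
inequality then gives convergence in probability of the distribution function at any finite set of
points (\<open>gibbs_ratio_concentration\<close>), which suffices for the Levy distance (\<open>levy_dist_le_of_grid\<close>).

All three regimes are instances of \<open>magnetization_law_converges\<close>, with limit density proportional to
\<open>exp (- \<theta> x\<^sup>2 - \<Lambda> x\<^sup>4 / 12)\<close>.\<close>

section \<open>Inequalities for hyperbolic functions\<close>

lemma sq_le_sinh_sq: "(h::real)\<^sup>2 \<le> (sinh h)\<^sup>2"
proof -
  have *: "x \<le> sinh x" if "x \<ge> 0" for x :: real
  proof -
    have "(\<lambda>x::real. sinh x - x) 0 \<le> (\<lambda>x. sinh x - x) x"
      by (rule DERIV_nonneg_imp_nondecreasing[OF that])
         (auto intro!: exI derivative_eq_intros simp: cosh_real_ge_1)
    then show ?thesis by simp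
  qed
  have "\<bar>h\<bar> \<le> \<bar>sinh h\<bar>"
    using *[of h] *[of "-h"] by (cases "h \<ge> 0") auto
  then show ?thesis by (rule abs_le_square_iff[THEN iffD1])
qed

lemma tanh_sq_ge: "h\<^sup>2 / (1 + h\<^sup>2) \<le> (tanh (h::real))\<^sup>2"
proof -
  have "(tanh h)\<^sup>2 = (sinh h)\<^sup>2 / (1 + (sinh h)\<^sup>2)"
    by (simp add: tanh_def power_divide cosh_square_eq add.commute)
  also have "\<dots> \<ge> h\<^sup>2 / (1 + h\<^sup>2)"
    using sq_le_sinh_sq[of h]
    by (subst frac_le_eq) (auto simp: add_nonneg_eq_0_iff algebra_simps divide_le_0_iff)
  finally show ?thesis .
qed

text \<open>Since \<open>tanh' = 1 - tanh\<^sup>2\<close>, a lower bound on \<open>tanh\<^sup>2\<close> gives an upper bound on \<open>tanh\<close>; the rational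
function is chosen so that its derivative lies above the bound that \<open>tanh_sq_ge\<close> gives.\<close>

lemma tanh_le_rational:
  assumes "(h::real) \<ge> 0"
  shows "tanh h \<le> h - h^3 / (3 * (1 + h\<^sup>2))"
proof -
  let ?D = "\<lambda>h::real. h - h^3 / (3 * (1 + h\<^sup>2)) - tanh h"
  have "?D 0 \<le> ?D h"
  proof (rule DERIV_nonneg_imp_nondecreasing[OF assms])
    fix x :: real
    have pos: "1 + x\<^sup>2 > 0" by (simp add: add_pos_nonneg)
    have "((\<lambda>x. x^3 / (3 * (1 + x\<^sup>2))) has_real_derivative
        (3 * x\<^sup>2 * (3 * (1 + x\<^sup>2)) - x^3 * (3 * (2 * x))) / ((3 * (1 + x\<^sup>2)) * (3 * (1 + x\<^sup>2)))) (at x)"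
      using pos by (intro DERIV_divide) (auto intro!: derivative_eq_intros)
    also have "(3 * x\<^sup>2 * (3 * (1 + x\<^sup>2)) - x^3 * (3 * (2 * x))) / ((3 * (1 + x\<^sup>2)) * (3 * (1 + x\<^sup>2)))
        = (3 * x\<^sup>2 + x^4) / (3 * (1 + x\<^sup>2)\<^sup>2)"
      using pos by (simp add: divide_simps) (simp add: power_numeral_reduce algebra_simps)
    finally have D: "((\<lambda>x. x^3 / (3 * (1 + x\<^sup>2))) has_real_derivative
        (3 * x\<^sup>2 + x^4) / (3 * (1 + x\<^sup>2)\<^sup>2)) (at x)" .
    have "(?D has_real_derivative (1 - (3 * x\<^sup>2 + x^4) / (3 * (1 + x\<^sup>2)\<^sup>2) - (1 - (tanh x)\<^sup>2))) (at x)"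
      by (intro DERIV_diff D) (auto intro!: derivative_eq_intros)
    moreover have "(3 * x\<^sup>2 + x^4) / (3 * (1 + x\<^sup>2)\<^sup>2) \<le> x\<^sup>2 / (1 + x\<^sup>2)"
    proof -
      have "3 * x\<^sup>2 + x^4 \<le> 3 * (x\<^sup>2 * (1 + x\<^sup>2))"
        using zero_le_power2[of "x\<^sup>2"] by (simp add: power2_eq_square power4_eq_xxxx algebra_simps)
      then have "(3 * x\<^sup>2 + x^4) / (3 * (1 + x\<^sup>2)\<^sup>2) \<le> 3 * (x\<^sup>2 * (1 + x\<^sup>2)) / (3 * (1 + x\<^sup>2)\<^sup>2)"
        by (rule divide_right_mono) simp
      also have "\<dots> = x\<^sup>2 / (1 + x\<^sup>2)"
        using pos by (simp add: power2_eq_square)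
      finally show ?thesis .
    qed
    ultimately show "\<exists>y. (?D has_real_derivative y) (at x) \<and> 0 \<le> y"
      using tanh_sq_ge[of x] by (intro exI conjI) auto
  qed
  then show ?thesis by simp
qed

text \<open>Integrated form of the bound on \<open>tanh\<close>. The correction behaves like \<open>h\<^sup>4 / 12\<close> near zero, which is the
quartic term of the limit density, but only like \<open>h\<^sup>2\<close> at infinity, so that the inequality can hold for
all \<open>h\<close>. It is what makes dominated convergence possible.\<close>

lemma cosh_le_exp_quartic:
  "cosh (h::real) \<le> exp (h\<^sup>2 / 2 - h^4 / (12 * (1 + h\<^sup>2)))"
proof -
  have main: "ln (cosh h) \<le> h\<^sup>2 / 2 - h^4 / (12 * (1 + h\<^sup>2))" if "h \<ge> 0" for h :: real
  proof -
    let ?D = "\<lambda>h::real. h\<^sup>2 / 2 - h^4 / (12 * (1 + h\<^sup>2)) - ln (cosh h)"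
    have "?D 0 \<le> ?D h"
    proof (rule DERIV_nonneg_imp_nondecreasing[OF that])
      fix x :: real assume "0 \<le> x"
      have pos: "1 + x\<^sup>2 > 0" by (simp add: add_pos_nonneg)
      have "((\<lambda>x. x^4 / (12 * (1 + x\<^sup>2))) has_real_derivative
          (4 * x^3 * (12 * (1 + x\<^sup>2)) - x^4 * (12 * (2 * x))) / ((12 * (1 + x\<^sup>2)) * (12 * (1 + x\<^sup>2)))) (at x)"
        using pos by (intro DERIV_divide) (auto intro!: derivative_eq_intros)
      also have "(4 * x^3 * (12 * (1 + x\<^sup>2)) - x^4 * (12 * (2 * x))) / ((12 * (1 + x\<^sup>2)) * (12 * (1 + x\<^sup>2)))
          = (2 * x^3 + x^5) / (6 * (1 + x\<^sup>2)\<^sup>2)"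
        using pos by (simp add: divide_simps) (simp add: power_numeral_reduce algebra_simps)
      finally have D: "((\<lambda>x. x^4 / (12 * (1 + x\<^sup>2))) has_real_derivative
          (2 * x^3 + x^5) / (6 * (1 + x\<^sup>2)\<^sup>2)) (at x)" .
      have "(?D has_real_derivative (x - (2 * x^3 + x^5) / (6 * (1 + x\<^sup>2)\<^sup>2) - tanh x)) (at x)"
        by (intro DERIV_diff D) (auto intro!: derivative_eq_intros simp: cosh_real_pos tanh_def)
      moreover have "(2 * x^3 + x^5) / (6 * (1 + x\<^sup>2)\<^sup>2) \<le> x^3 / (3 * (1 + x\<^sup>2))"
      proof -
        have "2 * x^3 + x^5 \<le> 2 * (x^3 * (1 + x\<^sup>2))"
          using zero_le_power[OF \<open>0 \<le> x\<close>, of 5] by (simp add: power_numeral_reduce algebra_simps)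
        then have "(2 * x^3 + x^5) / (6 * (1 + x\<^sup>2)\<^sup>2) \<le> 2 * (x^3 * (1 + x\<^sup>2)) / (6 * (1 + x\<^sup>2)\<^sup>2)"
          by (rule divide_right_mono) simp
        also have "\<dots> = x^3 / (3 * (1 + x\<^sup>2))"
          using pos by (simp add: divide_simps power2_eq_square)
        finally show ?thesis .
      qed
      ultimately show "\<exists>y. (?D has_real_derivative y) (at x) \<and> 0 \<le> y"
        using tanh_le_rational[OF \<open>0 \<le> x\<close>] by (intro exI conjI) auto
    qed
    then show ?thesis by simp
  qed
  have "ln (cosh h) \<le> h\<^sup>2 / 2 - h^4 / (12 * (1 + h\<^sup>2))"
    using main[of h] main[of "-h"] by (cases "h \<ge> 0") auto
  then have "exp (ln (cosh h)) \<le> exp (h\<^sup>2 / 2 - h^4 / (12 * (1 + h\<^sup>2)))"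
    by (simp only: exp_le_cancel_iff)
  then show ?thesis by (simp add: cosh_real_pos)
qed

text \<open>The right-hand side has the shape of the correction in \<open>cosh_le_exp_quartic\<close>; a small multiple of
\<open>tanh\<^sup>4\<close>, which appears in the second moment, is therefore absorbed by that correction.\<close>

lemma tanh_power4_le: "(tanh (h::real))^4 \<le> 2 * (h^4 / (1 + h\<^sup>2))"
proof -
  have le1: "(tanh h)\<^sup>2 \<le> 1"
    using tanh_real_bounds[of h] by (simp add: abs_square_le_1 abs_le_iff)
  have leh: "(tanh h)\<^sup>2 \<le> h\<^sup>2"
  proof -
    have "\<bar>tanh h\<bar> \<le> \<bar>h\<bar>"
      using tanh_le_rational[of "\<bar>h\<bar>"] by (simp add: zero_le_divide_iff add_nonneg_nonneg order_trans[OF tanh_le_rational[of "\<bar>h\<bar>", unfolded tanh_real_abs]])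
    then show ?thesis by (rule abs_le_square_iff[THEN iffD1])
  qed
  have "(tanh h)^4 * (1 + h\<^sup>2) = (tanh h)\<^sup>2 * (tanh h)\<^sup>2 + (tanh h)\<^sup>2 * (tanh h)\<^sup>2 * h\<^sup>2"
    by (simp add: power2_eq_square power4_eq_xxxx algebra_simps)
  also have "\<dots> \<le> h\<^sup>2 * h\<^sup>2 + 1 * h\<^sup>2 * h\<^sup>2"
    using leh le1 by (intro add_mono mult_mono) auto
  finally have "(tanh h)^4 * (1 + h\<^sup>2) \<le> 2 * h^4"
    by (simp add: power2_eq_square power4_eq_xxxx)
  then show ?thesis by (simp add: pos_le_divide_eq add_pos_nonneg)
qed

lemma tanh_artanh: "\<bar>x\<bar> < 1 \<Longrightarrow> tanh (artanh x) = (x::real)"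
proof -
  assume x: "\<bar>x\<bar> < 1"
  have "exp (- 2 * artanh x) = inverse (exp (ln ((1 + x) / (1 - x))))"
    by (simp add: artanh_def exp_minus)
  also have "\<dots> = (1 - x) / (1 + x)"
    using x by (subst exp_ln) (auto simp: abs_less_iff)
  finally have *: "exp (- 2 * artanh x) = (1 - x) / (1 + x)" .
  show ?thesis unfolding tanh_real_altdef * using x by (simp add: divide_simps abs_less_iff)
qed

text \<open>Hoeffding's lemma for a variable with values \<open>\<plusminus>1\<close> and mean \<open>T\<close>. Writing \<open>T = tanh \<alpha>\<close>, the left-hand side
is \<open>cosh (g + \<alpha>) / cosh \<alpha>\<close>, and the claim says that \<open>ln cosh\<close> has second derivative at most one. The
constant one in front of the exponential matters: a second moment has to be compared with the
square of a first moment up to a factor that tends to one.\<close>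

lemma two_point_mgf_le:
  fixes T g :: real
  assumes "\<bar>T\<bar> < 1"
  shows "cosh g + T * sinh g \<le> exp (g * T + g\<^sup>2 / 2)"
proof -
  define \<alpha> where "\<alpha> = artanh T"
  have T: "T = tanh \<alpha>" unfolding \<alpha>_def using assms by (simp add: tanh_artanh)
  have tanh_sub: "tanh y - tanh x \<le> y - x" if "x \<le> y" for x y :: real
  proof -
    have "(\<lambda>z::real. z - tanh z) x \<le> (\<lambda>z. z - tanh z) y"
      by (rule DERIV_nonneg_imp_nondecreasing[OF that])
         (auto intro!: exI derivative_eq_intros)
    then show ?thesis by simp
  qed
  let ?D = "\<lambda>g. g * T + g\<^sup>2 / 2 + ln (cosh \<alpha>) - ln (cosh (g + \<alpha>))"
  have D: "(?D has_real_derivative (T + x - tanh (x + \<alpha>))) (at x)" for x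
    by (auto intro!: derivative_eq_intros simp: cosh_real_pos tanh_def)
  have "?D 0 \<le> ?D g"
  proof (cases "g \<ge> 0")
    case True
    show ?thesis
    proof (rule DERIV_nonneg_imp_nondecreasing[OF True])
      fix x :: real assume "0 \<le> x"
      then show "\<exists>y. (?D has_real_derivative y) (at x) \<and> 0 \<le> y"
        using tanh_sub[of \<alpha> "x + \<alpha>"]
          by (intro exI[of _ "T + x - tanh (x + \<alpha>)"] conjI D) (auto simp: T)
    qed
  next
    case False
    then have "g \<le> 0" by simp
    then show ?thesis
    proof (rule DERIV_nonpos_imp_nonincreasing)
      fix x :: real assume "x \<le> 0"
      then show "\<exists>y. (?D has_real_derivative y) (at x) \<and> y \<le> 0"
        using tanh_sub[of "x + \<alpha>" \<alpha>]
          by (intro exI[of _ "T + x - tanh (x + \<alpha>)"] conjI D) (auto simp: T)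
    qed
  qed
  then have "ln (cosh (g + \<alpha>)) \<le> g * T + g\<^sup>2 / 2 + ln (cosh \<alpha>)" by simp
  then have "exp (ln (cosh (g + \<alpha>))) \<le> exp (g * T + g\<^sup>2 / 2 + ln (cosh \<alpha>))"
    by (simp only: exp_le_cancel_iff)
  then have "cosh (g + \<alpha>) \<le> exp (g * T + g\<^sup>2 / 2) * cosh \<alpha>"
    by (simp add: exp_add cosh_real_pos)
  moreover have "cosh (g + \<alpha>) = (cosh g + T * sinh g) * cosh \<alpha>"
    by (simp add: cosh_add T tanh_def algebra_simps)
  ultimately show ?thesis by (simp add: cosh_real_pos)
qed

lemma ln_cosh_expansion: "((\<lambda>z::real. (ln (cosh z) - z\<^sup>2 / 2) / z^4) \<longlongrightarrow> -1/12) (at 0)"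
  unfolding cosh_field_def by real_asymp

lemma tanh_expansion: "((\<lambda>z::real. (tanh z / z - 1) / z\<^sup>2) \<longlongrightarrow> -1/3) (at 0)"
  unfolding tanh_real_altdef by real_asymp

lemma artanh_expansion: "((\<lambda>z::real. (artanh z / z - 1) / z\<^sup>2) \<longlongrightarrow> 1/3) (at 0)"
  unfolding artanh_def by real_asymp

section \<open>Sums over spin configurations\<close>

definition mag :: "nat \<Rightarrow> (nat \<Rightarrow> real) \<Rightarrow> real" where
  "mag N \<sigma> = (\<Sum>i=1..N. \<sigma> i)"

definition overlap :: "nat \<Rightarrow> (nat \<Rightarrow> real) \<Rightarrow> (nat \<Rightarrow> real) \<Rightarrow> real" where
  "overlap N \<sigma> \<tau> = (\<Sum>i=1..N. \<sigma> i * \<tau> i)"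

lemma spin_values: "\<sigma> \<in> spins N \<Longrightarrow> i \<in> {1..N} \<Longrightarrow> \<sigma> i = -1 \<or> \<sigma> i = 1"
  unfolding spins_def by (auto dest!: PiE_mem)

lemma sum_spins_prod:
  fixes f :: "nat \<Rightarrow> real \<Rightarrow> real"
  shows "(\<Sum>\<sigma>\<in>spins N. \<Prod>i\<in>{1..N}. f i (\<sigma> i)) = (\<Prod>i\<in>{1..N}. f i 1 + f i (-1))"
  unfolding spins_def by (subst prod_sum_PiE[symmetric]) (auto simp: add.commute)

lemma sum_spins_exp_mag: "(\<Sum>\<sigma>\<in>spins N. exp (h * mag N \<sigma>)) = (2 * cosh h) ^ N"
proof -
  have "(\<Sum>\<sigma>\<in>spins N. exp (h * mag N \<sigma>)) = (\<Sum>\<sigma>\<in>spins N. \<Prod>i\<in>{1..N}. exp (h * \<sigma> i))"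
    by (simp add: mag_def sum_distrib_left exp_sum)
  also have "\<dots> = (2 * cosh h) ^ N"
    by (subst sum_spins_prod) (simp add: cosh_field_def add_divide_distrib)
  finally show ?thesis .
qed

lemma sum_two_spins_exp:
  "(\<Sum>\<sigma>\<in>spins N. \<Sum>\<tau>\<in>spins N. exp (h * mag N \<sigma> + k * mag N \<tau> + g * overlap N \<sigma> \<tau>)) =
     (4 * (cosh h * cosh k * cosh g + sinh h * sinh k * sinh g)) ^ N"
proof -
  have "(\<Sum>\<tau>\<in>spins N. exp (h * mag N \<sigma> + k * mag N \<tau> + g * overlap N \<sigma> \<tau>)) =
      (\<Prod>i\<in>{1..N}. exp (h * \<sigma> i) * (exp (k + g * \<sigma> i) + exp (- (k + g * \<sigma> i))))" for \<sigma>
  proof -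
    have "(\<Sum>\<tau>\<in>spins N. exp (h * mag N \<sigma> + k * mag N \<tau> + g * overlap N \<sigma> \<tau>)) =
       (\<Sum>\<tau>\<in>spins N. \<Prod>i\<in>{1..N}. exp (h * \<sigma> i) * exp ((k + g * \<sigma> i) * \<tau> i))"
      by (simp add: mag_def overlap_def exp_sum[symmetric] exp_add[symmetric] sum.distrib[symmetric]
          sum_distrib_left algebra_simps)
    also have "\<dots> = (\<Prod>i\<in>{1..N}. exp (h * \<sigma> i) * exp (k + g * \<sigma> i) + exp (h * \<sigma> i) * exp (- (k + g * \<sigma> i)))"
      by (subst sum_spins_prod[of "\<lambda>i t. exp (h * \<sigma> i) * exp ((k + g * \<sigma> i) * t)"]) simp
    finally show ?thesis by (simp add: distrib_left)
  qed
  then have "(\<Sum>\<sigma>\<in>spins N. \<Sum>\<tau>\<in>spins N. exp (h * mag N \<sigma> + k * mag N \<tau> + g * overlap N \<sigma> \<tau>)) =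
     (\<Sum>\<sigma>\<in>spins N. \<Prod>i\<in>{1..N}. exp (h * \<sigma> i) * (exp (k + g * \<sigma> i) + exp (- (k + g * \<sigma> i))))"
    by simp
  also have "\<dots> = (exp h * (exp (k + g) + exp (- (k + g))) + exp (- h) * (exp (k - g) + exp (- (k - g)))) ^ N"
    by (subst sum_spins_prod[of "\<lambda>i s. exp (h * s) * (exp (k + g * s) + exp (- (k + g * s)))"]) simp
  also have "exp h * (exp (k + g) + exp (- (k + g))) + exp (- h) * (exp (k - g) + exp (- (k - g))) =
      4 * (cosh h * cosh k * cosh g + sinh h * sinh k * sinh g)"
    by (simp add: cosh_field_def sinh_field_def exp_add exp_diff exp_minus field_simps)
  finally show ?thesis .
qed

text \<open>For fixed fields the sites are independent. Under the weight \<open>exp (h \<sigma> + k \<tau>)\<close> of one site the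
product \<open>\<sigma> \<tau>\<close> has mean \<open>tanh h * tanh k\<close>, so the two-point bound applies site by site.\<close>

lemma sum_two_spins_exp_le:
  "(\<Sum>\<sigma>\<in>spins N. \<Sum>\<tau>\<in>spins N. exp (h * mag N \<sigma> + k * mag N \<tau> + g * overlap N \<sigma> \<tau>))
    \<le> (2 * cosh h) ^ N * (2 * cosh k) ^ N * exp (real N * (g * (tanh h * tanh k) + g\<^sup>2 / 2))"
proof -
  let ?T = "tanh h * tanh k"
  have T: "\<bar>?T\<bar> < 1"
    using tanh_real_bounds[of h] tanh_real_bounds[of k]
    by (auto simp: abs_mult intro!: mult_strict_mono'[of "\<bar>tanh h\<bar>" 1 "\<bar>tanh k\<bar>" 1, simplified])
  have nonneg: "0 \<le> cosh g + ?T * sinh g"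
  proof -
    have "\<bar>?T * sinh g\<bar> \<le> 1 * \<bar>sinh g\<bar>" unfolding abs_mult using T
      by (intro mult_right_mono) (auto simp: abs_mult)
    also have "\<bar>sinh g\<bar> \<le> cosh g"
      using sinh_less_cosh_real[of g] sinh_less_cosh_real[of "-g"] by (simp add: abs_le_iff)
    finally show ?thesis by linarith
  qed
  have "4 * (cosh h * cosh k * cosh g + sinh h * sinh k * sinh g) =
      (2 * cosh h) * (2 * cosh k) * (cosh g + ?T * sinh g)"
    by (simp add: tanh_def field_simps)
  then have "(\<Sum>\<sigma>\<in>spins N. \<Sum>\<tau>\<in>spins N. exp (h * mag N \<sigma> + k * mag N \<tau> + g * overlap N \<sigma> \<tau>))
     = (2 * cosh h) ^ N * (2 * cosh k) ^ N * (cosh g + ?T * sinh g) ^ N"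
    by (simp only: sum_two_spins_exp power_mult_distrib)
  also have "(cosh g + ?T * sinh g) ^ N \<le> exp (g * ?T + g\<^sup>2 / 2) ^ N"
    by (intro power_mono two_point_mgf_le T nonneg)
  also have "exp (g * ?T + g\<^sup>2 / 2) ^ N = exp (real N * (g * ?T + g\<^sup>2 / 2))"
    by (rule exp_of_nat_mult[symmetric])
  finally show ?thesis by (simp add: mult_left_mono)
qed

section \<open>Gaussian linearization of quadratic interactions\<close>

text \<open>Completing the square (the Hubbard--Stratonovich transformation): \<open>exp (\<mu>\<^sup>2 / (2 v\<^sup>2))\<close> is a Gaussian
average of exponentials that are linear in \<open>\<mu>\<close>. With \<open>\<mu>\<close> proportional to the magnetization or to the
overlap, the sum over spins factorizes under the Gaussian integral. Keeping the shifted density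
\<open>normal_density \<mu> v\<close> on the right also records where the mass of the average sits.\<close>

lemma normal_density_tilt:
  assumes "v > 0"
  shows "normal_density 0 v x * exp (\<mu> * x / v\<^sup>2) = exp (\<mu>\<^sup>2 / (2 * v\<^sup>2)) * normal_density \<mu> v x"
proof -
  have "- x\<^sup>2 / (2 * v\<^sup>2) + \<mu> * x / v\<^sup>2 = \<mu>\<^sup>2 / (2 * v\<^sup>2) + - (x - \<mu>)\<^sup>2 / (2 * v\<^sup>2)"
    using assms by (simp add: field_simps power2_eq_square)
  then have "exp (- x\<^sup>2 / (2 * v\<^sup>2)) * exp (\<mu> * x / v\<^sup>2) = exp (\<mu>\<^sup>2 / (2 * v\<^sup>2)) * exp (- (x - \<mu>)\<^sup>2 / (2 * v\<^sup>2))"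
    unfolding exp_add[symmetric] by simp
  then show ?thesis by (simp add: normal_density_def)
qed

lemma nn_integral_normal_density_tilt:
  assumes "v > 0"
  shows "(\<integral>\<^sup>+x. ennreal (normal_density 0 v x * exp (\<mu> * x / v\<^sup>2)) \<partial>lborel) = ennreal (exp (\<mu>\<^sup>2 / (2 * v\<^sup>2)))"
proof -
  have "(\<integral>\<^sup>+x. ennreal (normal_density 0 v x * exp (\<mu> * x / v\<^sup>2)) \<partial>lborel)
     = (\<integral>\<^sup>+x. ennreal (exp (\<mu>\<^sup>2 / (2 * v\<^sup>2))) * ennreal (normal_density \<mu> v x) \<partial>lborel)"
    by (simp add: normal_density_tilt[OF assms] ennreal_mult)
  also have "\<dots> = ennreal (exp (\<mu>\<^sup>2 / (2 * v\<^sup>2))) * (\<integral>\<^sup>+x. ennreal (normal_density \<mu> v x) \<partial>lborel)"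
    by (rule nn_integral_cmult) simp
  also have "(\<integral>\<^sup>+x. ennreal (normal_density \<mu> v x) \<partial>lborel) = 1"
    using assms by (subst nn_integral_eq_integral) auto
  finally show ?thesis by simp
qed

lemma normal_density_widen:
  assumes "v > 0" "c * v\<^sup>2 < 1"
  shows "normal_density 0 v x * exp (c * x\<^sup>2 / 2) =
    1 / sqrt (1 - c * v\<^sup>2) * normal_density 0 (v / sqrt (1 - c * v\<^sup>2)) x"
proof -
  let ?d = "1 - c * v\<^sup>2"
  have d: "?d > 0" using assms by simp
  have "- x\<^sup>2 / (2 * v\<^sup>2) + c * x\<^sup>2 / 2 = - x\<^sup>2 / (2 * (v / sqrt ?d)\<^sup>2)"
    using assms d by (simp add: field_simps power_divide) 
  moreover have "1 / sqrt ?d * (1 / sqrt (2 * pi * (v / sqrt ?d)\<^sup>2)) = 1 / sqrt (2 * pi * v\<^sup>2)"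
    using assms d by (simp add: power_divide real_sqrt_divide real_sqrt_mult)
  ultimately show ?thesis
    by (simp add: normal_density_def exp_add[symmetric] mult.assoc[symmetric])
qed

text \<open>The squared overlap is linearized by a Gaussian \<open>g\<close>, the spins are summed out, and \<open>g\<close> is integrated
out again. The two replicas then interact only through \<open>T\<^sup>2\<close> with \<open>T = tanh h * tanh k\<close>, and
\<open>2 T\<^sup>2 \<le> tanh\<^sup>4 h + tanh\<^sup>4 k\<close> separates them.\<close>

lemma sum_two_spins_exp_overlap_sq_le:
  assumes \<kappa>: "\<kappa> > 0" and small: "4 * \<kappa> * real N \<le> 1"
  shows "(\<Sum>\<sigma>\<in>spins N. \<Sum>\<tau>\<in>spins N. exp (h * mag N \<sigma> + k * mag N \<tau> + \<kappa> * (overlap N \<sigma> \<tau>)\<^sup>2))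
    \<le> 1 / sqrt (1 - 2 * \<kappa> * real N) *
      ((2 * cosh h) ^ N * exp (\<kappa> * real N ^ 2 * tanh h ^ 4)) *
      ((2 * cosh k) ^ N * exp (\<kappa> * real N ^ 2 * tanh k ^ 4))"
proof -
  define v where "v = sqrt (2 * \<kappa>)"
  define d where "d = 1 - 2 * \<kappa> * real N"
  define T where "T = tanh h * tanh k"
  define A where "A = (2 * cosh h) ^ N * (2 * cosh k) ^ N"
  have v: "v > 0" "v\<^sup>2 = 2 * \<kappa>" using \<kappa> by (auto simp: v_def)
  have d: "d \<ge> 1/2" "d > 0" "d = 1 - real N * v\<^sup>2" using small by (auto simp: d_def v)
  have A: "A > 0" by (simp add: A_def)
  have lin: "ennreal (exp (\<kappa> * R\<^sup>2)) = (\<integral>\<^sup>+g. ennreal (normal_density 0 v g * exp (g * R)) \<partial>lborel)" for R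
    using nn_integral_normal_density_tilt[of v "2 * \<kappa> * R"] v \<kappa>
    by (simp add: power_mult_distrib power2_eq_square field_simps)
  have "ennreal (\<Sum>\<sigma>\<in>spins N. \<Sum>\<tau>\<in>spins N. exp (h * mag N \<sigma> + k * mag N \<tau> + \<kappa> * (overlap N \<sigma> \<tau>)\<^sup>2)) =
    (\<Sum>\<sigma>\<in>spins N. \<Sum>\<tau>\<in>spins N. ennreal (exp (h * mag N \<sigma> + k * mag N \<tau>)) *
      (\<integral>\<^sup>+g. ennreal (normal_density 0 v g * exp (g * overlap N \<sigma> \<tau>)) \<partial>lborel))"
    by (simp add: lin[symmetric] ennreal_mult[symmetric] exp_add[symmetric] sum_ennreal sum_nonneg)
  also have "\<dots> = (\<integral>\<^sup>+g. (\<Sum>\<sigma>\<in>spins N. \<Sum>\<tau>\<in>spins N. ennreal (exp (h * mag N \<sigma> + k * mag N \<tau>)) *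
      ennreal (normal_density 0 v g * exp (g * overlap N \<sigma> \<tau>))) \<partial>lborel)"
    by (simp add: nn_integral_sum nn_integral_cmult)
  also have "\<dots> = (\<integral>\<^sup>+g. ennreal (normal_density 0 v g *
      (\<Sum>\<sigma>\<in>spins N. \<Sum>\<tau>\<in>spins N. exp (h * mag N \<sigma> + k * mag N \<tau> + g * overlap N \<sigma> \<tau>))) \<partial>lborel)"
    by (simp add: ennreal_mult[symmetric] sum_ennreal sum_nonneg sum_distrib_left exp_add mult_ac)
  also have "\<dots> \<le> (\<integral>\<^sup>+g. ennreal (normal_density 0 v g *
      (A * exp (real N * (g * T + g\<^sup>2 / 2)))) \<partial>lborel)"
    unfolding A_def T_def
    by (intro nn_integral_mono ennreal_leI mult_left_mono sum_two_spins_exp_le) auto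
  also have "\<dots> = (\<integral>\<^sup>+g. ennreal (A / sqrt d) *
      ennreal (normal_density 0 (v / sqrt d) g * exp (((v / sqrt d)\<^sup>2 * (real N * T)) * g / (v / sqrt d)\<^sup>2)) \<partial>lborel)"
  proof (intro nn_integral_cong)
    fix g :: real
    have "normal_density 0 v g * (A * exp (real N * (g * T + g\<^sup>2 / 2))) =
        A * exp (real N * T * g) * (normal_density 0 v g * exp (real N * g\<^sup>2 / 2))"
      by (simp add: exp_add[symmetric] algebra_simps)
    also have "normal_density 0 v g * exp (real N * g\<^sup>2 / 2) = 1 / sqrt d * normal_density 0 (v / sqrt d) g"
      using v d by (subst normal_density_widen) auto
    also have "real N * T * g = ((v / sqrt d)\<^sup>2 * (real N * T)) * g / (v / sqrt d)\<^sup>2"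
      using v(1) d(2) by simp
    finally have "normal_density 0 v g * (A * exp (real N * (g * T + g\<^sup>2 / 2))) =
      (A / sqrt d) * (normal_density 0 (v / sqrt d) g * exp (((v / sqrt d)\<^sup>2 * (real N * T)) * g / (v / sqrt d)\<^sup>2))"
      by (simp only: divide_inverse mult_1_left mult_1_right mult_ac)
    then show "ennreal (normal_density 0 v g * (A * exp (real N * (g * T + g\<^sup>2 / 2)))) =
      ennreal (A / sqrt d) *
      ennreal (normal_density 0 (v / sqrt d) g * exp (((v / sqrt d)\<^sup>2 * (real N * T)) * g / (v / sqrt d)\<^sup>2))"
      using A d by (simp add: ennreal_mult[symmetric])
  qed
  also have "\<dots> = ennreal (A / sqrt d) * ennreal (exp (((v / sqrt d)\<^sup>2 * (real N * T))\<^sup>2 / (2 * (v / sqrt d)\<^sup>2)))"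
    using v(1) d(2) by (subst nn_integral_cmult, simp, subst nn_integral_normal_density_tilt) auto
  also have "((v / sqrt d)\<^sup>2 * (real N * T))\<^sup>2 / (2 * (v / sqrt d)\<^sup>2) = \<kappa> * real N ^ 2 * (T\<^sup>2 / d)"
    using v d \<kappa> by (simp add: power_divide power_mult_distrib field_simps power2_eq_square)
  finally have le: "(\<Sum>\<sigma>\<in>spins N. \<Sum>\<tau>\<in>spins N. exp (h * mag N \<sigma> + k * mag N \<tau> + \<kappa> * (overlap N \<sigma> \<tau>)\<^sup>2))
      \<le> A / sqrt d * exp (\<kappa> * real N ^ 2 * (T\<^sup>2 / d))"
    using A d by (simp add: ennreal_mult[symmetric])
  \<comment> \<open>The smallness of \<open>\<kappa>\<close> enters as \<open>d \<ge> 1/2\<close>.\<close>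
  have "T\<^sup>2 / d \<le> T\<^sup>2 / (1/2)"
    using d by (intro divide_left_mono) auto
  also have "T\<^sup>2 / (1/2) \<le> tanh h ^ 4 + tanh k ^ 4"
    using zero_le_power2[of "(tanh h)\<^sup>2 - (tanh k)\<^sup>2"]
    by (simp add: T_def power_mult_distrib power2_diff power_mult[symmetric])
  finally have "\<kappa> * real N ^ 2 * (T\<^sup>2 / d) \<le> \<kappa> * real N ^ 2 * (tanh h ^ 4 + tanh k ^ 4)"
    using \<kappa> by (intro mult_left_mono) auto
  then have "A / sqrt d * exp (\<kappa> * real N ^ 2 * (T\<^sup>2 / d)) \<le>
      A / sqrt d * exp (\<kappa> * real N ^ 2 * (tanh h ^ 4 + tanh k ^ 4))"
    using A d(2) by (intro mult_left_mono) (simp_all only: exp_le_cancel_iff, auto)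
  note order_trans[OF le this]
  also have "A / sqrt d * exp (\<kappa> * real N ^ 2 * (tanh h ^ 4 + tanh k ^ 4)) =
      1 / sqrt (1 - 2 * \<kappa> * real N) *
      ((2 * cosh h) ^ N * exp (\<kappa> * real N ^ 2 * tanh h ^ 4)) *
      ((2 * cosh k) ^ N * exp (\<kappa> * real N ^ 2 * tanh k ^ 4))"
    by (simp add: A_def d_def exp_add distrib_left)
  finally show ?thesis .
qed

section \<open>The smoothed Curie--Weiss model\<close>

text \<open>Up to normalization this is the density of \<open>s * (mag + G)\<close>, where the configuration has weight
\<open>exp (b * mag\<^sup>2)\<close> and \<open>G\<close> is an independent centered Gaussian of variance \<open>1 / (2 b)\<close>; this is the
content of \<open>smoothed_curie_weiss\<close>.\<close>

definition field_density :: "real \<Rightarrow> real \<Rightarrow> nat \<Rightarrow> real \<Rightarrow> real" where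
  "field_density b s N x = exp (- b * x\<^sup>2 / s\<^sup>2) * cosh (2 * b * x / s) ^ N"

lemma field_density_pos: "field_density b s N x > 0"
  by (simp add: field_density_def)

lemma borel_measurable_field_density [measurable]: "field_density b s N \<in> borel_measurable borel"
  unfolding field_density_def cosh_field_def by measurable

lemma borel_measurable_tanh_real [measurable]: "(tanh :: real \<Rightarrow> real) \<in> borel_measurable borel"
  unfolding tanh_def sinh_field_def cosh_field_def by measurable

lemma normal_density_cosh:
  assumes "b > 0" "s > 0"
  shows "normal_density 0 (s / sqrt (2 * b)) x * (2 * cosh (2 * b * x / s)) ^ N =
    2 ^ N / sqrt (pi * s\<^sup>2 / b) * field_density b s N x"
  using assms by (simp add: normal_density_def field_density_def power_mult_distrib power_divide)

lemma normal_density_field: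
  assumes "b > 0" "s > 0"
  shows "normal_density 0 (s / sqrt (2 * b)) x * exp ((2 * b * x / s) * m) =
    exp (b * m\<^sup>2) * normal_density (s * m) (s / sqrt (2 * b)) x"
  using normal_density_tilt[of "s / sqrt (2 * b)" x "s * m"] assms
  by (simp add: power_divide power_mult_distrib field_simps power2_eq_square)

lemma smoothed_curie_weiss:
  assumes "b > 0" "s > 0"
  shows "(\<Sum>\<sigma>\<in>spins N. exp (b * (mag N \<sigma>)\<^sup>2) * normal_density (s * mag N \<sigma>) (s / sqrt (2 * b)) x) =
    2 ^ N / sqrt (pi * s\<^sup>2 / b) * field_density b s N x"
proof -
  have "(\<Sum>\<sigma>\<in>spins N. exp (b * (mag N \<sigma>)\<^sup>2) * normal_density (s * mag N \<sigma>) (s / sqrt (2 * b)) x)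
     = normal_density 0 (s / sqrt (2 * b)) x * (\<Sum>\<sigma>\<in>spins N. exp ((2 * b * x / s) * mag N \<sigma>))"
    by (simp only: normal_density_field[OF assms, symmetric] sum_distrib_left)
  then show ?thesis
    by (simp only: sum_spins_exp_mag normal_density_cosh[OF assms])
qed

lemma curie_weiss_partition:
  assumes "b > 0" "s > 0"
  shows "(\<Sum>\<sigma>\<in>spins N. exp (b * (mag N \<sigma>)\<^sup>2)) =
    2 ^ N / sqrt (pi * s\<^sup>2 / b) * (LINT x|lborel. field_density b s N x)"
proof -
  have "(LINT x|lborel. 2 ^ N / sqrt (pi * s\<^sup>2 / b) * field_density b s N x) = (\<Sum>\<sigma>\<in>spins N. exp (b * (mag N \<sigma>)\<^sup>2))"
    unfolding smoothed_curie_weiss[OF assms, symmetric] using assms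
    by (subst Bochner_Integration.integral_sum) auto
  then show ?thesis by simp
qed

text \<open>Chebyshev's inequality, in the form that a Gaussian of variance \<open>v\<^sup>2\<close> stays within \<open>\<eta>\<close> of its mean.\<close>

lemma normal_density_near_mean:
  assumes v: "v > 0" and \<eta>: "\<eta> > 0" and B [measurable]: "B \<in> sets borel"
    and near: "\<And>x. \<bar>x - \<mu>\<bar> < \<eta> \<Longrightarrow> x \<in> B"
  shows "1 - v\<^sup>2 / \<eta>\<^sup>2 \<le> (LINT x|lborel. indicator B x * normal_density \<mu> v x)"
proof -
  have m: "has_bochner_integral lborel (\<lambda>x. normal_density \<mu> v x * (x - \<mu>)\<^sup>2) (v\<^sup>2)"
    using normal_moment_even[OF v, of \<mu> 1] by (simp add: fact_2)
  have "1 - v\<^sup>2 / \<eta>\<^sup>2 = (LINT x|lborel. normal_density \<mu> v x - normal_density \<mu> v x * (x - \<mu>)\<^sup>2 / \<eta>\<^sup>2)"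
    using m v by (subst Bochner_Integration.integral_diff) (auto simp: has_bochner_integral_iff)
  also have "\<dots> \<le> (LINT x|lborel. indicator B x * normal_density \<mu> v x)"
  proof (rule integral_mono)
    show "integrable lborel (\<lambda>x. normal_density \<mu> v x - normal_density \<mu> v x * (x - \<mu>)\<^sup>2 / \<eta>\<^sup>2)"
      using m v by (auto simp: has_bochner_integral_iff)
    show "integrable lborel (\<lambda>x. indicator B x * normal_density \<mu> v x)"
      using integrable_mult_indicator[OF _ integrable_normal_density[OF v, of \<mu>], of B] by simp
    fix x :: real
    show "normal_density \<mu> v x - normal_density \<mu> v x * (x - \<mu>)\<^sup>2 / \<eta>\<^sup>2 \<le> indicator B x * normal_density \<mu> v x"
    proof (cases "x \<in> B")
      case False
      then have "\<eta> \<le> \<bar>x - \<mu>\<bar>" using near[of x] by fastforce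
      then have "\<eta>\<^sup>2 \<le> (x - \<mu>)\<^sup>2" using \<eta> by (intro abs_le_square_iff[THEN iffD1]) auto
      then have "normal_density \<mu> v x * 1 \<le> normal_density \<mu> v x * ((x - \<mu>)\<^sup>2 / \<eta>\<^sup>2)"
        using \<eta> by (intro mult_left_mono) (auto simp: field_simps)
      with False show ?thesis by simp
    qed simp
  qed
  finally show ?thesis .
qed

text \<open>Undoes the smoothing: the noise has variance \<open>s\<^sup>2 / (2 b)\<close>, so all but a fraction
\<open>s\<^sup>2 / (2 b \<eta>\<^sup>2)\<close> of the mass of every configuration stays within distance \<open>\<eta>\<close>.\<close>

lemma curie_weiss_mass_le:
  assumes b: "b > 0" and s: "s > 0" and \<eta>: "\<eta> > 0" and [measurable]: "B \<in> sets borel"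
    and P: "P \<subseteq> spins N"
    and near: "\<And>\<sigma> x. \<sigma> \<in> P \<Longrightarrow> \<bar>x - s * mag N \<sigma>\<bar> < \<eta> \<Longrightarrow> x \<in> B"
  shows "(1 - s\<^sup>2 / (2 * b * \<eta>\<^sup>2)) * (\<Sum>\<sigma>\<in>P. exp (b * (mag N \<sigma>)\<^sup>2)) \<le>
    2 ^ N / sqrt (pi * s\<^sup>2 / b) * (LINT x|lborel. indicator B x * field_density b s N x)"
proof -
  define v where "v = s / sqrt (2 * b)"
  have v: "v > 0" "v\<^sup>2 = s\<^sup>2 / (2 * b)" using b s by (auto simp: v_def power_divide)
  have int: "integrable lborel (\<lambda>x. indicator B x * normal_density \<mu> v x)" for \<mu>
    using integrable_mult_indicator[OF _ integrable_normal_density[OF v(1), of \<mu>], of B] by simp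
  have "(1 - s\<^sup>2 / (2 * b * \<eta>\<^sup>2)) * (\<Sum>\<sigma>\<in>P. exp (b * (mag N \<sigma>)\<^sup>2)) =
      (\<Sum>\<sigma>\<in>P. exp (b * (mag N \<sigma>)\<^sup>2) * (1 - v\<^sup>2 / \<eta>\<^sup>2))"
    by (simp add: v sum_distrib_right[symmetric] mult.commute mult.left_commute)
  also have "\<dots> \<le> (\<Sum>\<sigma>\<in>P. exp (b * (mag N \<sigma>)\<^sup>2) *
      (LINT x|lborel. indicator B x * normal_density (s * mag N \<sigma>) v x))"
    using near v \<eta> by (intro sum_mono mult_left_mono normal_density_near_mean) auto
  also have "\<dots> \<le> (\<Sum>\<sigma>\<in>spins N. exp (b * (mag N \<sigma>)\<^sup>2) *
      (LINT x|lborel. indicator B x * normal_density (s * mag N \<sigma>) v x))"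
    by (intro sum_mono2 finite_spins P mult_nonneg_nonneg integral_nonneg_AE) auto
  also have "\<dots> = (LINT x|lborel. (\<Sum>\<sigma>\<in>spins N. exp (b * (mag N \<sigma>)\<^sup>2) *
      (indicator B x * normal_density (s * mag N \<sigma>) v x)))"
    using int by (subst Bochner_Integration.integral_sum) auto
  also have "\<dots> = (LINT x|lborel. indicator B x * (\<Sum>\<sigma>\<in>spins N. exp (b * (mag N \<sigma>)\<^sup>2) *
      normal_density (s * mag N \<sigma>) v x))"
    by (simp add: sum_distrib_left mult_ac)
  also have "\<dots> = 2 ^ N / sqrt (pi * s\<^sup>2 / b) * (LINT x|lborel. indicator B x * field_density b s N x)"
    unfolding v_def smoothed_curie_weiss[OF b s] mult.left_commute[of "indicator B _"]
    by (rule integral_mult_right_zero)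
  finally show ?thesis .
qed

text \<open>Each magnetization is linearized by its own field. For fixed fields the double spin sum has a bound
that is a product of one factor for each replica, so a double integral becomes a square.\<close>

lemma two_replica_partition_le:
  assumes b: "b > 0" and s: "s > 0" and \<kappa>: "\<kappa> > 0" and small: "4 * \<kappa> * real N \<le> 1"
    and int: "integrable lborel (\<lambda>x. field_density b s N x * exp (\<kappa> * real N ^ 2 * tanh (2 * b * x / s) ^ 4))"
  shows "(\<Sum>\<sigma>\<in>spins N. \<Sum>\<tau>\<in>spins N.
       exp (b * (mag N \<sigma>)\<^sup>2) * exp (b * (mag N \<tau>)\<^sup>2) * exp (\<kappa> * (overlap N \<sigma> \<tau>)\<^sup>2))
    \<le> 1 / sqrt (1 - 2 * \<kappa> * real N) * (2 ^ N / sqrt (pi * s\<^sup>2 / b) *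
      (LINT x|lborel. field_density b s N x * exp (\<kappa> * real N ^ 2 * tanh (2 * b * x / s) ^ 4)))\<^sup>2"
proof -
  define v where "v = s / sqrt (2 * b)"
  define h where "h x = 2 * b * x / s" for x
  define G where "G x = (2 * cosh (h x)) ^ N * exp (\<kappa> * real N ^ 2 * tanh (h x) ^ 4)" for x
  define D where "D = 1 / sqrt (1 - 2 * \<kappa> * real N)"
  define c where "c = 2 ^ N / sqrt (pi * s\<^sup>2 / b)"
  define J where "J = (LINT x|lborel. field_density b s N x * exp (\<kappa> * real N ^ 2 * tanh (h x) ^ 4))"
  let ?n = "normal_density 0 v"
  have v: "v > 0" "v\<^sup>2 = s\<^sup>2 / (2 * b)" using b s by (auto simp: v_def power_divide)
  have D: "D \<ge> 0" using small by (simp add: D_def)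
  have c: "c > 0" using b s by (simp add: c_def)
  have [measurable]: "h \<in> borel_measurable borel" by (simp add: h_def[abs_def])
  have [measurable]: "G \<in> borel_measurable borel" by (simp add: G_def[abs_def] cosh_field_def)
  have G0: "G x \<ge> 0" for x by (simp add: G_def)
  have nG: "?n x * G x = c * (field_density b s N x * exp (\<kappa> * real N ^ 2 * tanh (h x) ^ 4))" for x
    using normal_density_cosh[OF b s, of x N] by (simp add: G_def v_def h_def c_def mult.assoc[symmetric])
  have lin: "ennreal (exp (b * m\<^sup>2)) = (\<integral>\<^sup>+x. ennreal (?n x * exp (h x * m)) \<partial>lborel)" for m
  proof -
    have "s * m * x / v\<^sup>2 = h x * m" for x
      using s b by (subst v(2), simp add: h_def power2_eq_square field_simps)
    moreover have "(s * m)\<^sup>2 / (2 * v\<^sup>2) = b * m\<^sup>2"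
      using s b by (subst v(2), simp add: power2_eq_square field_simps)
    ultimately show ?thesis
      using nn_integral_normal_density_tilt[OF v(1), of "s * m"] by simp
  qed
  have lin2: "ennreal (exp (b * m\<^sup>2) * exp (b * m'\<^sup>2)) =
      (\<integral>\<^sup>+x. (\<integral>\<^sup>+y. ennreal (?n x * exp (h x * m) * (?n y * exp (h y * m'))) \<partial>lborel) \<partial>lborel)" for m m'
    by (simp add: lin nn_integral_cmult nn_integral_multc ennreal_mult)
  have "ennreal (\<Sum>\<sigma>\<in>spins N. \<Sum>\<tau>\<in>spins N.
       exp (b * (mag N \<sigma>)\<^sup>2) * exp (b * (mag N \<tau>)\<^sup>2) * exp (\<kappa> * (overlap N \<sigma> \<tau>)\<^sup>2)) =
    (\<Sum>\<sigma>\<in>spins N. \<Sum>\<tau>\<in>spins N. ennreal (exp (\<kappa> * (overlap N \<sigma> \<tau>)\<^sup>2)) *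
      ennreal (exp (b * (mag N \<sigma>)\<^sup>2) * exp (b * (mag N \<tau>)\<^sup>2)))"
    by (simp add: ennreal_mult[symmetric] sum_ennreal sum_nonneg mult_ac)
  also have "\<dots> = (\<integral>\<^sup>+x. (\<integral>\<^sup>+y. (\<Sum>\<sigma>\<in>spins N. \<Sum>\<tau>\<in>spins N. ennreal (exp (\<kappa> * (overlap N \<sigma> \<tau>)\<^sup>2)) *
      ennreal (?n x * exp (h x * mag N \<sigma>) * (?n y * exp (h y * mag N \<tau>)))) \<partial>lborel) \<partial>lborel)"
    unfolding lin2 by (simp add: nn_integral_sum nn_integral_cmult)
  also have "\<dots> = (\<integral>\<^sup>+x. (\<integral>\<^sup>+y. ennreal (?n x * ?n y * (\<Sum>\<sigma>\<in>spins N. \<Sum>\<tau>\<in>spins N.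
      exp (h x * mag N \<sigma> + h y * mag N \<tau> + \<kappa> * (overlap N \<sigma> \<tau>)\<^sup>2))) \<partial>lborel) \<partial>lborel)"
    by (simp add: ennreal_mult[symmetric] sum_ennreal sum_nonneg sum_distrib_left exp_add mult_ac)
  also have "\<dots> \<le> (\<integral>\<^sup>+x. (\<integral>\<^sup>+y. ennreal (?n x * ?n y * (D * G x * G y)) \<partial>lborel) \<partial>lborel)"
    unfolding D_def G_def
    by (intro nn_integral_mono ennreal_leI mult_left_mono sum_two_spins_exp_overlap_sq_le \<kappa> small) auto
  also have "\<dots> = (\<integral>\<^sup>+x. (\<integral>\<^sup>+y. ennreal D * (ennreal (?n x * G x) * ennreal (?n y * G y)) \<partial>lborel) \<partial>lborel)"
    using D G0 by (simp add: ennreal_mult[symmetric] mult_ac)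
  also have "\<dots> = ennreal D * ((\<integral>\<^sup>+x. ennreal (?n x * G x) \<partial>lborel) * (\<integral>\<^sup>+x. ennreal (?n x * G x) \<partial>lborel))"
    by (simp add: nn_integral_cmult nn_integral_multc)
  also have "(\<integral>\<^sup>+x. ennreal (?n x * G x) \<partial>lborel) = ennreal (c * J)"
    unfolding nG J_def using c int less_imp_le[OF field_density_pos]
    by (subst nn_integral_eq_integral) (auto simp: h_def)
  also have "ennreal D * (ennreal (c * J) * ennreal (c * J)) = ennreal (D * (c * J)\<^sup>2)"
  proof -
    have "J \<ge> 0" unfolding J_def using less_imp_le[OF field_density_pos] by (intro integral_nonneg_AE) auto
    then show ?thesis using D c by (simp add: ennreal_mult[symmetric] power2_eq_square)
  qed
  finally show ?thesis
    using D by (subst (asm) ennreal_le_iff) (auto simp: D_def c_def J_def h_def)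
qed

section \<open>The Gibbs weight as a product over edges\<close>

abbreviation (input) edges :: "nat \<Rightarrow> (nat \<times> nat) set" where
  "edges N \<equiv> {1..N} \<times> {1..N}"

definition edge_spin :: "(nat \<Rightarrow> real) \<Rightarrow> nat \<times> nat \<Rightarrow> real" where
  "edge_spin \<sigma> ij = \<sigma> (fst ij) * \<sigma> (snd ij)"

definition edge_tanh :: "nat \<Rightarrow> real \<Rightarrow> real" where
  "edge_tanh N p = tanh (1 / (2 * real N * p))"

text \<open>The coupling of the averaged model: the expectation of \<open>reduced_weight\<close> is proportional to
\<open>exp (coupling * mag\<^sup>2)\<close>.\<close>

definition coupling :: "nat \<Rightarrow> real \<Rightarrow> real" where
  "coupling N p = artanh (p * edge_tanh N p)"

text \<open>The Boltzmann weight without the factor \<open>\<Prod> cosh\<close> of \<open>gibbs_weight_factorization\<close>, which is the same for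
all configurations and cancels in the Gibbs measure. That factor is a function of the number of
edges, and its fluctuations are too large for a second moment argument when \<open>p\<^sup>4 N\<^sup>3\<close> is bounded.\<close>

definition reduced_weight :: "nat \<Rightarrow> real \<Rightarrow> (nat \<times> nat \<Rightarrow> real) \<Rightarrow> (nat \<Rightarrow> real) \<Rightarrow> real" where
  "reduced_weight N p e \<sigma> = (\<Prod>ij\<in>edges N. 1 + edge_tanh N p * edge_spin \<sigma> ij * e ij)"

lemma edge_spin_values: "\<sigma> \<in> spins N \<Longrightarrow> ij \<in> edges N \<Longrightarrow> edge_spin \<sigma> ij = -1 \<or> edge_spin \<sigma> ij = 1"
  using spin_values[of \<sigma> N "fst ij"] spin_values[of \<sigma> N "snd ij"] by (auto simp: edge_spin_def)

lemma sum_edge_spin: "(\<Sum>ij\<in>edges N. edge_spin \<sigma> ij) = (mag N \<sigma>)\<^sup>2"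
  by (simp add: edge_spin_def mag_def power2_eq_square sum_product sum.cartesian_product case_prod_beta)

lemma sum_edge_spin_mult: "(\<Sum>ij\<in>edges N. edge_spin \<sigma> ij * edge_spin \<tau> ij) = (overlap N \<sigma> \<tau>)\<^sup>2"
  by (simp add: edge_spin_def overlap_def power2_eq_square sum_product sum.cartesian_product case_prod_beta mult_ac)

lemma tanh_le_self: "0 \<le> (x::real) \<Longrightarrow> tanh x \<le> x"
  using tanh_le_rational[of x] by (smt (verit) divide_nonneg_nonneg zero_le_power zero_le_power2)

lemma edge_tanh_bounds:
  assumes "N \<ge> 1" "0 < p"
  shows "0 < edge_tanh N p" "edge_tanh N p < 1" "edge_tanh N p \<le> 1 / (2 * real N * p)"
    "p * edge_tanh N p \<le> 1 / (2 * real N)" "p * edge_tanh N p \<le> 1 / 2"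
proof -
  show "0 < edge_tanh N p" "edge_tanh N p < 1"
    using assms tanh_real_bounds by (auto simp: edge_tanh_def)
  show 1: "edge_tanh N p \<le> 1 / (2 * real N * p)"
    using assms unfolding edge_tanh_def by (intro tanh_le_self) auto
  have "p * edge_tanh N p \<le> p * (1 / (2 * real N * p))"
    using 1 assms by (intro mult_left_mono) auto
  then show 2: "p * edge_tanh N p \<le> 1 / (2 * real N)" using assms by simp
  also have "\<dots> \<le> 1 / 2" using assms by (simp add: field_simps)
  finally show "p * edge_tanh N p \<le> 1 / 2" .
qed

lemma coupling_pos: "N \<ge> 1 \<Longrightarrow> 0 < p \<Longrightarrow> 0 < coupling N p"
proof -
  assume N: "N \<ge> 1" and p: "0 < p"
  define a where "a = p * edge_tanh N p"
  have "0 < a" "a \<le> 1/2" using edge_tanh_bounds[OF N p] p by (auto simp: a_def)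
  then have "0 < ln ((1 + a) / (1 - a))" by (intro ln_gt_zero) (simp add: field_simps)
  then show ?thesis by (simp add: coupling_def artanh_def a_def)
qed

text \<open>For a spin product \<open>u = \<plusminus>1\<close> one has \<open>exp (x u) = cosh x * (1 + u * tanh x)\<close>, and for \<open>e \<in> {0, 1}\<close> the factor
\<open>tanh (\<gamma> e)\<close> is linear in \<open>e\<close>.\<close>

lemma gibbs_weight_factorization:
  assumes N: "N \<ge> 1" and \<sigma>: "\<sigma> \<in> spins N"
    and e: "\<And>i j. i \<in> {1..N} \<Longrightarrow> j \<in> {1..N} \<Longrightarrow> e i j \<in> {0, 1}"
  shows "exp (- 1 * hamiltonian N p e \<sigma>) =
    (\<Prod>ij\<in>edges N. cosh (1 / (2 * real N * p) * e (fst ij) (snd ij))) *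
    reduced_weight N p (\<lambda>ij. e (fst ij) (snd ij)) \<sigma>"
proof -
  let ?\<gamma> = "1 / (2 * real N * p)"
  have "- 1 * hamiltonian N p e \<sigma> = (\<Sum>ij\<in>edges N. ?\<gamma> * (e (fst ij) (snd ij) * edge_spin \<sigma> ij))"
    by (simp add: hamiltonian_def sum.cartesian_product case_prod_beta edge_spin_def sum_distrib_left mult.assoc)
  then have "exp (- 1 * hamiltonian N p e \<sigma>) = (\<Prod>ij\<in>edges N. exp (?\<gamma> * (e (fst ij) (snd ij) * edge_spin \<sigma> ij)))"
    by (simp add: exp_sum)
  also have "\<dots> = (\<Prod>ij\<in>edges N. cosh (?\<gamma> * e (fst ij) (snd ij)) *
      (1 + edge_tanh N p * edge_spin \<sigma> ij * e (fst ij) (snd ij)))"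
  proof (rule prod.cong[OF refl])
    fix ij assume ij: "ij \<in> edges N"
    have c: "cosh x * (1 + tanh x) = exp x" "cosh x * (1 - tanh x) = exp (- x)" for x :: real
      by (simp_all add: tanh_def cosh_plus_sinh cosh_minus_sinh field_simps)
    show "exp (?\<gamma> * (e (fst ij) (snd ij) * edge_spin \<sigma> ij)) = cosh (?\<gamma> * e (fst ij) (snd ij)) *
      (1 + edge_tanh N p * edge_spin \<sigma> ij * e (fst ij) (snd ij))"
      using e[of "fst ij" "snd ij"] edge_spin_values[OF \<sigma> ij] ij c[of ?\<gamma>]
      unfolding edge_tanh_def by auto
  qed
  finally show ?thesis by (simp only: prod.distrib reduced_weight_def)
qed

lemma measure_magnetization_law:
  assumes N: "N \<ge> 1" and e: "\<And>i j. i \<in> {1..N} \<Longrightarrow> j \<in> {1..N} \<Longrightarrow> e i j \<in> {0, 1}"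
  shows "measure (magnetization_law s 1 N p e) {..t} =
    (\<Sum>\<sigma>\<in>{\<sigma>\<in>spins N. s * mag N \<sigma> \<le> t}. reduced_weight N p (\<lambda>ij. e (fst ij) (snd ij)) \<sigma>) /
    (\<Sum>\<sigma>\<in>spins N. reduced_weight N p (\<lambda>ij. e (fst ij) (snd ij)) \<sigma>)"
proof -
  let ?W = "reduced_weight N p (\<lambda>ij. e (fst ij) (snd ij))"
  let ?g = "\<lambda>\<sigma>. exp (- 1 * hamiltonian N p e \<sigma>)"
  define C where "C = (\<Prod>ij\<in>edges N. cosh (1 / (2 * real N * p) * e (fst ij) (snd ij)))"
  have C: "C > 0" unfolding C_def by (intro prod_pos) simp
  have g: "?g \<sigma> = C * ?W \<sigma>" if "\<sigma> \<in> spins N" for \<sigma>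
    unfolding C_def by (rule gibbs_weight_factorization[OF N that e])
  have Z: "partition_fun 1 N p e = C * (\<Sum>\<sigma>\<in>spins N. ?W \<sigma>)"
    unfolding partition_fun_def sum_distrib_left by (intro sum.cong refl g)
  have "emeasure (magnetization_law s 1 N p e) {..t} =
    (\<Sum>\<sigma>\<in>spins N. ennreal (?g \<sigma> / partition_fun 1 N p e * indicator {..t} (s * mag N \<sigma>)))"
    using partition_fun_pos[of 1 N p e]
    by (subst emeasure_magnetization_law, simp, intro sum.cong refl)
       (simp add: mag_def ennreal_mult ennreal_indicator del: mult_minus1 times_divide_eq_left)
  also have "\<dots> = ennreal (\<Sum>\<sigma>\<in>spins N. ?g \<sigma> / partition_fun 1 N p e * indicator {..t} (s * mag N \<sigma>))"
    using partition_fun_pos[of 1 N p e] by (intro sum_ennreal) auto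
  finally have "measure (magnetization_law s 1 N p e) {..t} =
      (\<Sum>\<sigma>\<in>spins N. ?g \<sigma> / partition_fun 1 N p e * indicator {..t} (s * mag N \<sigma>))"
    using partition_fun_pos[of 1 N p e] by (simp add: measure_def sum_nonneg)
  also have "\<dots> = (\<Sum>\<sigma>\<in>spins N. ?W \<sigma> / (\<Sum>\<sigma>\<in>spins N. ?W \<sigma>) * indicator {..t} (s * mag N \<sigma>))"
    using C by (intro sum.cong refl) (simp only: g Z, simp)
  also have "\<dots> = (\<Sum>\<sigma>\<in>{\<sigma>\<in>spins N. s * mag N \<sigma> \<le> t}. ?W \<sigma> / (\<Sum>\<sigma>\<in>spins N. ?W \<sigma>))"
    by (intro sum.mono_neutral_cong_right) (auto simp: finite_spins)
  finally show ?thesis by (simp add: sum_divide_distrib)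
qed

text \<open>For \<open>u = \<plusminus>1\<close> the factor \<open>1 + a u\<close> equals \<open>sqrt (1 - a\<^sup>2) * exp (u * artanh a)\<close>, and the spin products of
all edges add up to the squared magnetization.\<close>

lemma prod_one_plus_edge_spin:
  assumes "\<bar>a\<bar> < 1" and \<sigma>: "\<sigma> \<in> spins N"
  shows "(\<Prod>ij\<in>edges N. 1 + a * edge_spin \<sigma> ij) =
    sqrt (1 - a\<^sup>2) ^ (N * N) * exp (artanh a * (mag N \<sigma>)\<^sup>2)"
proof -
  have a2: "1 - a\<^sup>2 = (1 - a) * (1 + a)" by (simp add: power2_eq_square algebra_simps)
  have e: "exp (artanh a) = sqrt ((1 + a) / (1 - a))"
  proof -
    have "exp (artanh a) = exp (ln (sqrt ((1 + a) / (1 - a))))"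
      using assms(1) by (simp add: artanh_def ln_sqrt)
    also have "\<dots> = sqrt ((1 + a) / (1 - a))" using assms(1) by (subst exp_ln) auto
    finally show ?thesis .
  qed
  have "(\<Prod>ij\<in>edges N. 1 + a * edge_spin \<sigma> ij) =
      (\<Prod>ij\<in>edges N. sqrt (1 - a\<^sup>2) * exp (artanh a * edge_spin \<sigma> ij))"
  proof (rule prod.cong[OF refl])
    fix ij assume ij: "ij \<in> edges N"
    have 1: "sqrt (1 - a\<^sup>2) * exp (artanh a) = 1 + a"
      using assms(1) unfolding e a2 by (simp add: real_sqrt_mult[symmetric])
    have 2: "sqrt (1 - a\<^sup>2) * exp (- artanh a) = 1 - a"
      using assms(1) unfolding exp_minus e a2
      by (simp add: real_sqrt_mult real_sqrt_divide)
    show "1 + a * edge_spin \<sigma> ij = sqrt (1 - a\<^sup>2) * exp (artanh a * edge_spin \<sigma> ij)"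
      using edge_spin_values[OF \<sigma> ij] 1 2 by auto
  qed
  also have "\<dots> = sqrt (1 - a\<^sup>2) ^ (N * N) * exp (artanh a * (mag N \<sigma>)\<^sup>2)"
    unfolding sum_edge_spin[symmetric] sum_distrib_left by (simp add: prod.distrib exp_sum)
  finally show ?thesis .
qed

section \<open>Covariances of the weights of two configurations\<close>

definition pair_excess :: "nat \<Rightarrow> real \<Rightarrow> real" where
  "pair_excess N p = p * (1 - p) * (edge_tanh N p)\<^sup>2 / (1 - (p * edge_tanh N p)\<^sup>2)\<^sup>2"

text \<open>The left-hand side is the joint expectation of the two factors that one edge contributes. Its ratio
to the product of the expectations is an explicit function because \<open>(1 + a u) (u - a) = (1 - a\<^sup>2) u\<close>
for \<open>u = \<plusminus>1\<close>.\<close>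

lemma pair_factor:
  assumes N: "N \<ge> 1" and p: "0 < p" and uv: "u = -1 \<or> u = (1::real)" "v = -1 \<or> v = (1::real)"
  defines "t \<equiv> edge_tanh N p"
  shows "1 + p * (t * u + t * v + t * u * (t * v)) = (1 + p * t * u) * (1 + p * t * v) *
    (1 + pair_excess N p * ((u - p * t) * (v - p * t)))"
proof -
  define a where "a = p * t"
  have a: "a \<le> 1/2" "0 < a" using edge_tanh_bounds[OF N p] p by (auto simp: a_def t_def)
  have a1: "1 - a\<^sup>2 > 0" using a using power_strict_mono[of a 1 2] by simp
  have k: "pair_excess N p * (1 - a\<^sup>2)\<^sup>2 = p * (1 - p) * t\<^sup>2"
    using a1 by (simp add: pair_excess_def a_def t_def)
  have "(1 + a * u) * (u - a) = u * (1 - a\<^sup>2)" "(1 + a * v) * (v - a) = v * (1 - a\<^sup>2)"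
    using uv by (auto simp: power2_eq_square algebra_simps)
  then have "(1 + a * u) * (1 + a * v) * (pair_excess N p * ((u - a) * (v - a))) =
      pair_excess N p * ((u * (1 - a\<^sup>2)) * (v * (1 - a\<^sup>2)))"
    by (metis (no_types, opaque_lifting) mult.assoc mult.left_commute)
  also have "\<dots> = pair_excess N p * (1 - a\<^sup>2)\<^sup>2 * (u * v)" by (simp add: power2_eq_square)
  also have "\<dots> = p * (1 - p) * t\<^sup>2 * (u * v)" by (simp only: k)
  finally show ?thesis
    unfolding a_def[symmetric] distrib_left[of _ 1] 
    by (simp add: a_def power2_eq_square algebra_simps)
qed

lemma pair_excess_bounds:
  assumes N: "N \<ge> 1" and p: "0 < p" "p \<le> 1"
  shows "0 \<le> pair_excess N p" "pair_excess N p \<le> 1 / (2 * real N ^ 2 * p)"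
proof -
  define t where "t = edge_tanh N p"
  have t: "0 < t" "t \<le> 1 / (2 * real N * p)" "p * t \<le> 1 / 2"
    using edge_tanh_bounds[OF N p(1)] by (auto simp: t_def)
  have "(p * t)\<^sup>2 \<le> (1/2)\<^sup>2" using t p by (intro power_mono) auto
  then have "(3/4)\<^sup>2 \<le> (1 - (p * t)\<^sup>2)\<^sup>2" by (intro power_mono) (auto simp: power2_eq_square)
  then have d: "9/16 \<le> (1 - (p * t)\<^sup>2)\<^sup>2" by (simp add: power2_eq_square)
  have num: "p * (1 - p) * t\<^sup>2 \<le> p * 1 * (1 / (2 * real N * p))\<^sup>2"
    using p t by (intro mult_mono power_mono) auto
  show "0 \<le> pair_excess N p" unfolding pair_excess_def using p by simp
  have "pair_excess N p \<le> (p * 1 * (1 / (2 * real N * p))\<^sup>2) / (9/16)"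
    unfolding pair_excess_def t_def[symmetric] using num d p by (intro frac_le) auto
  also have "\<dots> \<le> 1 / (2 * real N ^ 2 * p)"
    using p N by (simp add: power2_eq_square field_simps)
  finally show "pair_excess N p \<le> 1 / (2 * real N ^ 2 * p)" .
qed

lemma sum_pair_exponent:
  "(\<Sum>ij\<in>edges N. (edge_spin \<sigma> ij - a) * (edge_spin \<tau> ij - a)) =
    (overlap N \<sigma> \<tau>)\<^sup>2 - a * (mag N \<sigma>)\<^sup>2 - a * (mag N \<tau>)\<^sup>2 + a\<^sup>2 * real N ^ 2"
proof -
  have "(\<Sum>ij\<in>edges N. (edge_spin \<sigma> ij - a) * (edge_spin \<tau> ij - a)) =
     (\<Sum>ij\<in>edges N. edge_spin \<sigma> ij * edge_spin \<tau> ij - a * edge_spin \<sigma> ij - a * edge_spin \<tau> ij + a\<^sup>2)"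
    by (simp add: algebra_simps power2_eq_square)
  also have "\<dots> = (overlap N \<sigma> \<tau>)\<^sup>2 - a * (mag N \<sigma>)\<^sup>2 - a * (mag N \<tau>)\<^sup>2 + a\<^sup>2 * real N ^ 2"
    by (simp only: sum.distrib sum_subtractf sum_distrib_left[symmetric] sum_edge_spin sum_edge_spin_mult)
       (simp add: power2_eq_square)
  finally show ?thesis .
qed

lemma mag_sq_le:
  assumes "\<sigma> \<in> spins N" shows "(mag N \<sigma>)\<^sup>2 \<le> real N ^ 2"
proof -
  have "(\<Sum>ij\<in>edges N. edge_spin \<sigma> ij) \<le> (\<Sum>ij\<in>edges N. 1)"
    using edge_spin_values[OF assms] by (intro sum_mono) force
  then show ?thesis unfolding sum_edge_spin by (simp add: power2_eq_square)
qed

text \<open>By \<open>sum_pair_exponent\<close> the main term of the logarithm is the squared overlap, and the terms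
\<open>- a * mag\<^sup>2\<close> are nonpositive, so they can be dropped in the upper bound. In the lower bound the crude estimate
\<open>mag\<^sup>2 \<le> N\<^sup>2\<close> is good enough, since \<open>a\<close> is of order \<open>1 / N\<close>.\<close>

lemma pair_ratio_bounds:
  assumes N: "N \<ge> 1" and p: "0 < p" "p \<le> 1" and \<sigma>: "\<sigma> \<in> spins N" and \<tau>: "\<tau> \<in> spins N"
  defines "a \<equiv> p * edge_tanh N p"
  defines "r \<equiv> (\<Prod>ij\<in>edges N. 1 + pair_excess N p * ((edge_spin \<sigma> ij - a) * (edge_spin \<tau> ij - a)))"
  shows "r \<le> exp (1 / (2 * real N ^ 2 * p) * ((overlap N \<sigma> \<tau>)\<^sup>2 + 1 / 4))"
    and "3 \<le> real N * p \<Longrightarrow> 1 - 2 / (real N * p) \<le> r"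
proof -
  let ?x = "\<lambda>ij. pair_excess N p * ((edge_spin \<sigma> ij - a) * (edge_spin \<tau> ij - a))"
  let ?\<kappa> = "1 / (2 * real N ^ 2 * p)"
  note k = pair_excess_bounds[OF N p]
  have a: "0 < a" "a \<le> 1 / (2 * real N)" "a \<le> 1/2"
    using edge_tanh_bounds[OF N p(1)] p by (auto simp: a_def)
  have aN: "a * real N \<le> 1 / 2" using a(2) N by (simp add: field_simps)
  have sum: "(\<Sum>ij\<in>edges N. ?x ij) = pair_excess N p *
      ((overlap N \<sigma> \<tau>)\<^sup>2 - a * (mag N \<sigma>)\<^sup>2 - a * (mag N \<tau>)\<^sup>2 + a\<^sup>2 * real N ^ 2)"
    by (simp only: sum_distrib_left[symmetric] sum_pair_exponent)
  have bound: "\<bar>?x ij\<bar> \<le> 9 / (8 * real N ^ 2 * p)" if "ij \<in> edges N" for ij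
  proof -
    have "\<bar>edge_spin \<sigma> ij - a\<bar> \<le> 3/2" "\<bar>edge_spin \<tau> ij - a\<bar> \<le> 3/2"
      using edge_spin_values[OF \<sigma> that] edge_spin_values[OF \<tau> that] a by auto
    then have "\<bar>?x ij\<bar> \<le> ?\<kappa> * (3/2 * (3/2))"
      unfolding abs_mult abs_of_nonneg[OF k(1)] using p k(2) by (intro mult_mono) simp_all
    then show ?thesis by simp
  qed
  \<comment> \<open>Each ratio is positive because it is a quotient of expectations of positive variables.\<close>
  have pos: "0 < 1 + ?x ij" if ij: "ij \<in> edges N" for ij
  proof -
    define t where "t = edge_tanh N p"
    have t: "0 < t" "t < 1" using edge_tanh_bounds[OF N p(1)] by (auto simp: t_def)
    have at: "a = p * t" by (simp add: a_def t_def)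
    define u where "u = edge_spin \<sigma> ij" define v where "v = edge_spin \<tau> ij"
    have uv: "u = -1 \<or> u = 1" "v = -1 \<or> v = 1"
      using edge_spin_values[OF \<sigma> ij] edge_spin_values[OF \<tau> ij] by (auto simp: u_def v_def)
    have "0 < (1 - p) * 1 + p * ((1 + t * u) * (1 + t * v))"
    proof -
      have "0 < 1 + t * u" "0 < 1 + t * v" using t uv by auto
      then have "0 < p * ((1 + t * u) * (1 + t * v))" using p(1) by (intro mult_pos_pos)
      then show ?thesis using p(2) by (intro add_nonneg_pos) simp_all
    qed
    also have "\<dots> = 1 + p * (t * u + t * v + t * u * (t * v))" by (simp add: algebra_simps)
    also have "\<dots> = (1 + a * u) * (1 + a * v) * (1 + ?x ij)"
      using pair_factor[OF N p(1) uv] by (simp add: at t_def u_def v_def)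
    finally have "0 < (1 + a * u) * (1 + a * v) * (1 + ?x ij)" .
    moreover have "0 < (1 + a * u) * (1 + a * v)" using a uv by (intro mult_pos_pos) auto
    ultimately show ?thesis by (simp add: zero_less_mult_iff)
  qed
  have "r \<le> (\<Prod>ij\<in>edges N. exp (?x ij))"
    unfolding r_def using pos by (intro prod_mono conjI exp_ge_add_one_self) (simp add: less_imp_le)
  also have "\<dots> = exp (\<Sum>ij\<in>edges N. ?x ij)" by (simp add: exp_sum)
  also have "(\<Sum>ij\<in>edges N. ?x ij) \<le> pair_excess N p * ((overlap N \<sigma> \<tau>)\<^sup>2 + 1 / 4)"
  proof -
    have "(a * real N)\<^sup>2 \<le> (1/2)\<^sup>2" using aN a by (intro power_mono) auto
    then have "a\<^sup>2 * real N ^ 2 \<le> 1 / 4" by (simp add: power_mult_distrib power_divide)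
    moreover have "0 \<le> a * (mag N \<sigma>)\<^sup>2" "0 \<le> a * (mag N \<tau>)\<^sup>2" using a by auto
    ultimately show ?thesis unfolding sum by (intro mult_left_mono k(1)) linarith
  qed
  also have "\<dots> \<le> ?\<kappa> * ((overlap N \<sigma> \<tau>)\<^sup>2 + 1 / 4)"
    using k by (intro mult_right_mono) auto
  finally show "r \<le> exp (?\<kappa> * ((overlap N \<sigma> \<tau>)\<^sup>2 + 1 / 4))" by simp
  assume Np: "3 \<le> real N * p"
  have small: "9 / (8 * real N ^ 2 * p) \<le> 1/2"
  proof -
    have "3 * 1 \<le> (real N * p) * real N" using Np N by (intro mult_mono) auto
    then show ?thesis using N p by (simp add: field_simps power2_eq_square)
  qed
  have lnle: "?x ij - 2 * (9 / (8 * real N ^ 2 * p))\<^sup>2 \<le> ln (1 + ?x ij)" if ij: "ij \<in> edges N" for ij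
  proof -
    have "\<bar>ln (1 + ?x ij) - ?x ij\<bar> \<le> 2 * (?x ij)\<^sup>2"
      by (intro abs_ln_one_plus_x_minus_x_bound order_trans[OF bound[OF ij] small])
    moreover have "(?x ij)\<^sup>2 \<le> (9 / (8 * real N ^ 2 * p))\<^sup>2"
      using bound[OF ij] by (metis abs_ge_zero power2_abs power_mono)
    ultimately show ?thesis by linarith
  qed
  have "- 2 / (real N * p) \<le> - (1 / (2 * real N * p)) - real (N * N) * (2 * (9 / (8 * real N ^ 2 * p))\<^sup>2)"
  proof -
    have "real (N * N) * (2 * (9 / (8 * real N ^ 2 * p))\<^sup>2) = 81 / 32 * (1 / (real N * p)) * (1 / (real N * p))"
      using N p by (simp add: field_simps power2_eq_square)
    also have "\<dots> \<le> 81 / 32 * (1 / (real N * p)) * (1 / 3)"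
      using Np by (intro mult_left_mono) (auto simp: field_simps)
    finally have "real (N * N) * (2 * (9 / (8 * real N ^ 2 * p))\<^sup>2) \<le> 27 / 32 * (1 / (real N * p))"
      by (simp add: mult_ac)
    moreover have "- 2 / (real N * p) = - 2 * (1 / (real N * p))"
      "1 / (2 * real N * p) = 1 / 2 * (1 / (real N * p))" "0 \<le> 1 / (real N * p)"
      using Np by auto
    ultimately show ?thesis by linarith
  qed
  also have "- (1 / (2 * real N * p)) \<le> (\<Sum>ij\<in>edges N. ?x ij)"
  proof -
    have "(mag N \<sigma>)\<^sup>2 + (mag N \<tau>)\<^sup>2 \<le> 2 * real N ^ 2" using mag_sq_le[OF \<sigma>] mag_sq_le[OF \<tau>] by simp
    then have "a * ((mag N \<sigma>)\<^sup>2 + (mag N \<tau>)\<^sup>2) \<le> 1 / (2 * real N) * (2 * real N ^ 2)"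
      using a by (intro mult_mono) auto
    also have "\<dots> = real N" using N by (simp add: power2_eq_square)
    finally have 1: "a * ((mag N \<sigma>)\<^sup>2 + (mag N \<tau>)\<^sup>2) \<le> real N" .
    have "pair_excess N p * (a * ((mag N \<sigma>)\<^sup>2 + (mag N \<tau>)\<^sup>2)) \<le> ?\<kappa> * real N"
      using k 1 a p by (intro mult_mono) auto
    also have "\<dots> = 1 / (2 * real N * p)" using N by (simp add: power2_eq_square)
    finally have "- (1 / (2 * real N * p)) \<le> - (pair_excess N p * (a * ((mag N \<sigma>)\<^sup>2 + (mag N \<tau>)\<^sup>2)))" by simp
    also have "\<dots> \<le> (\<Sum>ij\<in>edges N. ?x ij)"
    proof -
      have "0 \<le> pair_excess N p * ((overlap N \<sigma> \<tau>)\<^sup>2 + a\<^sup>2 * real N ^ 2)" using k(1) by simp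
      then show ?thesis unfolding sum by (simp add: algebra_simps)
    qed
    finally show ?thesis .
  qed
  also have "(\<Sum>ij\<in>edges N. ?x ij) - real (N * N) * (2 * (9 / (8 * real N ^ 2 * p))\<^sup>2)
      = (\<Sum>ij\<in>edges N. ?x ij - 2 * (9 / (8 * real N ^ 2 * p))\<^sup>2)"
    by (simp add: sum_subtractf)
  also have "\<dots> \<le> (\<Sum>ij\<in>edges N. ln (1 + ?x ij))"
    by (intro sum_mono lnle)
  finally have "exp (- 2 / (real N * p)) \<le> exp (\<Sum>ij\<in>edges N. ln (1 + ?x ij))"
    by (simp only: exp_le_cancel_iff)
  also have "\<dots> = r" unfolding r_def using pos by (simp add: exp_sum del: One_nat_def)
  finally show "1 - 2 / (real N * p) \<le> r"
    using exp_ge_add_one_self[of "- 2 / (real N * p)"] by simp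
qed

section \<open>Concentration of the Gibbs weights\<close>

text \<open>Edge indicators that take the values 0 and 1 everywhere, not only almost surely; this makes the weights
bounded and \<open>X\<^sup>2 = X\<close> an identity.\<close>

locale bernoulli_edges = prob_space M for M :: "'a measure" +
  fixes N :: nat and p :: real and X :: "nat \<times> nat \<Rightarrow> 'a \<Rightarrow> real"
  assumes N: "N \<ge> 1" and p: "0 < p" "p \<le> 1"
    and indep: "indep_vars (\<lambda>_. borel) X (edges N)"
    and X01: "\<And>ij \<omega>. ij \<in> edges N \<Longrightarrow> \<omega> \<in> space M \<Longrightarrow> X ij \<omega> \<in> {0, 1}"
    and expectation_X: "\<And>ij. ij \<in> edges N \<Longrightarrow> expectation (X ij) = p"
begin

lemma random_variable_X [measurable (raw)]: "ij \<in> edges N \<Longrightarrow> random_variable borel (X ij)"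
  using indep unfolding indep_vars_def by auto

lemma integrable_X: "ij \<in> edges N \<Longrightarrow> integrable M (X ij)"
  using X01 by (intro integrable_const_bound[of _ 1]) (auto intro!: AE_I2 random_variable_X, force)

lemma
  fixes c :: "nat \<times> nat \<Rightarrow> real"
  shows expectation_prod: "expectation (\<lambda>\<omega>. \<Prod>ij\<in>edges N. 1 + c ij * X ij \<omega>) = (\<Prod>ij\<in>edges N. 1 + p * c ij)"
    and integrable_prod: "integrable M (\<lambda>\<omega>. \<Prod>ij\<in>edges N. 1 + c ij * X ij \<omega>)"
proof -
  have ind: "indep_vars (\<lambda>_. borel) (\<lambda>ij \<omega>. 1 + c ij * X ij \<omega>) (edges N)"
    by (rule indep_vars_compose2[OF indep, where Y = "\<lambda>ij x. 1 + c ij * x"]) auto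
  have int: "integrable M (\<lambda>\<omega>. 1 + c ij * X ij \<omega>)" if "ij \<in> edges N" for ij
    using integrable_X[OF that] by auto
  show "integrable M (\<lambda>\<omega>. \<Prod>ij\<in>edges N. 1 + c ij * X ij \<omega>)"
    by (rule indep_vars_integrable[OF _ ind int]) auto
  have "expectation (\<lambda>\<omega>. \<Prod>ij\<in>edges N. 1 + c ij * X ij \<omega>) = (\<Prod>ij\<in>edges N. expectation (\<lambda>\<omega>. 1 + c ij * X ij \<omega>))"
    by (rule indep_vars_lebesgue_integral[OF _ ind int]) auto
  also have "\<dots> = (\<Prod>ij\<in>edges N. 1 + p * c ij)"
    using integrable_X expectation_X by (intro prod.cong refl) (simp add: prob_space mult.commute)
  finally show "expectation (\<lambda>\<omega>. \<Prod>ij\<in>edges N. 1 + c ij * X ij \<omega>) = (\<Prod>ij\<in>edges N. 1 + p * c ij)" .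
qed

definition W :: "(nat \<Rightarrow> real) \<Rightarrow> 'a \<Rightarrow> real" where
  "W \<sigma> \<omega> = reduced_weight N p (\<lambda>ij. X ij \<omega>) \<sigma>"

text \<open>The expectation of \<open>W\<close>, by \<open>expectation_W\<close>.\<close>

definition w :: "(nat \<Rightarrow> real) \<Rightarrow> real" where
  "w \<sigma> = sqrt (1 - (p * edge_tanh N p)\<^sup>2) ^ (N * N) * exp (coupling N p * (mag N \<sigma>)\<^sup>2)"

lemma pt_bounds: "0 < p * edge_tanh N p" "p * edge_tanh N p \<le> 1 / 2" "\<bar>p * edge_tanh N p\<bar> < 1"
  using edge_tanh_bounds[OF N p(1)] p by auto

lemma w_eq_prod: "\<sigma> \<in> spins N \<Longrightarrow> w \<sigma> = (\<Prod>ij\<in>edges N. 1 + p * edge_tanh N p * edge_spin \<sigma> ij)"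
  by (simp only: w_def coupling_def prod_one_plus_edge_spin[OF pt_bounds(3)])

lemma w_pos: "w \<sigma> > 0"
  unfolding w_def using pt_bounds power_mono[of "p * edge_tanh N p" "1/2" 2]
  by (intro mult_pos_pos zero_less_power) (auto simp: power2_eq_square)

lemma integrable_W: "integrable M (W \<sigma>)"
  unfolding W_def reduced_weight_def by (rule integrable_prod)

lemma expectation_W: "\<sigma> \<in> spins N \<Longrightarrow> expectation (W \<sigma>) = w \<sigma>"
  unfolding W_def reduced_weight_def expectation_prod by (simp only: w_eq_prod mult.assoc)

lemma W_mult_W:
  assumes "\<omega> \<in> space M"
  shows "W \<sigma> \<omega> * W \<tau> \<omega> = (\<Prod>ij\<in>edges N. 1 +
    (edge_tanh N p * edge_spin \<sigma> ij + edge_tanh N p * edge_spin \<tau> ij +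
     edge_tanh N p * edge_spin \<sigma> ij * (edge_tanh N p * edge_spin \<tau> ij)) * X ij \<omega>)"
  unfolding W_def reduced_weight_def prod.distrib[symmetric]
proof (rule prod.cong[OF refl])
  fix ij assume "ij \<in> edges N"
  then show "(1 + edge_tanh N p * edge_spin \<sigma> ij * X ij \<omega>) * (1 + edge_tanh N p * edge_spin \<tau> ij * X ij \<omega>) =
    1 + (edge_tanh N p * edge_spin \<sigma> ij + edge_tanh N p * edge_spin \<tau> ij +
     edge_tanh N p * edge_spin \<sigma> ij * (edge_tanh N p * edge_spin \<tau> ij)) * X ij \<omega>"
    using X01[OF _ assms, of ij] by (auto simp: algebra_simps)
qed

lemma integrable_W_mult_W: "integrable M (\<lambda>\<omega>. W \<sigma> \<omega> * W \<tau> \<omega>)"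
  by (subst Bochner_Integration.integrable_cong[OF refl W_mult_W], assumption, rule integrable_prod)

text \<open>A two-sided bound on the covariance follows from a one-sided bound on the exponential moment of
the overlap, because the ratio of the moments is at least \<open>1 - 2 / (N p)\<close> for every pair: whenever
\<open>1 - \<delta> \<le> r \<le> R\<close> and \<open>\<delta> \<ge> 0\<close>, then \<open>\<bar>r - 1\<bar> \<le> R - 1 + 2 \<delta>\<close>.\<close>

lemma covariance_W_le:
  assumes \<sigma>: "\<sigma> \<in> spins N" and \<tau>: "\<tau> \<in> spins N" and Np: "3 \<le> real N * p"
  shows "\<bar>expectation (\<lambda>\<omega>. W \<sigma> \<omega> * W \<tau> \<omega>) - w \<sigma> * w \<tau>\<bar> \<le>
    w \<sigma> * w \<tau> * (exp (1 / (2 * real N ^ 2 * p) * ((overlap N \<sigma> \<tau>)\<^sup>2 + 1 / 4)) - 1 + 4 / (real N * p))"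
proof -
  define a where "a = p * edge_tanh N p"
  define r where "r = (\<Prod>ij\<in>edges N. 1 + pair_excess N p * ((edge_spin \<sigma> ij - a) * (edge_spin \<tau> ij - a)))"
  have "expectation (\<lambda>\<omega>. W \<sigma> \<omega> * W \<tau> \<omega>) = (\<Prod>ij\<in>edges N. 1 + p *
    (edge_tanh N p * edge_spin \<sigma> ij + edge_tanh N p * edge_spin \<tau> ij +
     edge_tanh N p * edge_spin \<sigma> ij * (edge_tanh N p * edge_spin \<tau> ij)))"
    by (subst Bochner_Integration.integral_cong[OF refl W_mult_W], assumption, rule expectation_prod)
  also have "\<dots> = (\<Prod>ij\<in>edges N. (1 + p * edge_tanh N p * edge_spin \<sigma> ij) * (1 + p * edge_tanh N p * edge_spin \<tau> ij) *
    (1 + pair_excess N p * ((edge_spin \<sigma> ij - p * edge_tanh N p) * (edge_spin \<tau> ij - p * edge_tanh N p))))"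
    by (intro prod.cong refl pair_factor N p edge_spin_values[OF \<sigma>] edge_spin_values[OF \<tau>])
  also have "\<dots> = w \<sigma> * w \<tau> * r"
    unfolding r_def a_def w_eq_prod[OF \<sigma>] w_eq_prod[OF \<tau>] by (simp only: prod.distrib)
  finally have "expectation (\<lambda>\<omega>. W \<sigma> \<omega> * W \<tau> \<omega>) - w \<sigma> * w \<tau> = w \<sigma> * w \<tau> * (r - 1)"
    by (simp add: algebra_simps)
  then have "\<bar>expectation (\<lambda>\<omega>. W \<sigma> \<omega> * W \<tau> \<omega>) - w \<sigma> * w \<tau>\<bar> = w \<sigma> * w \<tau> * \<bar>r - 1\<bar>"
    using w_pos[of \<sigma>] w_pos[of \<tau>] by (simp add: abs_mult)
  also have "\<bar>r - 1\<bar> \<le> exp (1 / (2 * real N ^ 2 * p) * ((overlap N \<sigma> \<tau>)\<^sup>2 + 1 / 4)) - 1 + 4 / (real N * p)"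
  proof -
    have "r \<le> exp (1 / (2 * real N ^ 2 * p) * ((overlap N \<sigma> \<tau>)\<^sup>2 + 1 / 4))" "1 - 2 / (real N * p) \<le> r"
      using pair_ratio_bounds[OF N p \<sigma> \<tau>] Np unfolding r_def a_def by auto
    moreover have "0 \<le> 2 / (real N * p)" "4 / (real N * p) = 2 * (2 / (real N * p))" using Np by auto
    ultimately show ?thesis by linarith
  qed
  finally show ?thesis using w_pos[of \<sigma>] w_pos[of \<tau>] by (simp add: mult_left_mono)
qed

text \<open>Dominates the variance of \<open>\<Sum>\<sigma>\<in>S. W \<sigma>\<close>, relative to the square of the mean partition function,
simultaneously for all sets \<open>S\<close> of configurations, once \<open>N p \<ge> 3\<close>.\<close>

definition variance_bound :: real where
  "variance_bound = (\<Sum>\<sigma>\<in>spins N. \<Sum>\<tau>\<in>spins N. w \<sigma> * w \<tau> *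
     (exp (1 / (2 * real N ^ 2 * p) * ((overlap N \<sigma> \<tau>)\<^sup>2 + 1 / 4)) - 1 + 4 / (real N * p)))
     / (\<Sum>\<sigma>\<in>spins N. w \<sigma>)\<^sup>2"

lemma sum_w_pos: "(\<Sum>\<sigma>\<in>spins N. w \<sigma>) > 0"
  by (intro sum_pos finite_spins spins_nonempty w_pos)

lemma variance_sum_W_le:
  assumes S: "S \<subseteq> spins N" and Np: "3 \<le> real N * p"
  shows "variance (\<lambda>\<omega>. \<Sum>\<sigma>\<in>S. W \<sigma> \<omega>) \<le> variance_bound * (\<Sum>\<sigma>\<in>spins N. w \<sigma>)\<^sup>2"
proof -
  have fin: "finite S" using S finite_spins finite_subset by blast
  have E: "expectation (\<lambda>\<omega>. \<Sum>\<sigma>\<in>S. W \<sigma> \<omega>) = (\<Sum>\<sigma>\<in>S. w \<sigma>)"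
    using S by (subst Bochner_Integration.integral_sum) (auto simp: integrable_W expectation_W subset_iff intro!: sum.cong)
  have sq: "(\<Sum>\<sigma>\<in>S. W \<sigma> \<omega>)\<^sup>2 = (\<Sum>\<sigma>\<in>S. \<Sum>\<tau>\<in>S. W \<sigma> \<omega> * W \<tau> \<omega>)" for \<omega>
    by (simp add: power2_eq_square sum_product)
  have "variance (\<lambda>\<omega>. \<Sum>\<sigma>\<in>S. W \<sigma> \<omega>) = expectation (\<lambda>\<omega>. (\<Sum>\<sigma>\<in>S. W \<sigma> \<omega>)\<^sup>2) - (\<Sum>\<sigma>\<in>S. w \<sigma>)\<^sup>2"
    by (subst variance_eq) (auto simp: E sq integrable_W integrable_W_mult_W)
  also have "expectation (\<lambda>\<omega>. (\<Sum>\<sigma>\<in>S. W \<sigma> \<omega>)\<^sup>2) = (\<Sum>\<sigma>\<in>S. \<Sum>\<tau>\<in>S. expectation (\<lambda>\<omega>. W \<sigma> \<omega> * W \<tau> \<omega>))"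
    unfolding sq by (simp add: Bochner_Integration.integral_sum integrable_W_mult_W)
  also have "\<dots> - (\<Sum>\<sigma>\<in>S. w \<sigma>)\<^sup>2 = (\<Sum>\<sigma>\<in>S. \<Sum>\<tau>\<in>S. expectation (\<lambda>\<omega>. W \<sigma> \<omega> * W \<tau> \<omega>) - w \<sigma> * w \<tau>)"
    by (simp add: power2_eq_square sum_product sum_subtractf)
  also have "\<dots> \<le> (\<Sum>\<sigma>\<in>S. \<Sum>\<tau>\<in>S. w \<sigma> * w \<tau> *
     (exp (1 / (2 * real N ^ 2 * p) * ((overlap N \<sigma> \<tau>)\<^sup>2 + 1 / 4)) - 1 + 4 / (real N * p)))"
    using S by (intro sum_mono order_trans[OF abs_ge_self covariance_W_le] Np) auto
  also have "\<dots> \<le> (\<Sum>\<sigma>\<in>spins N. \<Sum>\<tau>\<in>spins N. w \<sigma> * w \<tau> *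
     (exp (1 / (2 * real N ^ 2 * p) * ((overlap N \<sigma> \<tau>)\<^sup>2 + 1 / 4)) - 1 + 4 / (real N * p)))"
  proof -
    have nonneg: "0 \<le> w \<sigma> * w \<tau> *
       (exp (1 / (2 * real N ^ 2 * p) * ((overlap N \<sigma> \<tau>)\<^sup>2 + 1 / 4)) - 1 + 4 / (real N * p))" for \<sigma> \<tau>
    proof -
      have "0 \<le> 1 / (2 * real N ^ 2 * p) * ((overlap N \<sigma> \<tau>)\<^sup>2 + 1 / 4)" using p by simp
      then have "1 \<le> exp (1 / (2 * real N ^ 2 * p) * ((overlap N \<sigma> \<tau>)\<^sup>2 + 1 / 4))" by (simp only: one_le_exp_iff)
      moreover have "0 \<le> 4 / (real N * p)" using p by simp
      ultimately show ?thesis using w_pos[of \<sigma>] w_pos[of \<tau>] by (intro mult_nonneg_nonneg) linarith+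
    qed
    have "(\<Sum>\<sigma>\<in>S. \<Sum>\<tau>\<in>S. w \<sigma> * w \<tau> *
     (exp (1 / (2 * real N ^ 2 * p) * ((overlap N \<sigma> \<tau>)\<^sup>2 + 1 / 4)) - 1 + 4 / (real N * p))) \<le>
      (\<Sum>\<sigma>\<in>S. \<Sum>\<tau>\<in>spins N. w \<sigma> * w \<tau> *
     (exp (1 / (2 * real N ^ 2 * p) * ((overlap N \<sigma> \<tau>)\<^sup>2 + 1 / 4)) - 1 + 4 / (real N * p)))"
      by (intro sum_mono sum_mono2 S finite_spins nonneg)
    also have "\<dots> \<le> (\<Sum>\<sigma>\<in>spins N. \<Sum>\<tau>\<in>spins N. w \<sigma> * w \<tau> *
     (exp (1 / (2 * real N ^ 2 * p) * ((overlap N \<sigma> \<tau>)\<^sup>2 + 1 / 4)) - 1 + 4 / (real N * p)))"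
      by (intro sum_mono2 S finite_spins sum_nonneg nonneg)
    finally show ?thesis .
  qed
  also have "\<dots> = variance_bound * (\<Sum>\<sigma>\<in>spins N. w \<sigma>)\<^sup>2"
    using sum_w_pos by (simp add: variance_bound_def)
  finally show ?thesis .
qed

lemma prob_sum_W_deviation:
  assumes S: "S \<subseteq> spins N" and Np: "3 \<le> real N * p" and \<eta>: "\<eta> > 0"
  shows "prob {\<omega>\<in>space M. \<eta> * (\<Sum>\<sigma>\<in>spins N. w \<sigma>) \<le> \<bar>(\<Sum>\<sigma>\<in>S. W \<sigma> \<omega>) - (\<Sum>\<sigma>\<in>S. w \<sigma>)\<bar>}
    \<le> variance_bound / \<eta>\<^sup>2"
proof -
  have E: "expectation (\<lambda>\<omega>. \<Sum>\<sigma>\<in>S. W \<sigma> \<omega>) = (\<Sum>\<sigma>\<in>S. w \<sigma>)"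
    using S by (subst Bochner_Integration.integral_sum) (auto simp: integrable_W expectation_W subset_iff intro!: sum.cong)
  have "prob {\<omega>\<in>space M. \<eta> * (\<Sum>\<sigma>\<in>spins N. w \<sigma>) \<le> \<bar>(\<Sum>\<sigma>\<in>S. W \<sigma> \<omega>) - expectation (\<lambda>\<omega>. \<Sum>\<sigma>\<in>S. W \<sigma> \<omega>)\<bar>}
    \<le> variance (\<lambda>\<omega>. \<Sum>\<sigma>\<in>S. W \<sigma> \<omega>) / (\<eta> * (\<Sum>\<sigma>\<in>spins N. w \<sigma>))\<^sup>2"
  proof (rule Chebyshev_inequality)
    show "integrable M (\<lambda>\<omega>. (\<Sum>\<sigma>\<in>S. W \<sigma> \<omega>)\<^sup>2)"
      by (simp add: power2_eq_square sum_product integrable_W_mult_W)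
  qed (use integrable_W sum_w_pos \<eta> in \<open>auto intro!: borel_measurable_sum borel_measurable_integrable\<close>)
  also have "\<dots> \<le> (variance_bound * (\<Sum>\<sigma>\<in>spins N. w \<sigma>)\<^sup>2) / (\<eta> * (\<Sum>\<sigma>\<in>spins N. w \<sigma>))\<^sup>2"
    by (intro divide_right_mono variance_sum_W_le S Np) simp
  also have "\<dots> = variance_bound / \<eta>\<^sup>2"
    using sum_w_pos by (simp add: power_mult_distrib)
  finally show ?thesis unfolding E .
qed

text \<open>Chebyshev's inequality for the numerators and for the partition function. Finitely many sets of
configurations are treated at once so that the exceptional event does not depend on the set.\<close>

lemma gibbs_ratio_concentration:
  assumes \<S>: "finite \<S>" "\<And>S. S \<in> \<S> \<Longrightarrow> S \<subseteq> spins N"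
    and Np: "3 \<le> real N * p" and \<eta>: "0 < \<eta>" "\<eta> \<le> 1 / 2"
  obtains B where "B \<in> events" "prob B \<le> (real (card \<S>) + 1) * (variance_bound / \<eta>\<^sup>2)"
    and "\<forall>\<omega>\<in>space M - B. \<forall>S\<in>\<S>.
      \<bar>(\<Sum>\<sigma>\<in>S. W \<sigma> \<omega>) / (\<Sum>\<sigma>\<in>spins N. W \<sigma> \<omega>) - (\<Sum>\<sigma>\<in>S. w \<sigma>) / (\<Sum>\<sigma>\<in>spins N. w \<sigma>)\<bar> \<le> 4 * \<eta>"
proof -
  define w\<^sub>0 where "w\<^sub>0 = (\<Sum>\<sigma>\<in>spins N. w \<sigma>)"
  define D where "D S = {\<omega>\<in>space M. \<eta> * w\<^sub>0 \<le> \<bar>(\<Sum>\<sigma>\<in>S. W \<sigma> \<omega>) - (\<Sum>\<sigma>\<in>S. w \<sigma>)\<bar>}" for S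
  have w0: "w\<^sub>0 > 0" using sum_w_pos by (simp add: w\<^sub>0_def)
  have [measurable]: "W \<sigma> \<in> borel_measurable M" for \<sigma> using integrable_W by auto
  have D: "D S \<in> events" for S unfolding D_def by measurable
  have "prob (\<Union>S\<in>insert (spins N) \<S>. D S) \<le> (\<Sum>S\<in>insert (spins N) \<S>. prob (D S))"
    using \<S> D by (intro finite_measure_subadditive_finite) auto
  also have "\<dots> \<le> (\<Sum>S\<in>insert (spins N) \<S>. variance_bound / \<eta>\<^sup>2)"
    unfolding D_def w\<^sub>0_def using \<S> by (intro sum_mono prob_sum_W_deviation Np \<eta>) auto
  also have "\<dots> \<le> (real (card \<S>) + 1) * (variance_bound / \<eta>\<^sup>2)"
  proof -
    have "0 \<le> variance_bound / \<eta>\<^sup>2"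
      by (rule order_trans[OF measure_nonneg prob_sum_W_deviation[OF order_refl Np \<eta>(1)]])
    moreover have "card (insert (spins N) \<S>) \<le> card \<S> + 1" using \<S> by (simp add: card_insert_if)
    ultimately show ?thesis unfolding sum_constant by (intro mult_right_mono) auto
  qed
  finally have prob: "prob (\<Union>S\<in>insert (spins N) \<S>. D S) \<le> (real (card \<S>) + 1) * (variance_bound / \<eta>\<^sup>2)" .
  show thesis
  proof (rule that[OF _ prob], goal_cases)
    case 1
    show "(\<Union>S\<in>insert (spins N) \<S>. D S) \<in> events"
      using \<S>(1) D by (intro sets.finite_UN) auto
  next
    case 2
    show ?case
    proof (intro ballI)
      fix \<omega> S assume \<omega>: "\<omega> \<in> space M - (\<Union>S\<in>insert (spins N) \<S>. D S)" and S: "S \<in> \<S>"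
      define A Z F where "A = (\<Sum>\<sigma>\<in>S. W \<sigma> \<omega>)" and "Z = (\<Sum>\<sigma>\<in>spins N. W \<sigma> \<omega>)" and "F = (\<Sum>\<sigma>\<in>S. w \<sigma>)"
      have A: "\<bar>A - F\<bar> \<le> \<eta> * w\<^sub>0" and Z: "\<bar>Z - w\<^sub>0\<bar> \<le> \<eta> * w\<^sub>0"
        using \<omega> S by (auto simp: D_def A_def Z_def F_def w\<^sub>0_def)
      have F: "0 \<le> F" "F \<le> w\<^sub>0"
        using w_pos \<S>(2)[OF S] by (auto simp: F_def w\<^sub>0_def less_imp_le intro!: sum_nonneg sum_mono2 finite_spins)
      have "\<eta> * w\<^sub>0 \<le> 1/2 * w\<^sub>0" using \<eta> w0 by (intro mult_right_mono) auto
      then have Zpos: "w\<^sub>0 / 2 \<le> Z" using Z by linarith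
      then have Z0: "Z > 0" using w0 by linarith
      have "A / Z - F / w\<^sub>0 = ((A - F) + (F / w\<^sub>0) * (w\<^sub>0 - Z)) / Z"
        using w0 Z0 by (simp add: field_simps)
      then have "\<bar>A / Z - F / w\<^sub>0\<bar> = \<bar>(A - F) + (F / w\<^sub>0) * (w\<^sub>0 - Z)\<bar> / Z"
        using Z0 by simp
      also have "\<dots> \<le> (2 * (\<eta> * w\<^sub>0)) / Z"
      proof (rule divide_right_mono)
        have "\<bar>(F / w\<^sub>0) * (w\<^sub>0 - Z)\<bar> \<le> 1 * (\<eta> * w\<^sub>0)"
          unfolding abs_mult using F w0 Z by (intro mult_mono) auto
        then show "\<bar>(A - F) + (F / w\<^sub>0) * (w\<^sub>0 - Z)\<bar> \<le> 2 * (\<eta> * w\<^sub>0)" using A by linarith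
      qed (use Z0 in simp)
      also have "\<dots> \<le> (2 * (\<eta> * w\<^sub>0)) / (w\<^sub>0 / 2)"
        using Zpos w0 \<eta> by (intro divide_left_mono) auto
      also have "\<dots> = 4 * \<eta>" using w0 by simp
      finally show "\<bar>(\<Sum>\<sigma>\<in>S. W \<sigma> \<omega>) / (\<Sum>\<sigma>\<in>spins N. W \<sigma> \<omega>) - (\<Sum>\<sigma>\<in>S. w \<sigma>) / (\<Sum>\<sigma>\<in>spins N. w \<sigma>)\<bar> \<le> 4 * \<eta>"
        by (simp add: A_def Z_def F_def w\<^sub>0_def)
    qed
  qed
qed

text \<open>The two-replica bound with \<open>\<kappa> = 1 / (2 N\<^sup>2 p)\<close>. The powers of two and the Gaussian normalization cancel
between numerator and denominator.\<close>

lemma variance_bound_le: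
  fixes s :: real
  assumes Np: "3 \<le> real N * p" and s: "s > 0"
  defines "b \<equiv> coupling N p"
  assumes int: "integrable lborel (\<lambda>x. field_density b s N x * exp (1 / (2 * p) * tanh (2 * b * x / s) ^ 4))"
  shows "variance_bound \<le> exp (1 / (8 * real N ^ 2 * p)) / sqrt (1 - 1 / (real N * p)) *
     ((LINT x|lborel. field_density b s N x * exp (1 / (2 * p) * tanh (2 * b * x / s) ^ 4)) /
      (LINT x|lborel. field_density b s N x))\<^sup>2 - 1 + 4 / (real N * p)"
proof -
  define \<kappa> where "\<kappa> = 1 / (2 * real N ^ 2 * p)"
  define C where "C = sqrt (1 - (p * edge_tanh N p)\<^sup>2) ^ (N * N)"
  define Q where "Q = (\<Sum>\<sigma>\<in>spins N. \<Sum>\<tau>\<in>spins N.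
       exp (b * (mag N \<sigma>)\<^sup>2) * exp (b * (mag N \<tau>)\<^sup>2) * exp (\<kappa> * (overlap N \<sigma> \<tau>)\<^sup>2))"
  define Z where "Z = (\<Sum>\<sigma>\<in>spins N. exp (b * (mag N \<sigma>)\<^sup>2))"
  define c where "c = 2 ^ N / sqrt (pi * s\<^sup>2 / b)"
  define I where "I = (LINT x|lborel. field_density b s N x)"
  define J where "J = (LINT x|lborel. field_density b s N x * exp (1 / (2 * p) * tanh (2 * b * x / s) ^ 4))"
  have b: "b > 0" unfolding b_def by (rule coupling_pos[OF N p(1)])
  have c: "c > 0" using b s by (simp add: c_def)
  have \<kappa>: "\<kappa> > 0" using N p by (simp add: \<kappa>_def)
  have \<kappa>N: "2 * \<kappa> * real N = 1 / (real N * p)" "\<kappa> * real N ^ 2 = 1 / (2 * p)" "\<kappa> * (1 / 4) = 1 / (8 * real N ^ 2 * p)"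
    using N by (auto simp: \<kappa>_def power2_eq_square)
  have w: "w \<sigma> = C * exp (b * (mag N \<sigma>)\<^sup>2)" for \<sigma> by (simp add: w_def C_def b_def)
  have C: "C > 0" using w_pos by (simp add: w zero_less_mult_iff)
  have Z: "Z > 0" unfolding Z_def by (intro sum_pos finite_spins spins_nonempty) simp
  have sumw: "(\<Sum>\<sigma>\<in>spins N. w \<sigma>) = C * Z" by (simp add: w Z_def sum_distrib_left)
  have ZI: "Z = c * I" unfolding Z_def c_def I_def by (rule curie_weiss_partition[OF b s])
  have "w \<sigma> * w \<tau> * (exp (\<kappa> * ((overlap N \<sigma> \<tau>)\<^sup>2 + 1 / 4)) - 1 + 4 / (real N * p)) =
    C\<^sup>2 * exp (\<kappa> * (1 / 4)) * (exp (b * (mag N \<sigma>)\<^sup>2) * exp (b * (mag N \<tau>)\<^sup>2) * exp (\<kappa> * (overlap N \<sigma> \<tau>)\<^sup>2))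
    + (4 / (real N * p) - 1) * (w \<sigma> * w \<tau>)" for \<sigma> \<tau>
    unfolding distrib_left exp_add w by (simp add: power2_eq_square algebra_simps)
  then have "(\<Sum>\<sigma>\<in>spins N. \<Sum>\<tau>\<in>spins N. w \<sigma> * w \<tau> *
      (exp (\<kappa> * ((overlap N \<sigma> \<tau>)\<^sup>2 + 1 / 4)) - 1 + 4 / (real N * p))) =
    C\<^sup>2 * exp (\<kappa> * (1 / 4)) * Q + (4 / (real N * p) - 1) * ((\<Sum>\<sigma>\<in>spins N. w \<sigma>) * (\<Sum>\<sigma>\<in>spins N. w \<sigma>))"
    by (simp only: sum.distrib sum_distrib_left[symmetric] Q_def sum_product)
  then have vb: "variance_bound = exp (\<kappa> * (1 / 4)) * (Q / Z\<^sup>2) - 1 + 4 / (real N * p)"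
    unfolding variance_bound_def \<kappa>_def[symmetric] sumw using C Z
    by (simp add: field_simps power2_eq_square)
  have "Q \<le> 1 / sqrt (1 - 2 * \<kappa> * real N) * (c * J)\<^sup>2"
    unfolding Q_def c_def J_def \<kappa>N(2)[symmetric]
  proof (rule two_replica_partition_le[OF b s \<kappa>])
    have "1 / (real N * p) \<le> 1 / 3" using Np by (intro divide_left_mono) auto
    then show "4 * \<kappa> * real N \<le> 1" using \<kappa>N(1) by linarith
  qed (use int in \<open>simp only: \<kappa>N\<close>)
  then have "Q / Z\<^sup>2 \<le> 1 / sqrt (1 - 2 * \<kappa> * real N) * (c * J)\<^sup>2 / Z\<^sup>2"
    by (rule divide_right_mono) simp
  also have "\<dots> = 1 / sqrt (1 - 1 / (real N * p)) * (J / I)\<^sup>2"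
    unfolding ZI \<kappa>N(1) using c by (simp add: power_mult_distrib power_divide)
  finally have "exp (\<kappa> * (1 / 4)) * (Q / Z\<^sup>2) \<le> exp (\<kappa> * (1 / 4)) * (1 / sqrt (1 - 1 / (real N * p)) * (J / I)\<^sup>2)"
    by (rule mult_left_mono) simp
  then show ?thesis unfolding vb \<kappa>N I_def J_def by simp
qed

end

section \<open>The Levy distance\<close>

lemma levy_dist_le:
  assumes "\<epsilon> > 0" and "\<And>t. measure \<nu> {..t - \<epsilon>} - \<epsilon> \<le> measure \<mu> {..t}"
    and "\<And>t. measure \<mu> {..t} \<le> measure \<nu> {..t + \<epsilon>} + \<epsilon>"
  shows "levy_dist \<nu> \<mu> \<le> \<epsilon>"
  unfolding levy_dist_def using assms by (intro cInf_lower bdd_belowI[of _ 0]) auto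

text \<open>Distribution functions are monotone, so they only have to be compared on a grid of mesh \<open>\<epsilon> / 2\<close> over
an interval that carries most of the mass of \<open>\<mu>\<close>. The comparison may itself be off by
\<open>\<epsilon> / 2\<close> in both coordinates, which leaves room for the horizontal error of a smoothing.\<close>

lemma levy_dist_le_of_grid:
  assumes \<mu>: "prob_space \<mu>" "sets \<mu> = sets borel" and \<epsilon>: "\<epsilon> > 0"
  obtains T :: "real set" where "finite T"
    and "\<forall>\<nu>. prob_space \<nu> \<longrightarrow> sets \<nu> = sets borel \<longrightarrow>
      (\<forall>t\<in>T. measure \<nu> {..t} \<le> measure \<mu> {..t + \<epsilon> / 2} + \<epsilon> / 2 \<and>
        measure \<mu> {..t - \<epsilon> / 2} - \<epsilon> / 2 \<le> measure \<nu> {..t}) \<longrightarrow>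
      levy_dist \<nu> \<mu> \<le> \<epsilon>"
proof -
  have space: "space \<nu> = UNIV" if "sets \<nu> = sets borel" for \<nu> :: "real measure"
    using sets_eq_imp_space_eq[OF that] by simp
  interpret \<mu>: real_distribution \<mu>
    using \<mu> space[OF \<mu>(2)] by (simp add: real_distribution_def real_distribution_axioms_def)
  have "eventually (\<lambda>x. cdf \<mu> x < \<epsilon> / 2) at_bot"
    using \<epsilon> by (intro order_tendstoD(2)[OF \<mu>.cdf_lim_at_bot]) simp
  then obtain a where a: "\<And>x. x \<le> a \<Longrightarrow> cdf \<mu> x < \<epsilon> / 2" by (auto simp: eventually_at_bot_linorder)
  have "eventually (\<lambda>x. 1 - \<epsilon> / 2 < cdf \<mu> x) at_top"
    using \<epsilon> by (intro order_tendstoD(1)[OF \<mu>.cdf_lim_at_top_prob]) simp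
  then obtain c where c: "\<And>x. c \<le> x \<Longrightarrow> 1 - \<epsilon> / 2 < cdf \<mu> x" by (auto simp: eventually_at_top_linorder)
  define K where "K = max (\<epsilon> / 2 - a) (c + \<epsilon> / 2)"
  define n where "n = \<lceil>\<bar>K\<bar> / (\<epsilon> / 2)\<rceil> + 1"
  define T where "T = {-K, K} \<union> (\<lambda>k. of_int k * (\<epsilon> / 2)) ` {-n..n}"
  have grid: "of_int k * (\<epsilon> / 2) \<in> T" if "\<bar>of_int k * (\<epsilon> / 2)\<bar> \<le> \<bar>K\<bar> + \<epsilon> / 2" for k :: int
  proof -
    have "\<bar>of_int k :: real\<bar> * (\<epsilon> / 2) \<le> (\<bar>K\<bar> / (\<epsilon> / 2) + 1) * (\<epsilon> / 2)"
      using that \<epsilon> by (simp add: abs_mult distrib_right)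
    then have "\<bar>of_int k :: real\<bar> \<le> \<bar>K\<bar> / (\<epsilon> / 2) + 1"
      using \<epsilon> by (subst (asm) mult_le_cancel_right_pos) auto
    also have "\<dots> \<le> of_int n" by (simp add: n_def)
    finally have "k \<in> {-n..n}" by auto
    then show ?thesis unfolding T_def by (intro UnI2 imageI)
  qed
  show thesis
  proof (rule that[of T], goal_cases)
    case 1
    show "finite T" by (simp add: T_def)
  next
    case 2
    show ?case
    proof (intro allI impI)
      fix \<nu> :: "real measure"
      assume \<nu>: "prob_space \<nu>" "sets \<nu> = sets borel"
        and close: "\<forall>t\<in>T. measure \<nu> {..t} \<le> measure \<mu> {..t + \<epsilon> / 2} + \<epsilon> / 2 \<and>
          measure \<mu> {..t - \<epsilon> / 2} - \<epsilon> / 2 \<le> measure \<nu> {..t}"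
      interpret \<nu>: real_distribution \<nu>
        using \<nu> space[OF \<nu>(2)] by (simp add: real_distribution_def real_distribution_axioms_def)
      have up: "cdf \<nu> t \<le> cdf \<mu> (t + \<epsilon> / 2) + \<epsilon> / 2"
        and low: "cdf \<mu> (t - \<epsilon> / 2) - \<epsilon> / 2 \<le> cdf \<nu> t" if "t \<in> T" for t
        using bspec[OF close that] by (simp_all add: cdf_def)
      have KT: "K \<in> T" "-K \<in> T" by (auto simp: T_def)
      note mono = \<mu>.cdf_nondecreasing \<nu>.cdf_nondecreasing
      show "levy_dist \<nu> \<mu> \<le> \<epsilon>"
      proof (rule levy_dist_le[OF \<epsilon>])
        fix t :: real
        define y where "y = t - \<epsilon>"
        consider "y \<le> -K" | "K < y" | "-K < y" "y \<le> K" by linarith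
        then have "cdf \<nu> y \<le> cdf \<mu> t + \<epsilon>"
        proof cases
          case 1
          have "cdf \<nu> y \<le> cdf \<nu> (-K)" using 1 by (rule mono)
          also have "\<dots> \<le> cdf \<mu> (-K + \<epsilon> / 2) + \<epsilon> / 2" by (rule up[OF KT(2)])
          also have "cdf \<mu> (-K + \<epsilon> / 2) < \<epsilon> / 2" by (rule a) (simp add: K_def)
          finally show ?thesis using \<mu>.cdf_nonneg[of t] by simp
        next
          case 2
          have "1 - \<epsilon> / 2 < cdf \<mu> t" by (rule c) (use 2 \<epsilon> in \<open>simp add: y_def K_def\<close>)
          then show ?thesis using \<nu>.cdf_bounded_prob[of y] \<epsilon> by simp
        next
          case 3
          define g where "g = of_int \<lceil>y / (\<epsilon> / 2)\<rceil> * (\<epsilon> / 2)"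
          have g: "y \<le> g" "g \<le> y + \<epsilon> / 2"
          proof -
            have "y / (\<epsilon> / 2) * (\<epsilon> / 2) \<le> g" "g \<le> (y / (\<epsilon> / 2) + 1) * (\<epsilon> / 2)"
              unfolding g_def using \<epsilon> by (intro mult_right_mono of_int_ceiling_le_add_one le_of_int_ceiling; simp)+
            then show "y \<le> g" "g \<le> y + \<epsilon> / 2" using \<epsilon> by (simp_all add: distrib_right)
          qed
          have "\<bar>g\<bar> \<le> \<bar>K\<bar> + \<epsilon> / 2" using g 3 \<epsilon> by linarith
          then have "g \<in> T" unfolding g_def by (rule grid)
          then have "cdf \<nu> g \<le> cdf \<mu> (g + \<epsilon> / 2) + \<epsilon> / 2" by (rule up)
          moreover have "cdf \<mu> (g + \<epsilon> / 2) \<le> cdf \<mu> t" by (rule mono) (use g in \<open>simp add: y_def\<close>)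
          moreover have "cdf \<nu> y \<le> cdf \<nu> g" using g by (intro mono)
          ultimately show ?thesis using \<epsilon> by linarith
        qed
        then show "measure \<nu> {..t - \<epsilon>} - \<epsilon> \<le> measure \<mu> {..t}" by (simp add: y_def cdf_def)
      next
        fix t :: real
        define y where "y = t + \<epsilon>"
        consider "K \<le> y" | "y < -K" | "-K \<le> y" "y < K" by linarith
        then have "cdf \<mu> t \<le> cdf \<nu> y + \<epsilon>"
        proof cases
          case 1
          have "1 - \<epsilon> / 2 < cdf \<mu> (K - \<epsilon> / 2)" by (rule c) (simp add: K_def)
          also have "\<dots> \<le> cdf \<nu> K + \<epsilon> / 2" using low[OF KT(1)] by simp
          also have "cdf \<nu> K \<le> cdf \<nu> y" using 1 by (rule mono)
          finally show ?thesis using \<mu>.cdf_bounded_prob[of t] by simp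
        next
          case 2
          have "cdf \<mu> t < \<epsilon> / 2" by (rule a) (use 2 \<epsilon> in \<open>simp add: y_def K_def\<close>)
          then show ?thesis using \<nu>.cdf_nonneg[of y] \<epsilon> by simp
        next
          case 3
          define g where "g = of_int \<lfloor>y / (\<epsilon> / 2)\<rfloor> * (\<epsilon> / 2)"
          have g: "g \<le> y" "y - \<epsilon> / 2 \<le> g"
          proof -
            have "g \<le> y / (\<epsilon> / 2) * (\<epsilon> / 2)" "(y / (\<epsilon> / 2) - 1) * (\<epsilon> / 2) \<le> g"
              unfolding g_def using \<epsilon> floor_correct[of "y / (\<epsilon> / 2)"] by (intro mult_right_mono; simp)+
            then show "g \<le> y" "y - \<epsilon> / 2 \<le> g" using \<epsilon> by (simp_all add: left_diff_distrib)
          qed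
          have "\<bar>g\<bar> \<le> \<bar>K\<bar> + \<epsilon> / 2" using g 3 \<epsilon> by linarith
          then have "g \<in> T" unfolding g_def by (rule grid)
          then have "cdf \<mu> (g - \<epsilon> / 2) - \<epsilon> / 2 \<le> cdf \<nu> g" by (rule low)
          moreover have "cdf \<mu> t \<le> cdf \<mu> (g - \<epsilon> / 2)" by (rule mono) (use g in \<open>simp add: y_def\<close>)
          moreover have "cdf \<nu> g \<le> cdf \<nu> y" using g by (intro mono)
          ultimately show ?thesis using \<epsilon> by linarith
        qed
        then show "measure \<mu> {..t} \<le> measure \<nu> {..t + \<epsilon>} + \<epsilon>" by (simp add: y_def cdf_def)
      qed
    qed
  qed
qed

section \<open>Limit of the averaged model\<close>

lemma dominated_convergence_eventually:
  fixes f :: "nat \<Rightarrow> 'a \<Rightarrow> real"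
  assumes "\<And>n. f n \<in> borel_measurable M" "h \<in> borel_measurable M" "integrable M g"
    and lim: "\<And>x. (\<lambda>n. f n x) \<longlonglongrightarrow> h x"
    and dom: "\<forall>\<^sub>F n in sequentially. \<forall>x. \<bar>f n x\<bar> \<le> g x"
  shows "(\<lambda>n. integral\<^sup>L M (f n)) \<longlonglongrightarrow> integral\<^sup>L M h"
proof -
  obtain n0 where n0: "\<And>n x. n \<ge> n0 \<Longrightarrow> \<bar>f n x\<bar> \<le> g x"
    using dom by (auto simp: eventually_sequentially)
  have "(\<lambda>n. integral\<^sup>L M (f (n + n0))) \<longlonglongrightarrow> integral\<^sup>L M h"
  proof (rule integral_dominated_convergence)
    show "AE x in M. (\<lambda>n. f (n + n0) x) \<longlonglongrightarrow> h x"
      using lim by (intro AE_I2 LIMSEQ_ignore_initial_segment) auto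
    show "AE x in M. norm (f (n + n0) x) \<le> g x" for n
      using n0[of "n + n0"] by auto
  qed (use assms in auto)
  then show ?thesis by (rule LIMSEQ_offset)
qed

definition limit_density :: "real \<Rightarrow> real \<Rightarrow> real \<Rightarrow> real" where
  "limit_density \<theta> \<Lambda> x = exp (- \<theta> * x\<^sup>2 - \<Lambda> * x^4 / 12)"

definition limit_law :: "real \<Rightarrow> real \<Rightarrow> real measure" where
  "limit_law \<theta> \<Lambda> = density lborel
     (\<lambda>x. ennreal (limit_density \<theta> \<Lambda> x / (LINT y|lborel. limit_density \<theta> \<Lambda> y)))"

lemma limit_density_measurable [measurable]: "limit_density \<theta> \<Lambda> \<in> borel_measurable borel"
  unfolding limit_density_def by measurable

lemma limit_density_pos: "limit_density \<theta> \<Lambda> x > 0"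
  by (simp add: limit_density_def)

lemma sets_limit_law [simp]: "sets (limit_law \<theta> \<Lambda>) = sets borel"
  by (simp add: limit_law_def)

text \<open>Separates the two sources of the limit density: the quartic term comes from \<open>ln (cosh h) - h\<^sup>2 / 2\<close>, and
the quadratic term comes from the amount by which \<open>2 N b\<close> falls short of the critical value one.\<close>

lemma ln_field_density:
  assumes "b > 0" "s > 0"
  shows "ln (field_density b s N x) =
     real N * (ln (cosh (2 * b * x / s)) - (2 * b * x / s)\<^sup>2 / 2) - (1 - 2 * real N * b) * b / s\<^sup>2 * x\<^sup>2"
proof -
  have "ln (field_density b s N x) = - b * x\<^sup>2 / s\<^sup>2 + real N * ln (cosh (2 * b * x / s))"
    unfolding field_density_def by (simp add: ln_mult ln_realpow cosh_real_pos)
  also have "\<dots> = real N * (ln (cosh (2 * b * x / s)) - (2 * b * x / s)\<^sup>2 / 2) - (1 - 2 * real N * b) * b / s\<^sup>2 * x\<^sup>2"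
    using assms by (simp add: field_simps power2_eq_square)
  finally show ?thesis .
qed

text \<open>A critical Curie--Weiss model with coupling \<open>b\<close>, observed at scale \<open>s\<close>. The assumption \<open>noise\<close> says
that the smoothing of the magnetization disappears in the limit, \<open>\<theta>\<close> and \<open>\<Lambda> / 12\<close> are the limits of the
coefficients of \<open>- x\<^sup>2\<close> and \<open>- x\<^sup>4\<close> in the exponent, and one of them has to be positive for the limit density
to be integrable.\<close>

locale critical_scaling =
  fixes p b s :: "nat \<Rightarrow> real" and \<theta> \<Lambda> :: real
  assumes p_range: "\<And>N. N \<ge> 1 \<Longrightarrow> 0 < p N \<and> p N \<le> 1"
    and s_pos: "\<And>N. N \<ge> 1 \<Longrightarrow> s N > 0"
    and b_pos: "\<And>N. N \<ge> 1 \<Longrightarrow> b N > 0"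
    and b_le: "\<And>N. N \<ge> 1 \<Longrightarrow> 2 * real N * b N \<le> 1"
    and Np: "filterlim (\<lambda>N. real N * p N) at_top sequentially"
    and noise: "(\<lambda>N. (s N)\<^sup>2 / b N) \<longlonglongrightarrow> 0"
    and quartic: "(\<lambda>N. real N * (2 * b N / s N) ^ 4) \<longlonglongrightarrow> \<Lambda>"
    and quadratic: "(\<lambda>N. (1 - 2 * real N * b N) * b N / (s N)\<^sup>2) \<longlonglongrightarrow> \<theta>"
    and nondegenerate: "\<theta> > 0 \<or> \<Lambda> > 0"
begin

abbreviation q :: "nat \<Rightarrow> real \<Rightarrow> real" where
  "q N \<equiv> field_density (b N) (s N) N"

abbreviation psi :: "real \<Rightarrow> real" where
  "psi \<equiv> limit_density \<theta> \<Lambda>"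

abbreviation \<mu> :: "real measure" where
  "\<mu> \<equiv> limit_law \<theta> \<Lambda>"

text \<open>The additional weight that the second replica leaves behind in \<open>two_replica_partition_le\<close>, for
\<open>\<kappa> = 1 / (2 N\<^sup>2 p)\<close>.\<close>

abbreviation tilt :: "nat \<Rightarrow> real \<Rightarrow> real" where
  "tilt N x \<equiv> exp (1 / (2 * p N) * tanh (2 * b N * x / s N) ^ 4)"

lemma eventually_ge_1: "\<forall>\<^sub>F N in sequentially. N \<ge> (1::nat)"
  by (rule eventually_ge_at_top)

lemma field_quartic: "(\<lambda>N. real N * (2 * b N * x / s N) ^ 4) \<longlonglongrightarrow> \<Lambda> * x^4"
  using tendsto_mult[OF quartic tendsto_const[of "x^4"]]
  by (simp add: power_divide power_mult_distrib mult_ac)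

text \<open>The field \<open>2 b x / s\<close> tends to zero because \<open>N\<close> times its fourth power stays bounded. Hence only the leading
term of \<open>ln cosh z - z\<^sup>2 / 2\<close> matters.\<close>

lemma field_to_0: "(\<lambda>N. 2 * b N / s N) \<longlonglongrightarrow> 0"
proof -
  have "(\<lambda>N. (2 * b N / s N) ^ 4) \<longlonglongrightarrow> 0"
  proof (rule Lim_transform_eventually)
    show "(\<lambda>N. real N * (2 * b N / s N) ^ 4 * inverse (real N)) \<longlonglongrightarrow> 0"
      using tendsto_mult[OF quartic lim_inverse_n[where 'a = real]] by simp
    show "\<forall>\<^sub>F N in sequentially. real N * (2 * b N / s N) ^ 4 * inverse (real N) = (2 * b N / s N) ^ 4"
      using eventually_ge_1 by eventually_elim simp
  qed
  then have "(\<lambda>N. root 4 ((2 * b N / s N) ^ 4)) \<longlonglongrightarrow> root 4 0" by (rule tendsto_real_root)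
  moreover have "\<forall>\<^sub>F N in sequentially. root 4 ((2 * b N / s N) ^ 4) = 2 * b N / s N"
    using eventually_ge_1
  proof eventually_elim
    case (elim N)
    then show ?case using b_pos[OF elim] s_pos[OF elim] by (intro real_root_power_cancel) auto
  qed
  ultimately show ?thesis by (simp add: Lim_transform_eventually)
qed

lemma density_limit: "(\<lambda>N. q N x) \<longlonglongrightarrow> psi x"
proof -
  let ?h = "\<lambda>N. 2 * b N * x / s N"
  have main: "(\<lambda>N. real N * (ln (cosh (?h N)) - (?h N)\<^sup>2 / 2)) \<longlonglongrightarrow> \<Lambda> * x^4 * (-1/12)"
  proof (cases "x = 0")
    case False
    have h0: "\<forall>\<^sub>F N in sequentially. ?h N \<noteq> 0"
      using eventually_ge_1
    proof eventually_elim
      case (elim N) then show ?case using b_pos[OF elim] s_pos[OF elim] False by simp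
    qed
    have "?h \<longlonglongrightarrow> 0" using tendsto_mult[OF field_to_0 tendsto_const[of x]] by simp
    then have "filterlim ?h (at 0) sequentially" using h0 by (rule filterlim_atI)
    then have "(\<lambda>N. (ln (cosh (?h N)) - (?h N)\<^sup>2 / 2) / (?h N)^4) \<longlonglongrightarrow> -1/12"
      by (rule filterlim_compose[OF ln_cosh_expansion])
    from tendsto_mult[OF field_quartic[of x] this]
    show ?thesis
    proof (rule Lim_transform_eventually)
      show "\<forall>\<^sub>F N in sequentially. real N * (?h N)^4 * ((ln (cosh (?h N)) - (?h N)\<^sup>2 / 2) / (?h N)^4) =
          real N * (ln (cosh (?h N)) - (?h N)\<^sup>2 / 2)"
        using h0 by eventually_elim (simp del: mult_eq_0_iff divide_eq_0_iff)
    qed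
  qed simp
  have "(\<lambda>N. exp (real N * (ln (cosh (?h N)) - (?h N)\<^sup>2 / 2) - (1 - 2 * real N * b N) * b N / (s N)\<^sup>2 * x\<^sup>2))
      \<longlonglongrightarrow> exp (\<Lambda> * x^4 * (-1/12) - \<theta> * x\<^sup>2)"
    by (intro tendsto_intros main quadratic)
  moreover have "\<forall>\<^sub>F N in sequentially. exp (real N * (ln (cosh (?h N)) - (?h N)\<^sup>2 / 2) -
      (1 - 2 * real N * b N) * b N / (s N)\<^sup>2 * x\<^sup>2) = q N x"
    using eventually_ge_1
  proof eventually_elim
    case (elim N)
    show ?case unfolding ln_field_density[OF b_pos[OF elim] s_pos[OF elim], symmetric]
      by (simp add: field_density_pos)
  qed
  moreover have "exp (\<Lambda> * x^4 * (-1/12) - \<theta> * x\<^sup>2) = psi x"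
    by (simp add: limit_density_def)
  ultimately show ?thesis by (simp only: tendsto_cong)
qed

lemma tilt_limit: "(\<lambda>N. tilt N x) \<longlonglongrightarrow> 1"
proof -
  let ?h = "\<lambda>N. 2 * b N * x / s N"
  have "(\<lambda>N. 1 / (2 * p N) * tanh (?h N) ^ 4) \<longlonglongrightarrow> 0"
  proof (rule tendsto_sandwich[where f = "\<lambda>_. 0"])
    have "(\<lambda>N. inverse (real N * p N)) \<longlonglongrightarrow> 0"
      by (rule tendsto_inverse_0_at_top[OF Np])
    from tendsto_mult[OF field_quartic[of x] this]
    show "(\<lambda>N. real N * (?h N)^4 * inverse (real N * p N)) \<longlonglongrightarrow> 0" by simp
    show "\<forall>\<^sub>F N in sequentially. 0 \<le> 1 / (2 * p N) * tanh (?h N) ^ 4"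
      using eventually_ge_1
    proof eventually_elim
      case (elim N) then show ?case using p_range[OF elim] by simp
    qed
    show "\<forall>\<^sub>F N in sequentially. 1 / (2 * p N) * tanh (?h N) ^ 4 \<le> real N * (?h N)^4 * inverse (real N * p N)"
      using eventually_ge_1
    proof eventually_elim
      case (elim N)
      note p = p_range[OF elim]
      have "tanh (?h N) ^ 4 \<le> 2 * ((?h N)^4 / (1 + (?h N)\<^sup>2))" by (rule tanh_power4_le)
      also have "(?h N)^4 / (1 + (?h N)\<^sup>2) \<le> (?h N)^4 / 1"
        by (intro divide_left_mono) (auto simp: add_pos_nonneg)
      finally have "1 / (2 * p N) * tanh (?h N) ^ 4 \<le> 1 / (2 * p N) * (2 * (?h N)^4)"
        using p by (intro mult_left_mono) auto
      also have "\<dots> = real N * (?h N)^4 * inverse (real N * p N)"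
        using elim p by (simp add: field_simps)
      finally show ?case .
    qed
  qed (rule tendsto_const)
  from tendsto_exp[OF this] show ?thesis by simp
qed

text \<open>Once \<open>N p \<ge> 24\<close>, half of the quartic correction of \<open>cosh_le_exp_quartic\<close> absorbs the tilt. The other half
gives Gaussian decay if \<open>\<Lambda> > 0\<close>, because \<open>x\<^sup>4 / (1 + x\<^sup>2) \<ge> x\<^sup>2 - 1\<close>; otherwise \<open>\<theta> > 0\<close> and the
quadratic term decays by itself.\<close>

lemma density_dominated:
  obtains \<alpha> where "\<alpha> > 0" and "\<forall>\<^sub>F N in sequentially. \<forall>x. q N x * tilt N x \<le> exp (\<alpha> - \<alpha> * x\<^sup>2)"
proof -
  have basic: "q N x * tilt N x \<le> exp (- ((1 - 2 * real N * b N) * b N / (s N)\<^sup>2 * x\<^sup>2) -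
      1 / 24 * (real N * ((2 * b N * x / s N)^4 / (1 + (2 * b N * x / s N)\<^sup>2))))"
    if N: "N \<ge> 1" and large: "real N * p N \<ge> 24" for N x
  proof -
    define h where "h = 2 * b N * x / s N"
    define r where "r = h^4 / (1 + h\<^sup>2)"
    define d where "d = (1 - 2 * real N * b N) * b N / (s N)\<^sup>2 * x\<^sup>2"
    note p = p_range[OF N]
    have r: "r \<ge> 0" by (simp add: r_def add_nonneg_nonneg)
    have "ln (cosh h) \<le> ln (exp (h\<^sup>2 / 2 - h^4 / (12 * (1 + h\<^sup>2))))"
      using cosh_le_exp_quartic[of h] by (subst ln_le_cancel_iff) (auto simp: cosh_real_pos)
    moreover have "h^4 / (12 * (1 + h\<^sup>2)) = r / 12" by (simp add: r_def)
    ultimately have "ln (cosh h) - h\<^sup>2 / 2 \<le> - r / 12" by simp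
    then have 1: "real N * (ln (cosh h) - h\<^sup>2 / 2) \<le> real N * (- r / 12)"
      by (rule mult_left_mono) simp
    have "1 / (2 * p N) * tanh h ^ 4 \<le> 1 / (2 * p N) * (2 * r)"
      using p tanh_power4_le[of h] unfolding r_def by (intro mult_left_mono) auto
    also have "\<dots> = 1 / p N * r" by simp
    also have "\<dots> \<le> real N / 24 * r"
      using p large r by (intro mult_right_mono) (auto simp: field_simps)
    finally have 2: "1 / (2 * p N) * tanh h ^ 4 \<le> real N / 24 * r" .
    have "q N x = exp (ln (q N x))" by (simp add: field_density_pos)
    also have "ln (q N x) = real N * (ln (cosh h) - h\<^sup>2 / 2) - d"
      unfolding ln_field_density[OF b_pos[OF N] s_pos[OF N]] h_def d_def ..
    finally have "q N x * tilt N x = exp (real N * (ln (cosh h) - h\<^sup>2 / 2) - d + 1 / (2 * p N) * tanh h ^ 4)"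
      by (simp add: exp_add h_def)
    also have "\<dots> \<le> exp (- d - 1 / 24 * (real N * r))"
      using 1 2 by (subst exp_le_cancel_iff) (simp add: field_simps)
    finally show ?thesis by (simp add: d_def r_def h_def)
  qed
  have large: "\<forall>\<^sub>F N in sequentially. real N * p N \<ge> 24"
    using Np by (simp add: filterlim_at_top)
  show thesis
  proof (cases "\<Lambda> > 0")
    case True
    have "\<forall>\<^sub>F N in sequentially. \<Lambda> / 2 < real N * (2 * b N / s N)^4"
      using quartic True by (intro order_tendstoD(1)) auto
    moreover have "\<forall>\<^sub>F N in sequentially. 2 * b N / s N < 1"
      using field_to_0 by (intro order_tendstoD(2)) auto
    ultimately have "\<forall>\<^sub>F N in sequentially. \<forall>x. q N x * tilt N x \<le> exp (\<Lambda> / 48 - \<Lambda> / 48 * x\<^sup>2)"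
      using large eventually_ge_1
    proof eventually_elim
      case (elim N)
      note N = elim(4)
      show ?case
      proof
        fix x :: real
        define k where "k = 2 * b N / s N"
        have k: "0 < k" "k < 1" using b_pos[OF N] s_pos[OF N] elim by (auto simp: k_def)
        have kx: "2 * b N * x / s N = k * x" by (simp add: k_def)
        have "(k * x)\<^sup>2 \<le> 1 * x\<^sup>2"
          unfolding power_mult_distrib using k by (intro mult_right_mono power_le_one) auto
        have "\<Lambda> / 2 * (x\<^sup>2 - 1) \<le> \<Lambda> / 2 * (x^4 / (1 + x\<^sup>2))"
        proof -
          have "(x\<^sup>2 - 1) * (1 + x\<^sup>2) \<le> x^4" by (simp add: power2_eq_square power4_eq_xxxx algebra_simps)
          then have "x\<^sup>2 - 1 \<le> x^4 / (1 + x\<^sup>2)" by (simp add: pos_le_divide_eq add_pos_nonneg)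
          then show ?thesis using True by (intro mult_left_mono) auto
        qed
        also have "\<dots> \<le> (real N * k^4) * (x^4 / (1 + x\<^sup>2))"
          using elim(1) by (intro mult_right_mono) (auto simp: k_def add_nonneg_nonneg)
        also have "\<dots> = real N * ((k * x)^4 / (1 + x\<^sup>2))" by (simp add: power_mult_distrib)
        also have "\<dots> \<le> real N * ((k * x)^4 / (1 + (k * x)\<^sup>2))"
          using \<open>(k * x)\<^sup>2 \<le> 1 * x\<^sup>2\<close> by (intro mult_left_mono divide_left_mono) (auto simp: add_pos_nonneg)
        finally have 1: "\<Lambda> / 2 * (x\<^sup>2 - 1) \<le> real N * ((k * x)^4 / (1 + (k * x)\<^sup>2))" .
        have 2: "0 \<le> (1 - 2 * real N * b N) * b N / (s N)\<^sup>2 * x\<^sup>2"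
          using b_le[OF N] b_pos[OF N] by simp
        have "q N x * tilt N x \<le> exp (- ((1 - 2 * real N * b N) * b N / (s N)\<^sup>2 * x\<^sup>2) -
          1 / 24 * (real N * ((k * x)^4 / (1 + (k * x)\<^sup>2))))"
          using basic[OF N elim(3), of x] unfolding kx .
        also have "\<dots> \<le> exp (\<Lambda> / 48 - \<Lambda> / 48 * x\<^sup>2)"
          using 1[unfolded right_diff_distrib] 2 by (subst exp_le_cancel_iff) linarith
        finally show "q N x * tilt N x \<le> exp (\<Lambda> / 48 - \<Lambda> / 48 * x\<^sup>2)" .
      qed
    qed
    then show thesis using True by (intro that[of "\<Lambda> / 48"]) auto
  next
    case False
    then have \<theta>: "\<theta> > 0" using nondegenerate by simp
    have "\<forall>\<^sub>F N in sequentially. \<theta> / 2 < (1 - 2 * real N * b N) * b N / (s N)\<^sup>2"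
      using quadratic \<theta> by (intro order_tendstoD(1)) auto
    then have "\<forall>\<^sub>F N in sequentially. \<forall>x. q N x * tilt N x \<le> exp (\<theta> / 2 - \<theta> / 2 * x\<^sup>2)"
      using large eventually_ge_1
    proof eventually_elim
      case (elim N)
      show ?case
      proof
        fix x :: real
        have 1: "\<theta> / 2 * x\<^sup>2 \<le> (1 - 2 * real N * b N) * b N / (s N)\<^sup>2 * x\<^sup>2"
          using elim(1) by (intro mult_right_mono) auto
        have 2: "0 \<le> real N * ((2 * b N * x / s N)^4 / (1 + (2 * b N * x / s N)\<^sup>2))"
          by (intro mult_nonneg_nonneg divide_nonneg_nonneg add_nonneg_nonneg) auto
        note basic[OF elim(3,2), of x]
        also have "exp (- ((1 - 2 * real N * b N) * b N / (s N)\<^sup>2 * x\<^sup>2) -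
          1 / 24 * (real N * ((2 * b N * x / s N)^4 / (1 + (2 * b N * x / s N)\<^sup>2)))) \<le> exp (\<theta> / 2 - \<theta> / 2 * x\<^sup>2)"
          using 1 2 \<theta> by (subst exp_le_cancel_iff) linarith
        finally show "q N x * tilt N x \<le> exp (\<theta> / 2 - \<theta> / 2 * x\<^sup>2)" .
      qed
    qed
    then show thesis using \<theta> by (intro that[of "\<theta> / 2"]) auto
  qed
qed

lemma integrable_gaussian_dominator:
  assumes "\<alpha> > 0"
  shows "integrable lborel (\<lambda>x::real. exp (\<alpha> - \<alpha> * x\<^sup>2))"
proof -
  define v where "v = sqrt (1 / (2 * \<alpha>))"
  define c where "c = 1 / sqrt (2 * pi * v\<^sup>2)"
  have v: "v > 0" "v\<^sup>2 = 1 / (2 * \<alpha>)" using assms by (auto simp: v_def)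
  have c: "c > 0" using v(1) by (simp add: c_def)
  have "normal_density 0 v x = c * exp (- (\<alpha> * x\<^sup>2))" for x
    unfolding normal_density_def c_def[symmetric] using assms by (simp add: v(2))
  then have eq: "exp (\<alpha> - \<alpha> * x\<^sup>2) = exp \<alpha> / c * normal_density 0 v x" for x
    using c by (simp add: exp_diff exp_minus divide_inverse)
  show ?thesis unfolding eq using v by (intro integrable_mult_right integrable_normal_density)
qed

lemma tilt_ge_1: "N \<ge> 1 \<Longrightarrow> 1 \<le> tilt N x"
  using p_range[of N] by simp

lemma q_le_q_tilt: "N \<ge> 1 \<Longrightarrow> q N x \<le> q N x * tilt N x"
  using mult_left_mono[OF tilt_ge_1 less_imp_le[OF field_density_pos]] by simp

lemma
  shows integral_q_limit: "B \<in> sets borel \<Longrightarrow>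
      (\<lambda>N. LINT x|lborel. indicator B x * q N x) \<longlonglongrightarrow> (LINT x|lborel. indicator B x * psi x)"
    and integral_tilted_limit: "(\<lambda>N. LINT x|lborel. q N x * tilt N x) \<longlonglongrightarrow> (LINT x|lborel. psi x)"
    and integrable_q_tilt: "\<forall>\<^sub>F N in sequentially. integrable lborel (\<lambda>x. q N x * tilt N x)"
    and integrable_psi: "integrable lborel psi"
proof -
  obtain \<alpha> where \<alpha>: "\<alpha> > 0" and dom: "\<forall>\<^sub>F N in sequentially. \<forall>x. q N x * tilt N x \<le> exp (\<alpha> - \<alpha> * x\<^sup>2)"
    by (rule density_dominated)
  note g = integrable_gaussian_dominator[OF \<alpha>]
  have dom': "\<forall>\<^sub>F N in sequentially. \<forall>x. \<bar>q N x * tilt N x\<bar> \<le> exp (\<alpha> - \<alpha> * x\<^sup>2)"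
    using dom by eventually_elim (simp add: abs_mult field_density_pos less_imp_le)
  have domq: "\<forall>\<^sub>F N in sequentially. \<forall>x. q N x \<le> exp (\<alpha> - \<alpha> * x\<^sup>2)"
    using dom eventually_ge_1 by eventually_elim (blast intro: order_trans q_le_q_tilt)
  have lim: "(\<lambda>N. q N x * tilt N x) \<longlonglongrightarrow> psi x" for x
    using tendsto_mult[OF density_limit tilt_limit, of x] by (simp add: limit_density_pos less_imp_le)
  show "(\<lambda>N. LINT x|lborel. q N x * tilt N x) \<longlonglongrightarrow> (LINT x|lborel. psi x)"
    by (rule dominated_convergence_eventually[OF _ _ g lim dom']) measurable
  show "\<forall>\<^sub>F N in sequentially. integrable lborel (\<lambda>x. q N x * tilt N x)"
    using dom'
  proof eventually_elim
    case (elim N)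
    then show ?case by (intro Bochner_Integration.integrable_bound[OF g]) auto
  qed
  have "psi x \<le> exp (\<alpha> - \<alpha> * x\<^sup>2)" for x
    by (rule tendsto_upperbound[OF density_limit])
      (use domq in \<open>auto elim: eventually_mono\<close>)
  then show "integrable lborel psi"
    by (intro Bochner_Integration.integrable_bound[OF g]) (auto simp: limit_density_pos less_imp_le)
  assume B: "B \<in> sets borel"
  show "(\<lambda>N. LINT x|lborel. indicator B x * q N x) \<longlonglongrightarrow> (LINT x|lborel. indicator B x * psi x)"
  proof (rule dominated_convergence_eventually[OF _ _ g])
    show "(\<lambda>N. indicator B x * q N x) \<longlonglongrightarrow> indicator B x * psi x" for x
      by (intro tendsto_intros density_limit)
    show "\<forall>\<^sub>F N in sequentially. \<forall>x. \<bar>indicator B x * q N x\<bar> \<le> exp (\<alpha> - \<alpha> * x\<^sup>2)"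
      using domq by eventually_elim (auto simp: abs_mult field_density_pos less_imp_le indicator_def)
  qed (use B in measurable)
qed

lemma prob_space_limit_law: "prob_space \<mu>"
  unfolding limit_law_def by (rule prob_space_normalized_density[OF integrable_psi]) (simp add: limit_density_pos less_imp_le)

lemma integral_psi_pos: "(LINT x|lborel. psi x) > 0"
proof -
  have "(LINT x|lborel. psi x) \<noteq> 0"
  proof
    assume "(LINT x|lborel. psi x) = 0"
    then have "\<mu> = density lborel (\<lambda>x. 0)" by (simp add: limit_law_def)
    then have "emeasure \<mu> (space \<mu>) = 0" by (simp add: emeasure_density)
    with prob_space.emeasure_space_1[OF prob_space_limit_law] show False by simp
  qed
  moreover have "(LINT x|lborel. psi x) \<ge> 0"
    by (intro integral_nonneg_AE) (simp add: limit_density_pos less_imp_le)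
  ultimately show ?thesis by simp
qed

lemma measure_limit_law:
  assumes B: "B \<in> sets borel"
  shows "measure \<mu> B = (LINT x|lborel. indicator B x * psi x) / (LINT x|lborel. psi x)"
proof -
  let ?I = "LINT x|lborel. psi x"
  have int: "integrable lborel (\<lambda>x. indicator B x * psi x / ?I)"
    using integrable_mult_indicator[OF _ integrable_psi, of B] B by (intro integrable_divide_zero) simp
  have "emeasure \<mu> B = (\<integral>\<^sup>+x. ennreal (indicator B x * psi x / ?I) \<partial>lborel)"
    unfolding limit_law_def using B integral_psi_pos
    by (subst emeasure_density) (auto intro!: nn_integral_cong split: split_indicator)
  also have "\<dots> = ennreal (LINT x|lborel. indicator B x * psi x / ?I)"
    using int integral_psi_pos by (intro nn_integral_eq_integral) (auto simp: limit_density_pos less_imp_le)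
  finally have "measure \<mu> B = (LINT x|lborel. indicator B x * psi x / ?I)"
    using integral_psi_pos by (simp add: measure_def integral_nonneg_AE limit_density_pos less_imp_le)
  then show ?thesis by simp
qed

lemma smoothed_mass_limit:
  assumes "B \<in> sets borel"
  shows "(\<lambda>N. (LINT x|lborel. indicator B x * q N x) / (LINT x|lborel. q N x)) \<longlonglongrightarrow> measure \<mu> B"
proof -
  have "(\<lambda>N. LINT x|lborel. q N x) \<longlonglongrightarrow> (LINT x|lborel. psi x)"
    using integral_q_limit[of UNIV] by simp
  then show ?thesis
    unfolding measure_limit_law[OF assms]
    using integral_psi_pos by (intro tendsto_divide integral_q_limit assms) auto
qed

lemma tilted_ratio_limit:
  "(\<lambda>N. (LINT x|lborel. q N x * tilt N x) / (LINT x|lborel. q N x)) \<longlonglongrightarrow> 1"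
proof -
  have "(\<lambda>N. LINT x|lborel. q N x) \<longlonglongrightarrow> (LINT x|lborel. psi x)"
    using integral_q_limit[of UNIV] by simp
  from tendsto_divide[OF integral_tilted_limit this] integral_psi_pos
  show ?thesis by simp
qed

text \<open>Distribution function of the scaled magnetization when every weight is replaced by its expectation.\<close>

definition annealed :: "nat \<Rightarrow> real \<Rightarrow> real" where
  "annealed N t = (\<Sum>\<sigma>\<in>{\<sigma>\<in>spins N. s N * mag N \<sigma> \<le> t}. exp (b N * (mag N \<sigma>)\<^sup>2)) /
     (\<Sum>\<sigma>\<in>spins N. exp (b N * (mag N \<sigma>)\<^sup>2))"

text \<open>Both half-lines are needed: enlarging a half-line by \<open>\<eta>\<close> only bounds its mass from above.\<close>

lemma annealed_sandwich:
  assumes N: "N \<ge> 1" and \<eta>: "\<eta> > 0"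
  defines "\<beta> \<equiv> 1 - (s N)\<^sup>2 / b N / (2 * \<eta>\<^sup>2)"
  shows "\<beta> * annealed N t \<le> (LINT x|lborel. indicator {..t + \<eta>} x * q N x) / (LINT x|lborel. q N x)"
    and "\<beta> * (1 - annealed N t) \<le> (LINT x|lborel. indicator {t - \<eta>..} x * q N x) / (LINT x|lborel. q N x)"
proof -
  define P where "P = {\<sigma>\<in>spins N. s N * mag N \<sigma> \<le> t}"
  define Z where "Z = (\<Sum>\<sigma>\<in>spins N. exp (b N * (mag N \<sigma>)\<^sup>2))"
  define c where "c = 2 ^ N / sqrt (pi * (s N)\<^sup>2 / b N)"
  have PS: "P \<subseteq> spins N" by (auto simp: P_def)
  have b: "b N > 0" and s: "s N > 0" using b_pos s_pos N by auto
  have c: "c > 0" using b s by (simp add: c_def)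
  have \<beta>: "\<beta> = 1 - (s N)\<^sup>2 / (2 * b N * \<eta>\<^sup>2)" by (simp add: \<beta>_def mult_ac)
  have Z: "Z = c * (LINT x|lborel. q N x)" unfolding Z_def c_def by (rule curie_weiss_partition[OF b s])
  have Zpos: "Z > 0" unfolding Z_def by (intro sum_pos finite_spins spins_nonempty) simp
  have key: "\<beta> * ((\<Sum>\<sigma>\<in>R. exp (b N * (mag N \<sigma>)\<^sup>2)) / Z) \<le>
      (LINT x|lborel. indicator B x * q N x) / (LINT x|lborel. q N x)"
    if R: "R \<subseteq> spins N" and B: "B \<in> sets borel"
      and near: "\<And>\<sigma> x. \<sigma> \<in> R \<Longrightarrow> \<bar>x - s N * mag N \<sigma>\<bar> < \<eta> \<Longrightarrow> x \<in> B" for R B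
  proof -
    have "\<beta> * (\<Sum>\<sigma>\<in>R. exp (b N * (mag N \<sigma>)\<^sup>2)) \<le> c * (LINT x|lborel. indicator B x * q N x)"
      unfolding \<beta> c_def by (rule curie_weiss_mass_le[OF b s \<eta> B R near])
    then have "\<beta> * (\<Sum>\<sigma>\<in>R. exp (b N * (mag N \<sigma>)\<^sup>2)) / Z \<le> c * (LINT x|lborel. indicator B x * q N x) / Z"
      using Zpos by (intro divide_right_mono) auto
    then show ?thesis using c by (simp add: Z)
  qed
  show "\<beta> * annealed N t \<le> (LINT x|lborel. indicator {..t + \<eta>} x * q N x) / (LINT x|lborel. q N x)"
    unfolding annealed_def P_def[symmetric] Z_def[symmetric] by (rule key[OF PS]) (auto simp: P_def)
  have "(\<Sum>\<sigma>\<in>spins N - P. exp (b N * (mag N \<sigma>)\<^sup>2)) = Z - (\<Sum>\<sigma>\<in>P. exp (b N * (mag N \<sigma>)\<^sup>2))"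
    unfolding Z_def using PS finite_spins by (rule sum_diff[rotated])
  then have "1 - annealed N t = (\<Sum>\<sigma>\<in>spins N - P. exp (b N * (mag N \<sigma>)\<^sup>2)) / Z"
    unfolding annealed_def P_def[symmetric] Z_def[symmetric] using Zpos by (simp add: diff_divide_distrib)
  then show "\<beta> * (1 - annealed N t) \<le> (LINT x|lborel. indicator {t - \<eta>..} x * q N x) / (LINT x|lborel. q N x)"
    by (simp only:) (rule key, auto simp: P_def)
qed

lemma annealed_bounds: "0 \<le> annealed N t" "annealed N t \<le> 1"
proof -
  have "(\<Sum>\<sigma>\<in>{\<sigma>\<in>spins N. s N * mag N \<sigma> \<le> t}. exp (b N * (mag N \<sigma>)\<^sup>2)) \<le> (\<Sum>\<sigma>\<in>spins N. exp (b N * (mag N \<sigma>)\<^sup>2))"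
    by (intro sum_mono2 finite_spins) auto
  moreover have "(\<Sum>\<sigma>\<in>spins N. exp (b N * (mag N \<sigma>)\<^sup>2)) > 0"
    by (intro sum_pos finite_spins spins_nonempty) simp
  ultimately show "annealed N t \<le> 1" by (simp add: annealed_def)
  show "0 \<le> annealed N t" unfolding annealed_def by (intro divide_nonneg_nonneg sum_nonneg) auto
qed

lemma annealed_limit:
  assumes \<eta>: "\<eta> > 0"
  shows "\<forall>\<^sub>F N in sequentially. annealed N t \<le> measure \<mu> {..t + \<eta>} + \<eta> \<and>
     measure \<mu> {..t - \<eta>} - \<eta> \<le> annealed N t"
proof -
  interpret L: prob_space \<mu> by (rule prob_space_limit_law)
  let ?\<beta> = "\<lambda>N. 1 - (s N)\<^sup>2 / b N / (2 * \<eta>\<^sup>2)"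
  let ?m = "\<lambda>B N. (LINT x|lborel. indicator B x * q N x) / (LINT x|lborel. q N x)"
  have sp: "space \<mu> = UNIV" by (simp add: limit_law_def)
  have "?\<beta> \<longlonglongrightarrow> 1 - 0 / (2 * \<eta>\<^sup>2)" using \<eta> by (intro tendsto_intros noise) auto
  then have "\<forall>\<^sub>F N in sequentially. 1 - \<eta> / 2 < ?\<beta> N" using \<eta> by (intro order_tendstoD(1)) auto
  moreover have "\<forall>\<^sub>F N in sequentially. ?m {..t + \<eta>} N < measure \<mu> {..t + \<eta>} + \<eta> / 2"
    using \<eta> by (intro order_tendstoD(2)[OF smoothed_mass_limit]) auto
  moreover have "\<forall>\<^sub>F N in sequentially. ?m {t - \<eta>..} N < measure \<mu> {t - \<eta>..} + \<eta> / 2"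
    using \<eta> by (intro order_tendstoD(2)[OF smoothed_mass_limit]) auto
  ultimately show ?thesis using eventually_ge_1
  proof eventually_elim
    case (elim N)
    have low: "x - \<eta> / 2 \<le> ?\<beta> N * x" if "0 \<le> x" "x \<le> 1" for x
    proof -
      have "(1 - \<eta> / 2) * x \<le> ?\<beta> N * x" using elim that by (intro mult_right_mono) auto
      moreover have "\<eta> / 2 * x \<le> \<eta> / 2 * 1" using that \<eta> by (intro mult_left_mono) auto
      ultimately show ?thesis by (simp add: algebra_simps)
    qed
    have 1: "annealed N t - \<eta> / 2 \<le> ?m {..t + \<eta>} N"
      using low[OF annealed_bounds] annealed_sandwich(1)[OF elim(4) \<eta>] by (rule order_trans)
    have 2: "(1 - annealed N t) - \<eta> / 2 \<le> ?m {t - \<eta>..} N"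
      using annealed_bounds[of N t] by (intro order_trans[OF low annealed_sandwich(2)[OF elim(4) \<eta>]]) auto
    have "AE x in lborel. x \<noteq> t - \<eta>" by (rule AE_lborel_singleton)
    then have "(LINT x|lborel. indicator {..t - \<eta>} x * psi x) = (LINT x|lborel. indicator {..<t - \<eta>} x * psi x)"
      by (intro integral_cong_AE) (auto split: split_indicator)
    then have "measure \<mu> {..t - \<eta>} = measure \<mu> {..<t - \<eta>}"
      by (simp add: measure_limit_law)
    moreover have "measure \<mu> {..<t - \<eta>} = 1 - measure \<mu> {t - \<eta>..}"
    proof -
      have "measure \<mu> (space \<mu> - {t - \<eta>..}) = 1 - measure \<mu> {t - \<eta>..}"
        by (rule L.prob_compl) simp
      moreover have "space \<mu> - {t - \<eta>..} = {..<t - \<eta>}" by (auto simp: sp)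
      ultimately show ?thesis by simp
    qed
    ultimately show ?case using 1 2 elim by linarith
  qed
qed

end

section \<open>Convergence of the random magnetization law\<close>

text \<open>The given variables equal 0 or 1 only almost surely. They are replaced by the indicators of the event
that they equal one, which changes them on a null set.\<close>

lemma bernoulli_edges_indicator:
  fixes M :: "'a measure" and eps :: "nat \<Rightarrow> nat \<Rightarrow> 'a \<Rightarrow> real"
  assumes "N \<ge> 1" "0 < p" "p \<le> 1" and "prob_space M"
    and indep: "prob_space.indep_vars M (\<lambda>_. borel) (\<lambda>(i, j). eps i j) (edges N)"
    and one: "\<And>i j. i \<in> {1..N} \<Longrightarrow> j \<in> {1..N} \<Longrightarrow> measure M {\<omega> \<in> space M. eps i j \<omega> = 1} = p"
  shows "bernoulli_edges M N p (\<lambda>ij \<omega>. indicator {1} (eps (fst ij) (snd ij) \<omega>))"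
proof -
  interpret prob_space M by fact
  have rv [measurable]: "eps i j \<in> borel_measurable M" if "i \<in> {1..N}" "j \<in> {1..N}" for i j
    using indep that unfolding indep_vars_def by auto
  show ?thesis
  proof
    have "indep_vars (\<lambda>_. borel) (\<lambda>ij \<omega>. indicator {1::real} ((\<lambda>(i, j). eps i j) ij \<omega>) :: real) (edges N)"
      by (rule indep_vars_compose2[OF indep, where Y = "\<lambda>_. indicator {1::real}"]) auto
    then show "indep_vars (\<lambda>_. borel) (\<lambda>ij \<omega>. indicator {1} (eps (fst ij) (snd ij) \<omega>) :: real) (edges N)"
      by (simp add: case_prod_beta)
    fix ij assume ij: "ij \<in> edges N"
    have "expectation (\<lambda>\<omega>. indicator {1} (eps (fst ij) (snd ij) \<omega>)) =
        expectation (indicator {\<omega> \<in> space M. eps (fst ij) (snd ij) \<omega> = 1})"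
      by (intro Bochner_Integration.integral_cong) (auto simp: indicator_def)
    also have "\<dots> = p"
      using ij one[of "fst ij" "snd ij"]
      by (subst Bochner_Integration.integral_indicator) (auto intro!: arg_cong[where f = prob])
    finally show "expectation (\<lambda>\<omega>. indicator {1} (eps (fst ij) (snd ij) \<omega>)) = p" .
  qed (use assms in \<open>auto simp: indicator_def\<close>)
qed

lemma edges_01_almost_surely:
  fixes M :: "'a measure" and eps :: "nat \<Rightarrow> nat \<Rightarrow> 'a \<Rightarrow> real"
  assumes "prob_space M"
    and rv: "\<And>i j. i \<in> {1..N} \<Longrightarrow> j \<in> {1..N} \<Longrightarrow> eps i j \<in> borel_measurable M"
    and one: "\<And>i j. i \<in> {1..N} \<Longrightarrow> j \<in> {1..N} \<Longrightarrow> measure M {\<omega> \<in> space M. eps i j \<omega> = 1} = p"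
    and zero: "\<And>i j. i \<in> {1..N} \<Longrightarrow> j \<in> {1..N} \<Longrightarrow> measure M {\<omega> \<in> space M. eps i j \<omega> = 0} = 1 - p"
  obtains B where "B \<in> sets M" "measure M B = 0"
    and "\<forall>\<omega>\<in>space M - B. \<forall>i\<in>{1..N}. \<forall>j\<in>{1..N}. eps i j \<omega> \<in> {0, 1}"
proof -
  interpret prob_space M by fact
  have "AE \<omega> in M. eps i j \<omega> \<in> {0, 1}" if ij: "i \<in> {1..N}" "j \<in> {1..N}" for i j
  proof -
    note [measurable] = rv[OF ij]
    have "prob ({\<omega> \<in> space M. eps i j \<omega> = 1} \<union> {\<omega> \<in> space M. eps i j \<omega> = 0}) = p + (1 - p)"
      unfolding one[OF ij, symmetric] zero[OF ij, symmetric]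
      by (subst finite_measure_Union) (auto simp: one[OF ij] zero[OF ij])
    then have "AE \<omega> in M. \<omega> \<in> {\<omega> \<in> space M. eps i j \<omega> = 1} \<union> {\<omega> \<in> space M. eps i j \<omega> = 0}"
      by (subst prob_eq_1[symmetric]) auto
    then show ?thesis by eventually_elim auto
  qed
  then have "AE \<omega> in M. \<forall>ij\<in>edges N. eps (fst ij) (snd ij) \<omega> \<in> {0, 1}"
    by (subst AE_finite_all) auto
  then obtain B where B: "{\<omega> \<in> space M. \<not> (\<forall>ij\<in>edges N. eps (fst ij) (snd ij) \<omega> \<in> {0, 1})} \<subseteq> B"
      "B \<in> sets M" "emeasure M B = 0"
    by (auto elim!: AE_E)
  show thesis
  proof (rule that[OF B(2)])
    show "measure M B = 0" using B(3) by (simp add: measure_def)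
    show "\<forall>\<omega>\<in>space M - B. \<forall>i\<in>{1..N}. \<forall>j\<in>{1..N}. eps i j \<omega> \<in> {0, 1}" using B(1) by force
  qed
qed

context critical_scaling
begin

text \<open>The bound of \<open>variance_bound_le\<close> along the sequence.\<close>

definition fluctuation :: "nat \<Rightarrow> real" where
  "fluctuation N = exp (1 / (8 * real N ^ 2 * p N)) / sqrt (1 - 1 / (real N * p N)) *
     ((LINT x|lborel. q N x * tilt N x) / (LINT x|lborel. q N x))\<^sup>2 - 1 + 4 / (real N * p N)"

lemma fluctuation_limit: "fluctuation \<longlonglongrightarrow> 0"
proof -
  have inv: "(\<lambda>N. 1 / (real N * p N)) \<longlonglongrightarrow> 0"
    using tendsto_inverse_0_at_top[OF Np] by (simp add: divide_inverse)
  have 1: "(\<lambda>N. 1 / 8 * (1 / (real N * p N)) * inverse (real N)) \<longlonglongrightarrow> 1 / 8 * 0 * 0"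
    by (intro tendsto_intros inv lim_inverse_n)
  have "(\<lambda>N. exp (1 / 8 * (1 / (real N * p N)) * inverse (real N)) / sqrt (1 - 1 / (real N * p N)) *
     ((LINT x|lborel. q N x * tilt N x) / (LINT x|lborel. q N x))\<^sup>2 - 1 + 4 * (1 / (real N * p N)))
    \<longlonglongrightarrow> exp (1 / 8 * 0 * 0) / sqrt (1 - 0) * 1\<^sup>2 - 1 + 4 * 0"
    by (intro tendsto_intros 1 inv tilted_ratio_limit) simp
  moreover have "1 / 8 * (1 / (real N * p N)) * inverse (real N) = 1 / (8 * real N ^ 2 * p N)"
    "4 * (1 / (real N * p N)) = 4 / (real N * p N)" for N
    by (simp_all add: inverse_eq_divide power2_eq_square mult_ac)
  ultimately show ?thesis
    by (simp add: fluctuation_def[abs_def])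
qed

text \<open>The random distribution function is close to the averaged one at the finitely many points of the grid,
by concentration, and the averaged one is close to that of the limit; by the choice of the grid this
controls the Levy distance outside an event whose probability is a constant times \<open>fluctuation\<close>.\<close>

lemma magnetization_law_converges:
  fixes M :: "nat \<Rightarrow> 'a measure" and eps :: "nat \<Rightarrow> nat \<Rightarrow> nat \<Rightarrow> 'a \<Rightarrow> real"
  assumes b_eq: "\<And>N. N \<ge> 1 \<Longrightarrow> b N = coupling N (p N)"
    and prob: "\<And>N. N \<ge> 1 \<Longrightarrow> prob_space (M N)"
    and indep: "\<And>N. N \<ge> 1 \<Longrightarrow>
      prob_space.indep_vars (M N) (\<lambda>_. borel) (\<lambda>(i, j). eps N i j) (edges N)"
    and one: "\<And>N i j. i \<in> {1..N} \<Longrightarrow> j \<in> {1..N} \<Longrightarrow>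
      measure (M N) {\<omega> \<in> space (M N). eps N i j \<omega> = 1} = p N"
    and zero: "\<And>N i j. i \<in> {1..N} \<Longrightarrow> j \<in> {1..N} \<Longrightarrow>
      measure (M N) {\<omega> \<in> space (M N). eps N i j \<omega> = 0} = 1 - p N"
  shows "levy_tendsto_in_prob M (\<lambda>N \<omega>. magnetization_law (s N) 1 N (p N) (\<lambda>i j. eps N i j \<omega>)) \<mu>"
  unfolding levy_tendsto_in_prob_def
proof (intro allI impI)
  fix \<epsilon> :: real assume \<epsilon>: "\<epsilon> > 0"
  let ?L = "\<lambda>N \<omega>. magnetization_law (s N) 1 N (p N) (\<lambda>i j. eps N i j \<omega>)"
  obtain T :: "real set" where T: "finite T"
    and grid: "\<forall>\<nu>. prob_space \<nu> \<longrightarrow> sets \<nu> = sets borel \<longrightarrow>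
      (\<forall>t\<in>T. measure \<nu> {..t} \<le> measure \<mu> {..t + \<epsilon> / 2} + \<epsilon> / 2 \<and>
        measure \<mu> {..t - \<epsilon> / 2} - \<epsilon> / 2 \<le> measure \<nu> {..t}) \<longrightarrow>
      levy_dist \<nu> \<mu> \<le> \<epsilon>"
    by (rule levy_dist_le_of_grid[OF prob_space_limit_law sets_limit_law \<epsilon>])
  interpret L: prob_space \<mu> by (rule prob_space_limit_law)
  define \<eta> where "\<eta> = min (\<epsilon> / 16) (1 / 2)"
  have \<eta>: "0 < \<eta>" "\<eta> \<le> 1 / 2" "4 * \<eta> \<le> \<epsilon> / 4" using \<epsilon> by (auto simp: \<eta>_def)
  have ann: "\<forall>\<^sub>F N in sequentially. \<forall>t\<in>T. annealed N t \<le> measure \<mu> {..t + \<epsilon> / 4} + \<epsilon> / 4 \<and>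
      measure \<mu> {..t - \<epsilon> / 4} - \<epsilon> / 4 \<le> annealed N t"
    using T \<epsilon> by (intro eventually_ball_finite ballI annealed_limit) auto
  have large: "\<forall>\<^sub>F N in sequentially. real N * p N \<ge> 3"
    using Np by (simp add: filterlim_at_top)
  have bound: "\<forall>\<^sub>F N in sequentially. measure (M N) {\<omega> \<in> space (M N). levy_dist (?L N \<omega>) \<mu> > \<epsilon>}
      \<le> (real (card T) + 1) * (fluctuation N / \<eta>\<^sup>2)"
    using ann large eventually_ge_1 integrable_q_tilt
  proof eventually_elim
    case (elim N)
    note N = elim(3)
    note pN = p_range[OF N]
    define X where "X ij \<omega> = (indicator {1} (eps N (fst ij) (snd ij) \<omega>) :: real)" for ij \<omega>
    interpret E: bernoulli_edges "M N" N "p N" X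
      unfolding X_def[abs_def] by (rule bernoulli_edges_indicator) (use pN N prob indep one in auto)
    define S where "S t = {\<sigma>\<in>spins N. s N * mag N \<sigma> \<le> t}" for t
    obtain B where B: "B \<in> sets (M N)"
        "measure (M N) B \<le> (real (card (S ` T)) + 1) * (E.variance_bound / \<eta>\<^sup>2)"
      and ratio: "\<forall>\<omega>\<in>space (M N) - B. \<forall>R\<in>S ` T.
      \<bar>(\<Sum>\<sigma>\<in>R. E.W \<sigma> \<omega>) / (\<Sum>\<sigma>\<in>spins N. E.W \<sigma> \<omega>) - (\<Sum>\<sigma>\<in>R. E.w \<sigma>) / (\<Sum>\<sigma>\<in>spins N. E.w \<sigma>)\<bar> \<le> 4 * \<eta>"
      by (rule E.gibbs_ratio_concentration[of "S ` T" \<eta>]) (use T elim(2) \<eta> in \<open>auto simp: S_def\<close>)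
    have rv: "eps N i j \<in> borel_measurable (M N)" if "i \<in> {1..N}" "j \<in> {1..N}" for i j
      using indep[OF N] that unfolding E.indep_vars_def by auto
    obtain B0 where B0: "B0 \<in> sets (M N)" "measure (M N) B0 = 0"
      and eps01: "\<forall>\<omega>\<in>space (M N) - B0. \<forall>i\<in>{1..N}. \<forall>j\<in>{1..N}. eps N i j \<omega> \<in> {0, 1}"
      by (rule edges_01_almost_surely[OF prob[OF N] rv one zero])
    have "E.variance_bound \<le> fluctuation N"
      unfolding fluctuation_def b_eq[OF N]
      by (rule E.variance_bound_le) (use elim(2,4) s_pos[OF N] b_eq[OF N] in auto)
    have "{\<omega> \<in> space (M N). levy_dist (?L N \<omega>) \<mu> > \<epsilon>} \<subseteq> B \<union> B0"
    proof (rule subsetI, rule ccontr)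
      fix \<omega> assume \<omega>: "\<omega> \<in> {\<omega> \<in> space (M N). levy_dist (?L N \<omega>) \<mu> > \<epsilon>}" "\<omega> \<notin> B \<union> B0"
      have close: "\<bar>measure (?L N \<omega>) {..t} - annealed N t\<bar> \<le> \<epsilon> / 4" if t: "t \<in> T" for t
      proof -
        have e: "eps N i j \<omega> \<in> {0, 1}" if "i \<in> {1..N}" "j \<in> {1..N}" for i j
          using eps01 \<omega> that by auto
        have W: "reduced_weight N (p N) (\<lambda>ij. eps N (fst ij) (snd ij) \<omega>) \<sigma> = E.W \<sigma> \<omega>" for \<sigma>
          unfolding E.W_def reduced_weight_def
        proof (rule prod.cong[OF refl])
          fix ij assume "ij \<in> edges N"
          then show "1 + edge_tanh N (p N) * edge_spin \<sigma> ij * eps N (fst ij) (snd ij) \<omega> =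
            1 + edge_tanh N (p N) * edge_spin \<sigma> ij * X ij \<omega>"
            using e[of "fst ij" "snd ij"] by (auto simp: X_def)
        qed
        have L: "measure (?L N \<omega>) {..t} = (\<Sum>\<sigma>\<in>S t. E.W \<sigma> \<omega>) / (\<Sum>\<sigma>\<in>spins N. E.W \<sigma> \<omega>)"
          unfolding S_def W[symmetric] by (rule measure_magnetization_law[OF N e])
        have "sqrt (1 - (p N * edge_tanh N (p N))\<^sup>2) ^ (N * N) \<noteq> 0"
          using E.w_pos[of "\<lambda>_. 1"] unfolding E.w_def by (metis less_irrefl mult_zero_left)
        then have "annealed N t = (\<Sum>\<sigma>\<in>S t. E.w \<sigma>) / (\<Sum>\<sigma>\<in>spins N. E.w \<sigma>)"
          unfolding annealed_def S_def E.w_def b_eq[OF N] sum_distrib_left[symmetric]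
            by (rule mult_divide_mult_cancel_left[symmetric])
        then show ?thesis
          using bspec[OF bspec[OF ratio, of \<omega>], of "S t"] \<omega> t \<eta>(3) unfolding L by auto
      qed
      have "levy_dist (?L N \<omega>) \<mu> \<le> \<epsilon>"
      proof (rule grid[rule_format, OF prob_space_magnetization_law sets_magnetization_law], intro conjI)
        fix t assume t: "t \<in> T"
        have "measure \<mu> {..t + \<epsilon> / 4} \<le> measure \<mu> {..t + \<epsilon> / 2}"
          using \<epsilon> by (intro L.finite_measure_mono) auto
        then show "measure (?L N \<omega>) {..t} \<le> measure \<mu> {..t + \<epsilon> / 2} + \<epsilon> / 2"
          using close[OF t] bspec[OF elim(1) t] by linarith
        have "measure \<mu> {..t - \<epsilon> / 2} \<le> measure \<mu> {..t - \<epsilon> / 4}"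
          using \<epsilon> by (intro L.finite_measure_mono) auto
        then show "measure \<mu> {..t - \<epsilon> / 2} - \<epsilon> / 2 \<le> measure (?L N \<omega>) {..t}"
          using close[OF t] bspec[OF elim(1) t] by linarith
      qed
      with \<omega> show False by simp
    qed
    then have "measure (M N) {\<omega> \<in> space (M N). levy_dist (?L N \<omega>) \<mu> > \<epsilon>} \<le> measure (M N) (B \<union> B0)"
      using B B0 by (intro E.finite_measure_mono) auto
    also have "\<dots> \<le> measure (M N) B + measure (M N) B0"
      using B B0 by (intro measure_Un_le) auto
    also have "\<dots> \<le> (real (card (S ` T)) + 1) * (E.variance_bound / \<eta>\<^sup>2)" using B B0 by simp
    also have "\<dots> \<le> (real (card T) + 1) * (fluctuation N / \<eta>\<^sup>2)"
    proof (rule mult_mono)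
      show "real (card (S ` T)) + 1 \<le> real (card T) + 1" using card_image_le[OF T] by simp
      show "E.variance_bound / \<eta>\<^sup>2 \<le> fluctuation N / \<eta>\<^sup>2"
        using \<open>E.variance_bound \<le> fluctuation N\<close> by (rule divide_right_mono) simp
      show "0 \<le> E.variance_bound / \<eta>\<^sup>2"
        by (rule order_trans[OF measure_nonneg E.prob_sum_W_deviation[OF order_refl elim(2) \<eta>(1)]])
    qed simp
    finally show ?case .
  qed
  show "(\<lambda>N. measure (M N) {\<omega> \<in> space (M N). levy_dist (?L N \<omega>) \<mu> > \<epsilon>}) \<longlonglongrightarrow> 0"
  proof (rule tendsto_sandwich[OF _ bound tendsto_const])
    have "(\<lambda>N. (real (card T) + 1) * (fluctuation N / \<eta>\<^sup>2)) \<longlonglongrightarrow> (real (card T) + 1) * (0 / \<eta>\<^sup>2)"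
      using \<eta> by (intro tendsto_intros fluctuation_limit) auto
    then show "(\<lambda>N. (real (card T) + 1) * (fluctuation N / \<eta>\<^sup>2)) \<longlonglongrightarrow> 0" by simp
  qed simp
qed

end

section \<open>The effective coupling and its distance from criticality\<close>

text \<open>Concavity of \<open>tanh\<close> on the positive half-line; it shows that the averaged model is never above the critical
coupling.\<close>

lemma tanh_scale_ge:
  assumes "0 \<le> c" "c \<le> 1" "0 \<le> (x::real)"
  shows "c * tanh x \<le> tanh (c * x)"
proof -
  have "(\<lambda>x. tanh (c * x) - c * tanh x) 0 \<le> (\<lambda>x. tanh (c * x) - c * tanh x) x"
  proof (rule DERIV_nonneg_imp_nondecreasing[OF assms(3)])
    fix y :: real assume y: "0 \<le> y"
    have "((\<lambda>x. tanh (c * x) - c * tanh x) has_real_derivative c * ((tanh y)\<^sup>2 - (tanh (c * y))\<^sup>2)) (at y)"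
      by (auto intro!: derivative_eq_intros simp: algebra_simps)
    moreover have "(tanh (c * y))\<^sup>2 \<le> (tanh y)\<^sup>2"
      using assms y mult_right_mono[of c 1 y] by (intro power_mono) auto
    ultimately show "\<exists>d. ((\<lambda>x. tanh (c * x) - c * tanh x) has_real_derivative d) (at y) \<and> 0 \<le> d"
      using assms by (intro exI[of _ "c * ((tanh y)\<^sup>2 - (tanh (c * y))\<^sup>2)"]) auto
  qed
  then show ?thesis by simp
qed

text \<open>The relative distance of the averaged model below the critical coupling \<open>1 / (2 N)\<close>.\<close>

definition deficit :: "nat \<Rightarrow> real \<Rightarrow> real" where
  "deficit N p = 1 - 2 * real N * coupling N p"

lemma coupling_bounds:
  assumes N: "N \<ge> 1" and p: "0 < p" "p \<le> 1"
  defines "\<gamma> \<equiv> 1 / (2 * real N * p)"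
  shows "2 * real N * coupling N p \<le> 1" "tanh \<gamma> / \<gamma> \<le> 2 * real N * coupling N p"
proof -
  define a where "a = p * tanh \<gamma>"
  have a: "0 < a" "a \<le> 1 / 2" using edge_tanh_bounds[OF N p(1)] p by (auto simp: a_def edge_tanh_def \<gamma>_def)
  have ca: "coupling N p = artanh a" by (simp add: coupling_def edge_tanh_def a_def \<gamma>_def)
  have ta: "tanh (artanh a) = a" using a by (intro tanh_artanh) auto
  have \<gamma>: "\<gamma> > 0" using N p by (simp add: \<gamma>_def)
  have "tanh (artanh a) \<le> tanh (p * \<gamma>)"
    unfolding ta unfolding a_def using p \<gamma> by (intro tanh_scale_ge) auto
  then have "artanh a \<le> p * \<gamma>" by simp
  then have "2 * real N * artanh a \<le> 2 * real N * (p * \<gamma>)" by (intro mult_left_mono) auto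
  then show "2 * real N * coupling N p \<le> 1" using N p by (simp add: ca \<gamma>_def)
  have "0 \<le> artanh a" using a ta by (metis less_imp_le tanh_real_nonneg_iff)
  then have "a \<le> artanh a" using tanh_le_self[of "artanh a"] ta by simp
  then have "2 * real N * a \<le> 2 * real N * artanh a" by (intro mult_left_mono) auto
  moreover have "2 * real N * a = tanh \<gamma> / \<gamma>" by (simp add: a_def \<gamma>_def)
  ultimately show "tanh \<gamma> / \<gamma> \<le> 2 * real N * coupling N p" by (simp add: ca)
qed

context
  fixes p :: "nat \<Rightarrow> real"
  assumes p: "\<And>N. N \<ge> 1 \<Longrightarrow> 0 < p N \<and> p N \<le> 1"
    and Np: "filterlim (\<lambda>N. real N * p N) at_top sequentially"
begin

text \<open>The coupling constant of a present edge.\<close>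

definition \<gamma> :: "nat \<Rightarrow> real" where "\<gamma> N = 1 / (2 * real N * p N)"

lemma gamma_pos: "N \<ge> 1 \<Longrightarrow> \<gamma> N > 0"
  using p[of N] by (simp add: \<gamma>_def)

lemma gamma_at_0: "filterlim \<gamma> (at 0) sequentially"
proof (rule filterlim_atI)
  have "(\<lambda>N. 1/2 * inverse (real N * p N)) \<longlonglongrightarrow> 1/2 * 0"
    by (intro tendsto_intros tendsto_inverse_0_at_top[OF Np])
  moreover have "1/2 * inverse (real N * p N) = \<gamma> N" for N
    by (simp add: \<gamma>_def inverse_eq_divide mult.assoc)
  ultimately show "\<gamma> \<longlonglongrightarrow> 0" by simp
  show "\<forall>\<^sub>F N in sequentially. \<gamma> N \<noteq> 0"
    using eventually_ge_at_top[of 1] by eventually_elim (use gamma_pos in force)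
qed

lemma tanh_gamma: "(\<lambda>N. (1 - tanh (\<gamma> N) / \<gamma> N) / (\<gamma> N)\<^sup>2) \<longlonglongrightarrow> 1 / 3"
proof -
  have "- ((tanh (\<gamma> N) / \<gamma> N - 1) / (\<gamma> N)\<^sup>2) = (1 - tanh (\<gamma> N) / \<gamma> N) / (\<gamma> N)\<^sup>2" for N
    by (metis minus_diff_eq minus_divide_left)
  then show ?thesis
    using tendsto_minus[OF filterlim_compose[OF tanh_expansion gamma_at_0]] by simp
qed

lemma gamma_tendsto_0: "\<gamma> \<longlonglongrightarrow> 0"
  using gamma_at_0 by (simp add: filterlim_at)

lemma tanh_gamma_1: "(\<lambda>N. tanh (\<gamma> N) / \<gamma> N) \<longlonglongrightarrow> 1"
proof -
  have "(\<lambda>N. 1 - (1 - tanh (\<gamma> N) / \<gamma> N) / (\<gamma> N)\<^sup>2 * (\<gamma> N)\<^sup>2) \<longlonglongrightarrow> 1 - 1 / 3 * 0\<^sup>2"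
    by (intro tendsto_intros tanh_gamma gamma_tendsto_0)
  moreover have "\<forall>\<^sub>F N in sequentially. 1 - (1 - tanh (\<gamma> N) / \<gamma> N) / (\<gamma> N)\<^sup>2 * (\<gamma> N)\<^sup>2 = tanh (\<gamma> N) / \<gamma> N"
    using eventually_ge_at_top[of 1]
  proof eventually_elim
    case (elim N) then show ?case using gamma_pos[of N] by simp
  qed
  ultimately show ?thesis by (simp add: tendsto_cong)
qed

lemma deficit_bounds:
  assumes "N \<ge> 1"
  shows "0 \<le> deficit N (p N)" "deficit N (p N) \<le> 1 - tanh (\<gamma> N) / \<gamma> N"
  using coupling_bounds[OF assms] p[OF assms] by (auto simp: deficit_def \<gamma>_def)

lemma deficit_tendsto_0: "(\<lambda>N. deficit N (p N)) \<longlonglongrightarrow> 0"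
proof (rule tendsto_sandwich[where f = "\<lambda>_. 0"])
  show "(\<lambda>N. 1 - tanh (\<gamma> N) / \<gamma> N) \<longlonglongrightarrow> 0"
    using tendsto_diff[OF tendsto_const[of 1] tanh_gamma_1] by simp
qed (use deficit_bounds in \<open>auto simp: eventually_sequentially\<close>)

lemma coupling_tendsto: "(\<lambda>N. 2 * real N * coupling N (p N)) \<longlonglongrightarrow> 1"
  using tendsto_diff[OF tendsto_const[of 1] deficit_tendsto_0] by (simp add: deficit_def)

text \<open>Writing \<open>2 N * coupling = (artanh a / a) * (tanh \<gamma> / \<gamma>)\<close> with \<open>a = p * tanh \<gamma>\<close>, the second factor contributes
\<open>\<gamma>\<^sup>2 / 3\<close> to the deficit, while the first one contributes \<open>a\<^sup>2 / 3\<close>, which is of smaller order when \<open>p\<close> tends to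
zero.\<close>

lemma deficit_quadratic:
  assumes p0: "p \<longlonglongrightarrow> 0"
  shows "(\<lambda>N. deficit N (p N) / (\<gamma> N)\<^sup>2) \<longlonglongrightarrow> 1 / 3"
proof -
  define a where "a N = p N * tanh (\<gamma> N)" for N
  have a_pos: "a N > 0" if "N \<ge> 1" for N using p[OF that] gamma_pos[OF that] by (simp add: a_def)
  have "a \<longlonglongrightarrow> 0 * tanh 0"
    unfolding a_def by (intro tendsto_intros p0 gamma_tendsto_0) simp
  moreover have "\<forall>\<^sub>F N in sequentially. a N \<noteq> 0"
    using eventually_ge_at_top[of 1] by eventually_elim (use a_pos in force)
  ultimately have "filterlim a (at 0) sequentially" by (intro filterlim_atI) simp_all
  from filterlim_compose[OF artanh_expansion this]
  have A: "(\<lambda>N. (artanh (a N) / a N - 1) / (a N)\<^sup>2) \<longlonglongrightarrow> 1 / 3" .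
  have "(\<lambda>N. (1 - tanh (\<gamma> N) / \<gamma> N) / (\<gamma> N)\<^sup>2 -
      (artanh (a N) / a N - 1) / (a N)\<^sup>2 * (p N * (tanh (\<gamma> N) / \<gamma> N))\<^sup>2 * (tanh (\<gamma> N) / \<gamma> N))
      \<longlonglongrightarrow> 1 / 3 - 1 / 3 * (0 * 1)\<^sup>2 * 1"
    by (intro tendsto_intros tanh_gamma tanh_gamma_1 p0 A)
  moreover have "\<forall>\<^sub>F N in sequentially. (1 - tanh (\<gamma> N) / \<gamma> N) / (\<gamma> N)\<^sup>2 -
      (artanh (a N) / a N - 1) / (a N)\<^sup>2 * (p N * (tanh (\<gamma> N) / \<gamma> N))\<^sup>2 * (tanh (\<gamma> N) / \<gamma> N) =
      deficit N (p N) / (\<gamma> N)\<^sup>2"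
    using eventually_ge_at_top[of 1]
  proof eventually_elim
    case (elim N)
    define t where "t = tanh (\<gamma> N)"
    have g: "\<gamma> N > 0" and a: "a N > 0" and at: "a N = p N * t"
      using gamma_pos[OF elim] a_pos[OF elim] by (auto simp: a_def t_def)
    have c: "coupling N (p N) = artanh (a N)"
      by (simp add: coupling_def edge_tanh_def a_def \<gamma>_def)
    have pt: "p N * (t / \<gamma> N) = a N / \<gamma> N" by (simp add: at)
    have "(artanh (a N) / a N - 1) / (a N)\<^sup>2 * (p N * (t / \<gamma> N))\<^sup>2 * (t / \<gamma> N) =
       (artanh (a N) / a N - 1) * (t / \<gamma> N) / (\<gamma> N)\<^sup>2"
      unfolding pt power_divide using a by simp
    also have "(artanh (a N) / a N - 1) * (t / \<gamma> N) = artanh (a N) / (p N * \<gamma> N) - t / \<gamma> N"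
    proof -
      have "t / \<gamma> N = a N / (p N * \<gamma> N)" using p[OF elim] by (simp add: at)
      then show ?thesis using a by (simp add: left_diff_distrib diff_divide_distrib)
    qed
    also have "artanh (a N) / (p N * \<gamma> N) = 2 * real N * coupling N (p N)"
      using p[OF elim] elim by (simp add: c \<gamma>_def)
    finally show ?case by (simp add: t_def deficit_def diff_divide_distrib)
  qed
  ultimately show ?thesis by (simp add: tendsto_cong)
qed

section \<open>The three regimes\<close>

text \<open>At scale \<open>N\<^bsup>3/4\<^esup>\<close> the quartic coefficient is that of the critical Curie--Weiss model. The quadratic one is half
the limit of \<open>sqrt N\<close> times the deficit, that is, half the limit of \<open>sqrt N * \<gamma>\<^sup>2 / 3\<close>, and
\<open>sqrt N * \<gamma>\<^sup>2 = 1 / (4 * sqrt (p\<^sup>4 N\<^sup>3))\<close>. The case \<open>c = 0\<close> is the dense regime; there the upper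
bound \<open>1 - tanh \<gamma> / \<gamma>\<close> on the deficit already forces the quadratic coefficient to vanish.\<close>

lemma critical_scaling_three_quarters:
  assumes c: "(\<lambda>N. 1 / sqrt (p N ^ 4 * real N ^ 3)) \<longlonglongrightarrow> c" "c \<ge> 0" and p0: "c > 0 \<Longrightarrow> p \<longlonglongrightarrow> 0"
  shows "critical_scaling p (\<lambda>N. coupling N (p N)) (\<lambda>N. 1 / real N powr (3/4)) (c / 24) 1"
proof -
  let ?b = "\<lambda>N. coupling N (p N)" and ?s = "\<lambda>N. 1 / real N powr (3/4)"
  have s2: "(?s N)\<^sup>2 = 1 / (real N * sqrt (real N))" and s4: "(?s N)^4 = 1 / real N ^ 3" if "N \<ge> 1" for N
  proof -
    have "(real N powr (3/4))\<^sup>2 = real N powr (1 + 1/2)" using that by (simp add: powr_power)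
    also have "\<dots> = real N * sqrt (real N)" using that by (subst powr_add) (simp add: powr_half_sqrt)
    finally show "(?s N)\<^sup>2 = 1 / (real N * sqrt (real N))" by (simp add: power_divide)
    have "(real N powr (3/4))^4 = real N powr 3" using that by (simp add: powr_power)
    then show "(?s N)^4 = 1 / real N ^ 3" using that by (simp add: power_divide powr_numeral)
  qed
  have sqrt_gamma: "sqrt (real N) * (\<gamma> N)\<^sup>2 = 1 / 4 * (1 / sqrt (p N ^ 4 * real N ^ 3))" if "N \<ge> 1" for N
  proof -
    have "p N ^ 4 * real N ^ 3 = (p N * p N * real N)\<^sup>2 * real N" by (simp add: power2_eq_square power3_eq_cube power4_eq_xxxx)
    then have "sqrt (p N ^ 4 * real N ^ 3) = p N * p N * real N * sqrt (real N)"
      using p[OF that] by (simp add: real_sqrt_mult real_sqrt_abs)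
    moreover have "sqrt (real N) * sqrt (real N) = real N" by simp
    ultimately show ?thesis
      using that p[OF that] by (simp add: \<gamma>_def power2_eq_square field_simps)
  qed
  have sg: "(\<lambda>N. sqrt (real N) * (\<gamma> N)\<^sup>2) \<longlonglongrightarrow> c / 4"
  proof -
    have "(\<lambda>N. 1 / 4 * (1 / sqrt (p N ^ 4 * real N ^ 3))) \<longlonglongrightarrow> 1 / 4 * c" by (intro tendsto_intros c)
    moreover have "\<forall>\<^sub>F N in sequentially. 1 / 4 * (1 / sqrt (p N ^ 4 * real N ^ 3)) = sqrt (real N) * (\<gamma> N)\<^sup>2"
      using eventually_ge_at_top[of 1] by eventually_elim (simp add: sqrt_gamma)
    ultimately show ?thesis by (simp add: tendsto_cong)
  qed
  have sd: "(\<lambda>N. sqrt (real N) * deficit N (p N)) \<longlonglongrightarrow> c / 12"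
  proof (cases "c > 0")
    case True
    from tendsto_mult[OF deficit_quadratic[OF p0[OF True]] sg]
    have "(\<lambda>N. deficit N (p N) / (\<gamma> N)\<^sup>2 * (sqrt (real N) * (\<gamma> N)\<^sup>2)) \<longlonglongrightarrow> c / 12" by simp
    moreover have "\<forall>\<^sub>F N in sequentially. deficit N (p N) / (\<gamma> N)\<^sup>2 * (sqrt (real N) * (\<gamma> N)\<^sup>2) = sqrt (real N) * deficit N (p N)"
      using eventually_ge_at_top[of 1]
    proof eventually_elim
      case (elim N) then show ?case using gamma_pos[OF elim] by simp
    qed
    ultimately show ?thesis by (simp add: tendsto_cong)
  next
    case False
    then have "c = 0" using c by simp
    have "(\<lambda>N. sqrt (real N) * deficit N (p N)) \<longlonglongrightarrow> 0"
    proof (rule tendsto_sandwich[where f = "\<lambda>_. 0"])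
      show "(\<lambda>N. (1 - tanh (\<gamma> N) / \<gamma> N) / (\<gamma> N)\<^sup>2 * (sqrt (real N) * (\<gamma> N)\<^sup>2)) \<longlonglongrightarrow> 0"
        using tendsto_mult[OF tanh_gamma sg] \<open>c = 0\<close> by simp
      show "\<forall>\<^sub>F N in sequentially. sqrt (real N) * deficit N (p N) \<le> (1 - tanh (\<gamma> N) / \<gamma> N) / (\<gamma> N)\<^sup>2 * (sqrt (real N) * (\<gamma> N)\<^sup>2)"
        using eventually_ge_at_top[of 1]
      proof eventually_elim
        case (elim N)
        have "sqrt (real N) * deficit N (p N) \<le> sqrt (real N) * (1 - tanh (\<gamma> N) / \<gamma> N)"
          using deficit_bounds[OF elim] by (intro mult_left_mono) auto
        then show ?case using gamma_pos[OF elim] by (simp add: mult.commute)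
      qed
      show "\<forall>\<^sub>F N in sequentially. 0 \<le> sqrt (real N) * deficit N (p N)"
        using eventually_ge_at_top[of 1] by eventually_elim (simp add: deficit_bounds)
    qed simp
    then show ?thesis using \<open>c = 0\<close> by simp
  qed
  show ?thesis
  proof
    show "0 < p N \<and> p N \<le> 1" if "N \<ge> 1" for N using p[OF that] .
    show "0 < ?s N" if "N \<ge> 1" for N using that by simp
    show "0 < ?b N" if "N \<ge> 1" for N using coupling_pos[OF that] p[OF that] by simp
    show "2 * real N * ?b N \<le> 1" if "N \<ge> 1" for N using coupling_bounds(1)[OF that] p[OF that] by simp
    show "filterlim (\<lambda>N. real N * p N) at_top sequentially" by (rule Np)
    show "(\<lambda>N. (?s N)\<^sup>2 / ?b N) \<longlonglongrightarrow> 0"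
    proof -
      have "filterlim (\<lambda>N. sqrt (real N)) at_top sequentially" by real_asymp
      from tendsto_mult[OF tendsto_inverse_0_at_top[OF this] tendsto_inverse[OF coupling_tendsto]]
      have "(\<lambda>N. 2 * (inverse (sqrt (real N)) * inverse (2 * real N * ?b N))) \<longlonglongrightarrow> 2 * 0"
        by (intro tendsto_mult[OF tendsto_const]) simp
      moreover have "\<forall>\<^sub>F N in sequentially. 2 * (inverse (sqrt (real N)) * inverse (2 * real N * ?b N)) = (?s N)\<^sup>2 / ?b N"
        using eventually_ge_at_top[of 1]
      proof eventually_elim
        case (elim N) then show ?case unfolding s2[OF elim] by (simp add: inverse_eq_divide mult_ac)
      qed
      ultimately show ?thesis by (simp add: tendsto_cong)
    qed
    show "(\<lambda>N. real N * (2 * ?b N / ?s N)^4) \<longlonglongrightarrow> 1"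
    proof -
      have "(\<lambda>N. (2 * real N * ?b N)^4) \<longlonglongrightarrow> 1^4" by (intro tendsto_intros coupling_tendsto)
      moreover have "\<forall>\<^sub>F N in sequentially. (2 * real N * ?b N)^4 = real N * (2 * ?b N / ?s N)^4"
        using eventually_ge_at_top[of 1]
      proof eventually_elim
        case (elim N)
        show ?case unfolding power_divide[of _ "?s N"] s4[OF elim]
          by (simp add: power_mult_distrib power3_eq_cube power4_eq_xxxx)
      qed
      ultimately show ?thesis by (simp add: tendsto_cong)
    qed
    show "(\<lambda>N. (1 - 2 * real N * ?b N) * ?b N / (?s N)\<^sup>2) \<longlonglongrightarrow> c / 24"
    proof -
      have "(\<lambda>N. sqrt (real N) * deficit N (p N) * (2 * real N * ?b N) / 2) \<longlonglongrightarrow> c / 12 * 1 / 2"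
        by (intro tendsto_intros sd coupling_tendsto) simp
      moreover have "\<forall>\<^sub>F N in sequentially. sqrt (real N) * deficit N (p N) * (2 * real N * ?b N) / 2 = (1 - 2 * real N * ?b N) * ?b N / (?s N)\<^sup>2"
        using eventually_ge_at_top[of 1]
      proof eventually_elim
        case (elim N) then show ?case unfolding s2[OF elim] by (simp add: deficit_def)
      qed
      ultimately show ?thesis by (simp add: tendsto_cong)
    qed
  qed simp
qed

text \<open>At scale \<open>N\<^bsup>3/2\<^esup> p\<close>, which is now shorter than \<open>N\<^bsup>3/4\<^esup>\<close>, the quadratic term already confines the
magnetization and the quartic coefficient is of order \<open>p\<^sup>4 N\<^sup>3\<close>.\<close>

lemma critical_scaling_sparse:
  assumes p4: "(\<lambda>N. p N ^ 4 * real N ^ 3) \<longlonglongrightarrow> 0" and p0: "p \<longlonglongrightarrow> 0"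
  shows "critical_scaling p (\<lambda>N. coupling N (p N)) (\<lambda>N. 1 / sqrt (real N ^ 3 * (p N)\<^sup>2)) (1 / 24) 0"
proof -
  let ?b = "\<lambda>N. coupling N (p N)" and ?s = "\<lambda>N. 1 / sqrt (real N ^ 3 * (p N)\<^sup>2)"
  have s2: "(?s N)\<^sup>2 = 1 / (real N ^ 3 * (p N)\<^sup>2)" and s4: "(?s N)^4 = 1 / (real N ^ 3 * (p N)\<^sup>2)\<^sup>2" for N
  proof -
    show 1: "(?s N)\<^sup>2 = 1 / (real N ^ 3 * (p N)\<^sup>2)" by (simp add: power_divide)
    have "(?s N)^4 = ((?s N)\<^sup>2)\<^sup>2" by (simp only: power_mult[symmetric]) simp
    then show "(?s N)^4 = 1 / (real N ^ 3 * (p N)\<^sup>2)\<^sup>2" unfolding 1 by (simp add: power_divide)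
  qed
  show ?thesis
  proof
    show "0 < p N \<and> p N \<le> 1" if "N \<ge> 1" for N using p[OF that] .
    show "0 < ?s N" if "N \<ge> 1" for N using that p[OF that] by simp
    show "0 < ?b N" if "N \<ge> 1" for N using coupling_pos[OF that] p[OF that] by simp
    show "2 * real N * ?b N \<le> 1" if "N \<ge> 1" for N using coupling_bounds(1)[OF that] p[OF that] by simp
    show "filterlim (\<lambda>N. real N * p N) at_top sequentially" by (rule Np)
    show "(\<lambda>N. (?s N)\<^sup>2 / ?b N) \<longlonglongrightarrow> 0"
    proof -
      have "(\<lambda>N. 2 * (inverse (real N * p N))\<^sup>2 * inverse (2 * real N * ?b N)) \<longlonglongrightarrow> 2 * 0\<^sup>2 * inverse 1"
        by (intro tendsto_intros tendsto_inverse_0_at_top[OF Np] coupling_tendsto) simp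
      moreover have "\<forall>\<^sub>F N in sequentially. 2 * (inverse (real N * p N))\<^sup>2 * inverse (2 * real N * ?b N) = (?s N)\<^sup>2 / ?b N"
        using eventually_ge_at_top[of 1]
      proof eventually_elim
        case (elim N) then show ?case unfolding s2 by (simp add: inverse_eq_divide power2_eq_square power3_eq_cube mult_ac)
      qed
      ultimately show ?thesis by (simp add: tendsto_cong)
    qed
    show "(\<lambda>N. real N * (2 * ?b N / ?s N)^4) \<longlonglongrightarrow> 0"
    proof -
      have "(\<lambda>N. (2 * real N * ?b N)^4 * (p N ^ 4 * real N ^ 3)) \<longlonglongrightarrow> 1^4 * 0"
        by (intro tendsto_intros coupling_tendsto p4)
      moreover have "\<forall>\<^sub>F N in sequentially. (2 * real N * ?b N)^4 * (p N ^ 4 * real N ^ 3) = real N * (2 * ?b N / ?s N)^4"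
        using eventually_ge_at_top[of 1]
      proof eventually_elim
        case (elim N)
        show ?case unfolding power_divide[of _ "?s N"] s4
          by (simp add: power_mult_distrib power2_eq_square power3_eq_cube power4_eq_xxxx)
      qed
      ultimately show ?thesis by (simp add: tendsto_cong)
    qed
    show "(\<lambda>N. (1 - 2 * real N * ?b N) * ?b N / (?s N)\<^sup>2) \<longlonglongrightarrow> 1 / 24"
    proof -
      have "(\<lambda>N. deficit N (p N) / (\<gamma> N)\<^sup>2 * (2 * real N * ?b N) / 8) \<longlonglongrightarrow> 1 / 3 * 1 / 8"
        by (intro tendsto_intros deficit_quadratic p0 coupling_tendsto) simp
      moreover have "\<forall>\<^sub>F N in sequentially. deficit N (p N) / (\<gamma> N)\<^sup>2 * (2 * real N * ?b N) / 8 = (1 - 2 * real N * ?b N) * ?b N / (?s N)\<^sup>2"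
        using eventually_ge_at_top[of 1]
      proof eventually_elim
        case (elim N) then show ?case unfolding s2
          by (simp add: deficit_def \<gamma>_def power_divide power2_eq_square power3_eq_cube)
      qed
      ultimately show ?thesis by (simp add: tendsto_cong)
    qed
  qed simp
qed

end

lemma limit_law_quartic: "limit_law 0 1 = quartic_law"
  by (simp add: limit_law_def limit_density_def quartic_law_def)

lemma limit_law_quartic_tilted: "limit_law (c / 24) 1 = quartic_law_tilted c"
  by (simp add: limit_law_def limit_density_def quartic_law_tilted_def)

lemma limit_law_normal: "limit_law (1 / 24) 0 = centered_normal 12"
proof -
  have nd: "normal_density 0 (sqrt 12) x = 1 / sqrt (24 * pi) * limit_density (1 / 24) 0 x" for x
    by (simp add: normal_density_def limit_density_def)
  have "1 = (LINT x|lborel. 1 / sqrt (24 * pi) * limit_density (1 / 24) 0 x)"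
    unfolding nd[symmetric] by simp
  then have "(LINT x|lborel. limit_density (1 / 24) 0 x) = sqrt (24 * pi)"
    by (simp add: field_simps)
  then show ?thesis
    unfolding limit_law_def centered_normal_def nd by simp
qed

lemma tendsto_0_of_power4:
  fixes p :: "nat \<Rightarrow> real"
  assumes p: "\<And>N. N \<ge> 1 \<Longrightarrow> 0 < p N" and lim: "(\<lambda>N. p N ^ 4 * real N ^ 3) \<longlonglongrightarrow> l"
  shows "p \<longlonglongrightarrow> 0"
proof -
  have "(\<lambda>N. p N ^ 4 * real N ^ 3 * inverse (real N) ^ 3) \<longlonglongrightarrow> l * 0 ^ 3"
    by (intro tendsto_intros lim lim_inverse_n)
  moreover have "\<forall>\<^sub>F N in sequentially. p N ^ 4 * real N ^ 3 * inverse (real N) ^ 3 = p N ^ 4"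
    using eventually_ge_at_top[of 1] by eventually_elim (simp add: power_inverse)
  ultimately have "(\<lambda>N. p N ^ 4) \<longlonglongrightarrow> 0" by (simp add: tendsto_cong)
  then have "(\<lambda>N. root 4 (p N ^ 4)) \<longlonglongrightarrow> root 4 0" by (rule tendsto_real_root)
  moreover have "\<forall>\<^sub>F N in sequentially. root 4 (p N ^ 4) = p N"
    using eventually_ge_at_top[of 1]
    by eventually_elim (use p in \<open>auto intro!: real_root_power_cancel less_imp_le\<close>)
  ultimately show ?thesis by (simp add: tendsto_cong)
qed

text \<open>From \<open>(N p)\<^sup>4 = N * (p\<^sup>4 N\<^sup>3)\<close>.\<close>

lemma mean_degree_at_top:
  fixes p :: "nat \<Rightarrow> real"
  assumes p: "\<And>N. N \<ge> 1 \<Longrightarrow> 0 < p N" and lim: "filterlim (\<lambda>N. p N ^ 4 * real N ^ 3) at_top sequentially"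
  shows "filterlim (\<lambda>N. real N * p N) at_top sequentially"
  unfolding filterlim_at_top
proof
  fix C :: real
  have "\<forall>\<^sub>F N in sequentially. \<bar>C\<bar> ^ 4 \<le> p N ^ 4 * real N ^ 3"
    using lim by (simp add: filterlim_at_top)
  then show "\<forall>\<^sub>F N in sequentially. C \<le> real N * p N"
    using eventually_ge_at_top[of 1]
  proof eventually_elim
    case (elim N)
    have "p N ^ 4 * real N ^ 3 * 1 \<le> p N ^ 4 * real N ^ 3 * real N"
      using elim(2) by (intro mult_left_mono) auto
    then have "\<bar>C\<bar> ^ 4 \<le> (real N * p N) ^ 4"
      using elim(1) by (simp add: power_mult_distrib power3_eq_cube power4_eq_xxxx mult_ac)
    then have "\<bar>C\<bar> \<le> real N * p N"
      using p[OF elim(2)] by (subst (asm) power_mono_iff) auto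
    then show ?case by simp
  qed
qed

text \<open>The dense regime is the case \<open>c = 0\<close> of the intermediate one; its hypothesis implies that \<open>N p\<close> diverges.\<close>

theorem theorem1p2:
  fixes M :: "nat \<Rightarrow> 'a measure"
    and p :: "nat \<Rightarrow> real"
    and eps :: "nat \<Rightarrow> nat \<Rightarrow> nat \<Rightarrow> 'a \<Rightarrow> real"
  assumes p: "\<And>N. N \<ge> 1 \<Longrightarrow> 0 < p N \<and> p N \<le> 1"
    and prob: "\<And>N. N \<ge> 1 \<Longrightarrow> prob_space (M N)"
    and indep: "\<And>N. N \<ge> 1 \<Longrightarrow>
      prob_space.indep_vars (M N) (\<lambda>_. borel) (\<lambda>(i, j). eps N i j) ({1..N} \<times> {1..N})"
    and one: "\<And>N i j. i \<in> {1..N} \<Longrightarrow> j \<in> {1..N} \<Longrightarrow>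
      measure (M N) {\<omega> \<in> space (M N). eps N i j \<omega> = 1} = p N"
    and zero: "\<And>N i j. i \<in> {1..N} \<Longrightarrow> j \<in> {1..N} \<Longrightarrow>
      measure (M N) {\<omega> \<in> space (M N). eps N i j \<omega> = 0} = 1 - p N"
  shows
    "(filterlim (\<lambda>N. p N ^ 4 * real N ^ 3) at_top sequentially \<longrightarrow>
        levy_tendsto_in_prob M (\<lambda>N \<omega>. L1 1 N (p N) (\<lambda>i j. eps N i j \<omega>)) quartic_law) \<and>
     (\<forall>c>0. filterlim (\<lambda>N. real N * p N) at_top sequentially \<and>
        (\<lambda>N. p N ^ 4 * real N ^ 3) \<longlonglongrightarrow> 1 / c\<^sup>2 \<longrightarrow>
        levy_tendsto_in_prob M (\<lambda>N \<omega>. L1 1 N (p N) (\<lambda>i j. eps N i j \<omega>)) (quartic_law_tilted c)) \<and>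
     (filterlim (\<lambda>N. real N * p N) at_top sequentially \<and>
        (\<lambda>N. p N ^ 4 * real N ^ 3) \<longlonglongrightarrow> 0 \<longrightarrow>
        levy_tendsto_in_prob M (\<lambda>N \<omega>. L3 1 N (p N) (\<lambda>i j. eps N i j \<omega>)) (centered_normal 12))"
proof (intro conjI allI impI)
  have p_pos: "\<And>N. N \<ge> 1 \<Longrightarrow> 0 < p N" using p by blast
  {
    assume lim: "filterlim (\<lambda>N. p N ^ 4 * real N ^ 3) at_top sequentially"
    have "(\<lambda>N. 1 / sqrt (p N ^ 4 * real N ^ 3)) \<longlonglongrightarrow> 0"
      using tendsto_inverse_0_at_top[OF filterlim_compose[OF sqrt_at_top lim]] by (simp add: divide_inverse)
    then interpret critical_scaling p "\<lambda>N. coupling N (p N)" "\<lambda>N. 1 / real N powr (3/4)" "0 / 24" 1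
      by (intro critical_scaling_three_quarters p mean_degree_at_top[OF p_pos lim]) auto
    show "levy_tendsto_in_prob M (\<lambda>N \<omega>. L1 1 N (p N) (\<lambda>i j. eps N i j \<omega>)) quartic_law"
      using magnetization_law_converges[OF refl prob indep one zero]
      unfolding L1_def by (simp add: limit_law_quartic)
  next
    fix c :: real
    assume c: "c > 0" and lim: "filterlim (\<lambda>N. real N * p N) at_top sequentially \<and>
        (\<lambda>N. p N ^ 4 * real N ^ 3) \<longlonglongrightarrow> 1 / c\<^sup>2"
    have "(\<lambda>N. 1 / sqrt (p N ^ 4 * real N ^ 3)) \<longlonglongrightarrow> 1 / sqrt (1 / c\<^sup>2)"
      using lim c by (intro tendsto_intros) auto
    then have "(\<lambda>N. 1 / sqrt (p N ^ 4 * real N ^ 3)) \<longlonglongrightarrow> c"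
      using c by (simp add: real_sqrt_divide)
    then interpret critical_scaling p "\<lambda>N. coupling N (p N)" "\<lambda>N. 1 / real N powr (3/4)" "c / 24" 1
      using lim c by (intro critical_scaling_three_quarters p tendsto_0_of_power4[OF p_pos]) auto
    show "levy_tendsto_in_prob M (\<lambda>N \<omega>. L1 1 N (p N) (\<lambda>i j. eps N i j \<omega>)) (quartic_law_tilted c)"
      using magnetization_law_converges[OF refl prob indep one zero]
      unfolding L1_def by (simp add: limit_law_quartic_tilted)
  next
    assume lim: "filterlim (\<lambda>N. real N * p N) at_top sequentially \<and>
        (\<lambda>N. p N ^ 4 * real N ^ 3) \<longlonglongrightarrow> 0"
    interpret critical_scaling p "\<lambda>N. coupling N (p N)" "\<lambda>N. 1 / sqrt (real N ^ 3 * (p N)\<^sup>2)" "1 / 24" 0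
      using lim by (intro critical_scaling_sparse p tendsto_0_of_power4[OF p_pos]) auto
    show "levy_tendsto_in_prob M (\<lambda>N \<omega>. L3 1 N (p N) (\<lambda>i j. eps N i j \<omega>)) (centered_normal 12)"
      using magnetization_law_converges[OF refl prob indep one zero]
      unfolding L3_def by (simp add: limit_law_normal)
  }
qed

end
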